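(* Let $\mathcal{G}$ be the random rooted tree, with root $\rho$, generated by a branching process in which the numbers of offspring of the individuals are i.i.d. non-negative integer-valued random variables with mean $m$, where $1/0.36<m<\infty$. Let $\mathbf{X}=\{X_t,t\ge0\}$ be the vertex-reinforced jump process on $\mathcal{G}$ with $X_0=\rho$. Then $\mathbf{X}$ is transient.
   Context: Tree: $\mathcal{G}$ is the genealogical (Galton–Watson) tree of a branching process started from a single individual $\rho$ (the root). Vertex-reinforced jump process (VRJP) on a locally finite graph: a right-continuous, continuous-time process $X_t$ taking values in the vertices and jumping only to nearest neighbors, such that, given $X_s$ for $0\le s\le t$ and $X_t=x$, the conditional probability that in the interval $(t,t+dt)$ the process jumps to the nearest neighbor $y$ of $x$ is $L(y,t)\,dt$, where $L(y,t):=1+\int_0^t \mathbf{1}_{\{X_s=y\}}\,ds$. On the random tree $\mathcal{G}$, the process has this law conditionally on $\mathcal{G}$; if $\rho$ has no children, the process stays at $\rho$ forever. Terminology: the process is transient if, with positive probability (with respect to the joint law of tree and process), it does not return to its starting point, i.e. it leaves $\rho$ and none of its subsequent jumps is to $\rho$. *)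

theory Defs
  imports "HOL-Probability.Probability"
begin

section \<open>Galton--Watson trees\<close>

text \<open>
  Individuals carry Ulam--Harris labels: the root is the empty list, and the children of the
  individual \<open>u\<close> are \<open>u @ [i]\<close> for \<open>i < N u\<close>, where \<open>N u\<close> is the number of offspring of \<open>u\<close>.
\<close>

inductive_set gw_tree :: "(nat list \<Rightarrow> nat) \<Rightarrow> nat list set"
  for N :: "nat list \<Rightarrow> nat" where
  root: "[] \<in> gw_tree N"
| child: "u \<in> gw_tree N \<Longrightarrow> i < N u \<Longrightarrow> u @ [i] \<in> gw_tree N"

definition tree_adj :: "nat list set \<Rightarrow> nat list \<Rightarrow> nat list \<Rightarrow> bool" where
  "tree_adj T u v \<longleftrightarrow> u \<in> T \<and> v \<in> T \<and> (\<exists>i. v = u @ [i] \<or> u = v @ [i])"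

text \<open>
  An offspring number is attached to every word, also to those outside the tree; this does not affect
  the law of the tree.
\<close>

definition iid_offspring :: "'w measure \<Rightarrow> nat pmf \<Rightarrow> (nat list \<Rightarrow> 'w \<Rightarrow> nat) \<Rightarrow> bool" where
  "iid_offspring M p N \<longleftrightarrow>
     prob_space.indep_vars M (\<lambda>_. count_space UNIV) N UNIV \<and>
     (\<forall>u. distr M (count_space UNIV) (N u) = measure_pmf p)"


section \<open>Paths of jump processes\<close>

text \<open>
  Paths are functions on the reals of which only the restriction to \<open>[0, \<infinity>)\<close> matters; the
  vertices carry the discrete topology, so that continuity at a time means being constant near it.
\<close>

definition jump_times :: "(real \<Rightarrow> 'v) \<Rightarrow> 'v \<Rightarrow> 'v \<Rightarrow> real set" where
  "jump_times x u v = {t. 0 < t \<and> u \<noteq> v \<and> (\<forall>\<^sub>F s in at_left t. x s = u) \<and> x t = v}"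

text \<open>
  The existence of a left limit at every time, without which a jump from one vertex to another
  is meaningless, entails that there are finitely many jumps in each bounded time interval.
\<close>

definition nearest_neighbor_path :: "('v \<Rightarrow> 'v \<Rightarrow> bool) \<Rightarrow> (real \<Rightarrow> 'v) \<Rightarrow> bool" where
  "nearest_neighbor_path adj x \<longleftrightarrow>
     (\<forall>t\<ge>0. \<forall>\<^sub>F s in at_right t. x s = x t) \<and>
     (\<forall>t>0. \<exists>u. (\<forall>\<^sub>F s in at_left t. x s = u) \<and> (x t = u \<or> adj u (x t)))"

definition local_time :: "(real \<Rightarrow> 'v) \<Rightarrow> 'v \<Rightarrow> real \<Rightarrow> real" where
  "local_time x y t = 1 + (LINT s:{0..t}|lborel. indicator {y} (x s))"


section \<open>Vertex-reinforced jump processes\<close>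

text \<open>
  The information available at time \<open>t\<close>: the (possibly random) graph and the path up to \<open>t\<close>.
  Putting the graph into the initial sigma-algebra amounts to conditioning on it.
\<close>

definition history ::
  "'w measure \<Rightarrow> ('w \<Rightarrow> 'v \<Rightarrow> 'v \<Rightarrow> bool) \<Rightarrow> (real \<Rightarrow> 'w \<Rightarrow> 'v) \<Rightarrow> real \<Rightarrow> 'w measure" where
  "history M adj X t = sigma (space M)
     ({{\<omega> \<in> space M. adj \<omega> u v} | u v. True} \<union>
      {{\<omega> \<in> space M. X s \<omega> = v} | s v. 0 \<le> s \<and> s \<le> t})"

text \<open>
  The infinitesimal description ``given the history up to time \<open>t\<close> and \<open>X t = x\<close>, the process jumps
  to the neighbor \<open>y\<close> during \<open>(t, t + dt)\<close> with probability \<open>L(y, t) dt\<close>'' says that the jumps from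
  \<open>x\<close> to \<open>y\<close> have stochastic intensity \<open>L(y, t)\<close> while the process is at \<open>x\<close>.  It is expressed in
  integrated form: conditionally on the history up to \<open>s\<close>, the expected number of jumps from \<open>x\<close> to
  \<open>y\<close> during \<open>(s, t]\<close> is the expected integral of that intensity over \<open>(s, t]\<close>.  (Requiring only
  right derivatives at each fixed time would not rule out forced jumps at deterministic times.)
  Both sides are finite, because \<open>L(y, t) \<le> 1 + t\<close>.
\<close>

locale vrjp = prob_space M for M :: "'w measure" +
  fixes adj :: "'w \<Rightarrow> 'v :: countable \<Rightarrow> 'v \<Rightarrow> bool"
    and x0 :: 'v
    and X :: "real \<Rightarrow> 'w \<Rightarrow> 'v"
  assumes adj_measurable: "Measurable.pred M (\<lambda>\<omega>. adj \<omega> u v)"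
    and adj_sym: "\<omega> \<in> space M \<Longrightarrow> adj \<omega> u v \<Longrightarrow> adj \<omega> v u"
    and adj_irrefl: "\<omega> \<in> space M \<Longrightarrow> \<not> adj \<omega> u u"
    and locally_finite: "\<omega> \<in> space M \<Longrightarrow> finite {v. adj \<omega> u v}"
    and X_measurable: "0 \<le> t \<Longrightarrow> X t \<in> measurable M (count_space UNIV)"
    and X_start: "\<omega> \<in> space M \<Longrightarrow> X 0 \<omega> = x0"
    and X_path: "\<omega> \<in> space M \<Longrightarrow> nearest_neighbor_path (adj \<omega>) (\<lambda>t. X t \<omega>)"
    and X_intensity: "0 \<le> s \<Longrightarrow> s \<le> t \<Longrightarrow>
      AE \<omega> in M.
        nn_cond_exp M (history M adj X s)
          (\<lambda>\<omega>. of_nat (card (jump_times (\<lambda>r. X r \<omega>) x y \<inter> {s<..t}))) \<omega> =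
        nn_cond_exp M (history M adj X s)
          (\<lambda>\<omega>. \<integral>\<^sup>+ r \<in> {s<..t}. (if X r \<omega> = x \<and> adj \<omega> x y
                                    then ennreal (local_time (\<lambda>r. X r \<omega>) y r) else 0) \<partial>lborel) \<omega>"

definition leaves_forever :: "(real \<Rightarrow> 'v) \<Rightarrow> bool" where
  "leaves_forever x \<longleftrightarrow>
     (\<exists>t>0. (\<forall>s\<in>{0..<t}. x s = x 0) \<and> x t \<noteq> x 0 \<and> (\<forall>s>t. \<forall>u. s \<notin> jump_times x u (x 0)))"

definition transient :: "'w measure \<Rightarrow> (real \<Rightarrow> 'w \<Rightarrow> 'v) \<Rightarrow> bool" where
  "transient M X \<longleftrightarrow> 0 < measure M {\<omega> \<in> space M. leaves_forever (\<lambda>t. X t \<omega>)}"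

end

theory Submission
  imports Defs
begin

text \<open>
  Only visits made before the first return to the parent are exploited.  For a vertex at which time
  \<open>a\<close> has been spent, and whose parent carries time \<open>t\<close>, a new child is entered at rate \<open>1\<close> and the
  parent at rate \<open>1 + t\<close>; if a child entered when the time at its parent is \<open>a\<close> escapes with
  probability proportional to \<open>exp (- a / 2)\<close>, integrating over the entrance time gives for the
  vertex itself the escape weight \<open>1 / (2.5 + t) \<ge> 0.4 exp (- t / 2)\<close> per child.  So weights \<open>c\<close> on
  the tree with \<open>c u \<le> 0.36 * (sum of c over the children of u)\<close>, small enough that second order
  effects are absorbed in passing from \<open>0.4\<close> to \<open>0.36\<close>, yield an explicit supermartingale: the
  product over the ancestors of the current vertex of \<open>1\<close> minus the escape weight of the children not
  yet visited.  It equals \<open>1\<close> on returning to the root and starts below \<open>1\<close> wherever \<open>c\<close> is positive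
  at the root.  Such weights come from the survival probabilities of the subtrees under bond
  percolation with retention probability \<open>0.36\<close>, which are not all zero because \<open>0.36 * m > 1\<close>.

  The supermartingale property is derived from the integrated form of the jump intensities by
  telescoping along equidistant grids: on a fine grid each interval contains at most one jump, so the
  discretised compensated sums converge along every path.  The process is killed on leaving a finite
  set of words, which makes the number of jumps integrable and can only decrease the supermartingale.
\<close>

section \<open>Jumps of a path\<close>

text \<open>The form \<open>exp (- a / 2) / (2.5 + t)\<close> of the escape weight is dictated by a
  balance at the current vertex: per unit of weight, waiting raises the function at rate 1/2, the
  move to the parent at rate \<open>1 + t\<close>, and the new children take their shares of the
  weight away, which in total counts 1; the new subtrees have to pay for the sum
  \<open>2.5 + t\<close>. With \<open>exp (- r * a)\<close> the denominator would be
  \<open>2 + r + t\<close>, and replacing \<open>(2 + r) / (2 + r + t)\<close> by the smaller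
  \<open>exp (- r * t)\<close> requires r \<ge> sqrt 2 - 1, so 1/2 is a simple admissible rate.

  Families may be unbounded, yet both the smallness of the weight of a whole family and the lower
  bound for the survival probability need bounded ones. Hence only the first \<open>B\<close>
  children carry weight, while the process still moves on all of them; the set outside which it is
  killed grows with a separate parameter \<open>K\<close>, sent to infinity at a fixed time. The
  weights depend on the graph alone and the history contains the graph, so they are known at time 0
  and no conditioning on the tree is carried out.\<close>

definition path_jumps :: "(real \<Rightarrow> 'v) \<Rightarrow> real set" where
  "path_jumps x = {r. 0 < r \<and> \<not> (\<forall>\<^sub>F s in at_left r. x s = x r)}"

locale jump_path =
  fixes adj :: "'v \<Rightarrow> 'v \<Rightarrow> bool" and x :: "real \<Rightarrow> 'v"
  assumes nn: "nearest_neighbor_path adj x"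
begin

lemma right_const: "0 \<le> t \<Longrightarrow> \<forall>\<^sub>F s in at_right t. x s = x t"
  using nn by (auto simp: nearest_neighbor_path_def)

lemma left_limit:
  assumes "0 < t"
  obtains u where "\<forall>\<^sub>F s in at_left t. x s = u" "x t = u \<or> adj u (x t)"
  using nn assms by (auto simp: nearest_neighbor_path_def)

text \<open>Every time has a neighbourhood in which it is the only possible jump, because the path
  is constant just before and just after it; compactness of \<open>{0..t}\<close> leaves finitely
  many.\<close>

lemma finite_path_jumps: "finite (path_jumps x \<inter> {0..t})"
proof -
  have loc: "\<exists>e>0. \<forall>r\<in>path_jumps x \<inter> ball p e. r = p" if p: "p \<in> {0..t}" for p
  proof -
    from p have "0 \<le> p" by simp
    from right_const[OF this] obtain b where b: "b > p" "\<And>s. p < s \<Longrightarrow> s < b \<Longrightarrow> x s = x p"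
      by (auto simp: eventually_at_right_field)
    \<comment> \<open>There is no left limit at time 0; the guard \<open>0 < s\<close> lets any
      negative \<open>a\<close> serve there.\<close>
    have "\<exists>a<p. \<forall>s. a < s \<and> s < p \<and> 0 < s \<longrightarrow> s \<notin> path_jumps x"
    proof (cases "p = 0")
      case True
      then show ?thesis by (intro exI[of _ "-1"]) auto
    next
      case False
      with \<open>0 \<le> p\<close> have "0 < p" by simp
      then obtain u where "\<forall>\<^sub>F s in at_left p. x s = u" by (rule left_limit)
      then obtain a where a: "a < p" "\<And>s. a < s \<Longrightarrow> s < p \<Longrightarrow> x s = u"
        by (auto simp: eventually_at_left_field)
      have "s \<notin> path_jumps x" if "a < s" "s < p" for s
      proof -
        have "\<forall>\<^sub>F q in at_left s. x q = x s"
          unfolding eventually_at_left_field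
          using a that by (intro exI[of _ a]) auto
        then show ?thesis by (auto simp: path_jumps_def)
      qed
      with a show ?thesis by blast
    qed
    then obtain a where a: "a < p" "\<And>s. a < s \<Longrightarrow> s < p \<Longrightarrow> 0 < s \<Longrightarrow> s \<notin> path_jumps x" by blast
    have right: "s \<notin> path_jumps x" if "p < s" "s < b" for s
    proof -
      have "\<forall>\<^sub>F q in at_left s. x q = x s"
        unfolding eventually_at_left_field
        using b that by (intro exI[of _ p]) auto
      then show ?thesis by (auto simp: path_jumps_def)
    qed
    have "r = p" if "r \<in> path_jumps x \<inter> ball p (min (p - a) (b - p))" for r
    proof (rule ccontr)
      assume "r \<noteq> p"
      moreover have "0 < r" "a < r" "r < b" "r \<in> path_jumps x"
        using that by (auto simp: dist_real_def path_jumps_def)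
      ultimately show False using a(2)[of r] right[of r] by (cases "r < p") auto
    qed
    with a b show ?thesis by (intro exI[of _ "min (p - a) (b - p)"]) auto
  qed
  then obtain e where e: "\<And>p. p \<in> {0..t} \<Longrightarrow> e p > 0"
      "\<And>p r. p \<in> {0..t} \<Longrightarrow> r \<in> path_jumps x \<inter> ball p (e p) \<Longrightarrow> r = p"
    by metis
  have "compact {0..t}" by simp
  moreover have "{0..t} \<subseteq> (\<Union>p\<in>{0..t}. ball p (e p))" using e by force
  ultimately obtain C where C: "C \<subseteq> {0..t}" "finite C" "{0..t} \<subseteq> (\<Union>p\<in>C. ball p (e p))"
    using compactE_image[of "{0..t}" "{0..t}" "\<lambda>p. ball p (e p)"] by (metis open_ball)
  have "path_jumps x \<inter> {0..t} \<subseteq> C"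
  proof
    fix r assume r: "r \<in> path_jumps x \<inter> {0..t}"
    with C obtain p where "p \<in> C" "r \<in> ball p (e p)" by auto
    with e(2)[of p r] r C show "r \<in> C" by auto
  qed
  with C show ?thesis using finite_subset by blast
qed

text \<open>Seen from within \<open>{a..b}\<close> the left neighbourhood of \<open>a\<close> is
  invisible, so the path is locally constant on the interval even if it jumps at \<open>a\<close>;
  connectedness does the rest.\<close>

lemma const_no_jump:
  assumes "0 \<le> a" "path_jumps x \<inter> {a<..b} = {}" "s \<in> {a..b}"
  shows "x s = x a"
proof -
  have "\<forall>\<^sub>F q in at r within {a..b}. x r = x q" if r: "r \<in> {a..b}" for r
  proof -
    have R: "\<forall>\<^sub>F q in at_right r. x r = x q"
      by (rule eventually_mono[OF right_const]) (use r assms in auto)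
    show ?thesis
    proof (cases "r = a")
      case True
      from R show ?thesis
        unfolding True eventually_at_filter by (rule eventually_mono) auto
    next
      case False
      then have "r \<notin> path_jumps x" "0 < r" using r assms by auto
      then have "\<forall>\<^sub>F q in at_left r. x q = x r" by (auto simp: path_jumps_def)
      with R have "\<forall>\<^sub>F q in at r. x r = x q"
        unfolding eventually_at_split by (auto intro: eventually_mono[of _ "at_left r"])
      then show ?thesis using at_le[of "{a..b}" UNIV r] by (simp add: filter_leD)
    qed
  qed
  then show ?thesis
    using connected_local_const[of "{a..b}" a s x] assms by fastforce
qed

lemma single_jump:
  assumes "0 \<le> a" "path_jumps x \<inter> {a<..b} = {r}"
  shows "a < r" "r \<le> b" "\<And>s. s \<in> {a..<r} \<Longrightarrow> x s = x a" "\<And>s. s \<in> {r..b} \<Longrightarrow> x s = x r"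
    "adj (x a) (x r)" "x a \<noteq> x r" "\<forall>\<^sub>F s in at_left r. x s = x a"
proof -
  show ar: "a < r" and rb: "r \<le> b" using assms by auto
  show A: "x s = x a" if "s \<in> {a..<r}" for s
  proof (rule const_no_jump[of a s])
    have "path_jumps x \<inter> {a<..s} \<subseteq> path_jumps x \<inter> {a<..b} - {r}" using that rb by auto
    then show "path_jumps x \<inter> {a<..s} = {}" unfolding assms by simp
  qed (use that assms in auto)
  show "x s = x r" if "s \<in> {r..b}" for s
  proof (rule const_no_jump[of r b])
    have "path_jumps x \<inter> {r<..b} \<subseteq> path_jumps x \<inter> {a<..b} - {r}" using ar by auto
    then show "path_jumps x \<inter> {r<..b} = {}" unfolding assms by simp
  qed (use that ar assms in auto)
  show L: "\<forall>\<^sub>F s in at_left r. x s = x a"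
    unfolding eventually_at_left_field by (intro exI[of _ a] conjI ar allI impI A) simp
  have "r \<in> path_jumps x" using assms by auto
  with L show ne: "x a \<noteq> x r" by (auto simp: path_jumps_def)
  have "0 < r" using ar assms by simp
  then obtain u where u: "\<forall>\<^sub>F s in at_left r. x s = u" "x r = u \<or> adj u (x r)" by (rule left_limit)
  have "\<forall>\<^sub>F s in at_left r. u = x a" using u(1) L by eventually_elim simp
  then have "u = x a" by simp
  with u ne show "adj (x a) (x r)" by auto
qed

lemma jump_times_subset: "jump_times x u v \<subseteq> path_jumps x"
proof
  fix r assume r: "r \<in> jump_times x u v"
  { assume "\<forall>\<^sub>F s in at_left r. x s = x r"
    moreover have "\<forall>\<^sub>F s in at_left r. x s = u" using r by (simp add: jump_times_def)
    ultimately have "\<forall>\<^sub>F s in at_left r. x r = u" by eventually_elim simp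
    then have False using r by (auto simp: jump_times_def) }
  with r show "r \<in> path_jumps x" by (auto simp: path_jumps_def jump_times_def)
qed

lemma finite_jump_times: "0 \<le> a \<Longrightarrow> finite (jump_times x u v \<inter> {a<..b})"
  by (rule finite_subset[OF _ finite_path_jumps[of b]]) (use jump_times_subset in fastforce)

lemma jump_times_single:
  assumes "0 \<le> a" "path_jumps x \<inter> {a<..b} = {r}"
  shows "jump_times x u v \<inter> {a<..b} = (if u = x a \<and> v = x r then {r} else {})"
proof -
  note s = single_jump[OF assms]
  have "r \<in> jump_times x u v \<longleftrightarrow> u = x a \<and> v = x r"
  proof
    assume *: "r \<in> jump_times x u v"
    then have "\<forall>\<^sub>F s in at_left r. x s = u" by (simp add: jump_times_def)
    with s(7) have "\<forall>\<^sub>F s in at_left r. u = x a" by eventually_elim simp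
    then show "u = x a \<and> v = x r" using * by (simp add: jump_times_def)
  next
    assume "u = x a \<and> v = x r"
    moreover have "0 < r" using s(1) assms(1) by simp
    ultimately show "r \<in> jump_times x u v" using s(6,7) by (simp add: jump_times_def)
  qed
  moreover have "jump_times x u v \<inter> {a<..b} \<subseteq> {r}" using jump_times_subset assms by blast
  moreover have "r \<in> {a<..b}" using s(1,2) by simp
  ultimately show ?thesis by auto
qed

lemma jump_times_none:
  assumes "path_jumps x \<inter> {a<..b} = {}"
  shows "jump_times x u v \<inter> {a<..b} = {}"
  using assms jump_times_subset by blast

text \<open>The infimum of the times spent in \<open>A\<close> belongs to them by right continuity,
  and the left limit \<open>u\<close> is a value taken earlier, hence outside \<open>A\<close>. This
  locates the edge by which a path enters a subtree, and the jump by which it returns to its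
  start.\<close>

lemma first_entrance:
  assumes "0 \<le> a" "a \<le> b" "x a \<notin> A" "x b \<in> A"
  obtains r u where "a < r" "r \<le> b" "x r \<in> A" "u \<notin> A" "\<forall>\<^sub>F s in at_left r. x s = u" "adj u (x r)"
    "\<exists>q\<in>{a..<r}. x q = u"
proof -
  define S where "S = {s \<in> {a..b}. x s \<in> A}"
  define r where "r = Inf S"
  have S: "S \<noteq> {}" "bdd_below S" using assms by (auto simp: S_def)
  have ra: "a \<le> r" unfolding r_def by (rule cInf_greatest) (use S in \<open>auto simp: S_def\<close>)
  have rb: "r \<le> b" unfolding r_def by (rule cInf_lower) (use S assms in \<open>auto simp: S_def\<close>)
  have xr: "x r \<in> A"
  proof (rule ccontr)
    assume n: "x r \<notin> A"
    from right_const[of r] ra assms obtain d where d: "d > r" "\<And>s. r < s \<Longrightarrow> s < d \<Longrightarrow> x s = x r"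
      by (auto simp: eventually_at_right_field)
    have "d \<le> r" unfolding r_def
    proof (rule cInf_greatest)
      fix s assume s: "s \<in> S"
      then have "r \<le> s" unfolding r_def using S by (intro cInf_lower) auto
      moreover from s have "x s \<in> A" by (simp add: S_def)
      ultimately show "d \<le> s" using n d(2)[of s] by (cases "s = r") force+
    qed (use S in auto)
    with d show False by simp
  qed
  then have ar: "a < r" using ra assms by (cases "a = r") auto
  then have "0 < r" using assms by simp
  then obtain u where u: "\<forall>\<^sub>F s in at_left r. x s = u" "x r = u \<or> adj u (x r)" by (rule left_limit)
  have "\<forall>\<^sub>F s in at_left r. s \<in> {a<..<r}"
    unfolding eventually_at_left_field by (intro exI[of _ a] conjI ar) simp
  with u(1) have "\<forall>\<^sub>F s in at_left r. x s = u \<and> s \<in> {a<..<r}" by eventually_elim simp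
  then obtain q where q: "x q = u" "q \<in> {a<..<r}"
    using eventually_happens'[OF trivial_limit_at_left_real] by blast
  have uA: "u \<notin> A"
  proof
    assume "u \<in> A"
    with q rb have "q \<in> S" by (auto simp: S_def)
    then have "r \<le> q" unfolding r_def using S by (intro cInf_lower) auto
    with q show False by simp
  qed
  then have "adj u (x r)" using u xr by auto
  moreover have "\<exists>q\<in>{a..<r}. x q = u" using q by force
  ultimately show ?thesis using that[of r u] ar rb xr uA u(1) by simp
qed

end

section \<open>Equidistant grids\<close>

lemma sum_card_partition:
  fixes g :: "nat \<Rightarrow> 'a :: linorder"
  assumes "mono g" "finite (A \<inter> {g 0<..g m})"
  shows "(\<Sum>i<m. card (A \<inter> {g i<..g (Suc i)})) = card (A \<inter> {g 0<..g m})"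
  using assms(2)
proof (induction m)
  case (Suc m)
  have le: "g 0 \<le> g m" "g m \<le> g (Suc m)" using assms(1) by (auto intro: monoD)
  have eq: "A \<inter> {g 0<..g (Suc m)} = A \<inter> {g 0<..g m} \<union> A \<inter> {g m<..g (Suc m)}" using le by auto
  have fin: "finite (A \<inter> {g 0<..g m})" "finite (A \<inter> {g m<..g (Suc m)})"
    using Suc.prems unfolding eq by auto
  have "card (A \<inter> {g 0<..g (Suc m)}) = card (A \<inter> {g 0<..g m}) + card (A \<inter> {g m<..g (Suc m)})"
    unfolding eq by (rule card_Un_disjoint) (use fin in auto)
  with Suc.IH fin show ?case by simp
qed simp

definition grid :: "real \<Rightarrow> real \<Rightarrow> nat \<Rightarrow> nat \<Rightarrow> real" where
  "grid a b n i = a + (b - a) * real i / real n"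

lemma grid_0 [simp]: "grid a b n 0 = a"
  by (simp add: grid_def)

lemma grid_n [simp]: "0 < n \<Longrightarrow> grid a b n n = b"
  by (simp add: grid_def)

lemma grid_Suc: "grid a b n (Suc i) - grid a b n i = (b - a) / real n"
  by (simp add: grid_def add_divide_distrib[symmetric] diff_divide_distrib[symmetric]) (simp add: algebra_simps)

lemma mono_grid: "a \<le> b \<Longrightarrow> mono (grid a b n)"
  by (auto simp: mono_def grid_def intro!: divide_right_mono mult_left_mono)

lemma grid_ge: "a \<le> b \<Longrightarrow> a \<le> grid a b n i"
  by (simp add: grid_def)

lemma grid_le: "a \<le> b \<Longrightarrow> i \<le> n \<Longrightarrow> grid a b n i \<le> b"
  using monoD[OF mono_grid, of a b i n n] by (cases "n = 0") auto

text \<open>Finitely many points have a positive minimal gap, and a mesh below it cannot put two of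
  them into one cell. The extra element 1 in the proof keeps the minimum meaningful when there are
  no two distinct points.\<close>

lemma grid_separates:
  assumes "finite T" "a \<le> b"
  shows "\<exists>n0>0. \<forall>n\<ge>n0. \<forall>i. card (T \<inter> {grid a b n i<..grid a b n (Suc i)}) \<le> 1"
proof -
  have "\<exists>d>0. \<forall>r\<in>T. \<forall>s\<in>T. r < s \<longrightarrow> d \<le> s - r"
  proof -
    have fin: "finite ((\<lambda>(r, s). s - r) ` {(r, s) \<in> T \<times> T. r < s} \<union> {1})"
      by (intro finite_UnI finite_imageI) (auto intro: finite_subset[of _ "T \<times> T"] simp: assms)
    show ?thesis
    proof (intro exI[of _ "Min ((\<lambda>(r, s). s - r) ` {(r, s) \<in> T \<times> T. r < s} \<union> {1})"] conjI ballI impI)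
      show "0 < Min ((\<lambda>(r, s). s - r) ` {(r, s) \<in> T \<times> T. r < s} \<union> {1})"
        by (subst Min_gr_iff[OF fin]) auto
    qed (rule Min_le[OF fin], force)
  qed
  then obtain d where d: "d > 0" "\<And>r s. r \<in> T \<Longrightarrow> s \<in> T \<Longrightarrow> r < s \<Longrightarrow> d \<le> s - r" by blast
  obtain n0 :: nat where n0: "(b - a) / d < real n0" using reals_Archimedean2 by blast
  have "card (T \<inter> {grid a b n i<..grid a b n (Suc i)}) \<le> 1" if "n \<ge> Suc n0" for n i
  proof (rule ccontr)
    assume "\<not> ?thesis"
    then have "\<not> (\<forall>r\<in>T \<inter> {grid a b n i<..grid a b n (Suc i)}. \<forall>s\<in>T \<inter> {grid a b n i<..grid a b n (Suc i)}. r = s)"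
      using assms(1) card_le_Suc0_iff_eq[of "T \<inter> {grid a b n i<..grid a b n (Suc i)}"] by simp
    then obtain r' s' where "r' \<in> T \<inter> {grid a b n i<..grid a b n (Suc i)}"
      "s' \<in> T \<inter> {grid a b n i<..grid a b n (Suc i)}" "r' \<noteq> s'" by blast
    then obtain r s where rs: "r \<in> T" "s \<in> T" "r < s" "grid a b n i < r" "s \<le> grid a b n (Suc i)"
      by (cases "r' < s'") force+
    have "d < (b - a) / real n" using d(2)[of r s] rs grid_Suc[of a b n i] by simp
    then have "real n < (b - a) / d" using d(1) that by (simp add: field_simps)
    with n0 that show False by simp
  qed
  then show ?thesis by (intro exI[of _ "Suc n0"]) auto
qed

section \<open>The Lyapunov function\<close>

lemma exp_minus_lipschitz:
  fixes a b :: real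
  assumes "0 \<le> a" "0 \<le> b"
  shows "\<bar>exp (- a) - exp (- b)\<bar> \<le> \<bar>a - b\<bar>"
proof -
  have *: "\<bar>exp (- a) - exp (- b)\<bar> \<le> \<bar>a - b\<bar>" if "0 \<le> a" "a \<le> b" for a b :: real
  proof -
    have "exp (- a) - exp (- b) = exp (- a) * (1 - exp (- (b - a)))"
      by (simp add: algebra_simps flip: exp_add)
    also have "\<dots> \<le> 1 * (b - a)"
      using exp_ge_add_one_self[of "- (b - a)"] that by (intro mult_mono) (simp_all add: algebra_simps)
    finally show ?thesis using that by simp
  qed
  show ?thesis using *[of a b] *[of b a] assms by (cases "a \<le> b") (auto simp: abs_minus_commute)
qed

text \<open>By \<open>c_le\<close> the children of a vertex weigh at most 0.1 together, which is the
  origin of all factors 0.9 (and 0.36 = 0.9 * 0.4). The inequality \<open>al_le\<close> is the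
  balance at the root: waiting contributes \<open>al / 2\<close>, each neighbour at most
  \<open>al\<close>, and the weights of the children pay for it.\<close>

locale weighted_tree =
  fixes adj :: "nat list \<Rightarrow> nat list \<Rightarrow> bool" and c :: "nat list \<Rightarrow> real" and B :: nat and al :: real
  assumes adj_tree: "adj u v \<Longrightarrow> \<exists>i. v = u @ [i] \<or> u = v @ [i]"
    and fin_adj: "finite {v. adj u v}"
    and c_nonneg: "0 \<le> c u"
    and c_le: "c u * (10 * real B) \<le> 1"
    and c_sub: "c u \<le> 0.36 * (\<Sum>i | i < B \<and> adj u (u @ [i]). c (u @ [i]))"
    and al_nonneg: "0 \<le> al"
    and al_le: "al * (real (card {v. adj [] v}) + 1 / 2) \<le> (\<Sum>i | i < B \<and> adj [] [i]. c [i])"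
begin

text \<open>
  The state consists of the current vertex \<open>x\<close>, the visited set \<open>V\<close>, the local times \<open>l\<close> in excess of
  their initial value \<open>1\<close>, and whether the root has been returned to (\<open>b\<close>); leaving \<open>W\<close> kills the
  process.  The root has no parent, so its factor \<open>1 - al * exp (- l [] / 2)\<close> is separate and is
  dropped after the first jump.
\<close>

definition wt :: "nat list set \<Rightarrow> nat list \<Rightarrow> real" where
  "wt V u = (\<Sum>i | i < B \<and> adj u (u @ [i]) \<and> u @ [i] \<notin> V. 0.9 * c (u @ [i]))"

definition esc :: "nat list set \<Rightarrow> (nat list \<Rightarrow> real) \<Rightarrow> nat list \<Rightarrow> real" where
  "esc V l u = wt V u * (exp (- (l u / 2)) / (2.5 + l (butlast u)))"

definition pth :: "nat list set \<Rightarrow> (nat list \<Rightarrow> real) \<Rightarrow> nat list \<Rightarrow> real" where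
  "pth V l x = (\<Prod>j = 1..length x. 1 - esc V l (take j x))"

definition lyap :: "nat list set \<Rightarrow> nat list set \<Rightarrow> bool \<Rightarrow> (nat list \<Rightarrow> real) \<Rightarrow> nat list \<Rightarrow> real" where
  "lyap W V b l x = (if \<not> V \<subseteq> W then 0 else if b then 1
     else if x = [] then 1 - al * exp (- (l [] / 2)) else pth V l x)"

text \<open>The time derivative of \<open>lyap\<close> while the process waits at \<open>x\<close>:
  only the factor of \<open>x\<close> itself moves, through
  \<open>exp (- (l x / 2))\<close>.\<close>

definition drift :: "nat list set \<Rightarrow> nat list set \<Rightarrow> bool \<Rightarrow> (nat list \<Rightarrow> real) \<Rightarrow> nat list \<Rightarrow> real" where
  "drift W V b l x = (if \<not> V \<subseteq> W \<or> b then 0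
     else if x = [] then al * exp (- (l [] / 2)) / 2 else pth V l (butlast x) * esc V l x / 2)"

lemma sum_c_le: "A \<subseteq> {..<B} \<Longrightarrow> (\<Sum>i\<in>A. c (u @ [i])) \<le> 0.1"
proof -
  assume A: "A \<subseteq> {..<B}"
  show ?thesis
  proof (cases "B = 0")
    case False
    have "(\<Sum>i\<in>A. c (u @ [i])) \<le> (\<Sum>i<B. c (u @ [i]))"
      using A c_nonneg by (intro sum_mono2) auto
    also have "\<dots> \<le> (\<Sum>i<B. 1 / (10 * real B))"
      using c_le False by (intro sum_mono) (simp add: le_divide_eq)
    finally show ?thesis using False by simp
  qed (use A in auto)
qed

lemma wt_nonneg: "0 \<le> wt V u"
  unfolding wt_def using c_nonneg by (intro sum_nonneg) auto

lemma wt_le: "wt V u \<le> 0.1"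
proof -
  have "(\<Sum>i | i < B \<and> adj u (u @ [i]) \<and> u @ [i] \<notin> V. c (u @ [i])) \<le> 0.1"
    by (rule sum_c_le) auto
  then show ?thesis unfolding wt_def sum_distrib_left[symmetric] by linarith
qed

lemma al_le_1: "al \<le> 1"
proof -
  have "al * (1 / 2) \<le> al * (real (card {v. adj [] v}) + 1 / 2)"
    using al_nonneg by (intro mult_left_mono) auto
  also have "\<dots> \<le> (\<Sum>i | i < B \<and> adj [] [i]. c ([] @ [i]))" using al_le by simp
  also have "\<dots> \<le> 0.1" by (rule sum_c_le) auto
  finally show ?thesis by simp
qed

lemma esc_bounds:
  assumes "\<forall>u. 0 \<le> l u"
  shows "0 \<le> esc V l u" "esc V l u \<le> 0.1"
proof -
  let ?q = "exp (- (l u / 2)) / (2.5 + l (butlast u))"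
  have q: "0 \<le> ?q" "?q \<le> 1"
    using assms[THEN spec, of u] assms[THEN spec, of "butlast u"] exp_le_one_iff[of "- (l u / 2)"]
    by (auto simp: divide_le_eq simp del: exp_le_one_iff)
  show "0 \<le> esc V l u" unfolding esc_def using wt_nonneg q by (intro mult_nonneg_nonneg) auto
  have "esc V l u \<le> 0.1 * 1" unfolding esc_def using wt_nonneg wt_le q by (intro mult_mono) auto
  then show "esc V l u \<le> 0.1" by simp
qed

text \<open>The Lipschitz estimates serve to replace local times at the end of a grid cell by those
  at its beginning; during a cell of length \<open>h\<close> no local time moves by more than
  \<open>h\<close>.\<close>

lemma esc_lipschitz:
  assumes "\<forall>u. 0 \<le> l u" "\<forall>u. 0 \<le> l' u" "\<And>u. \<bar>l u - l' u\<bar> \<le> h"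
  shows "\<bar>esc V l u - esc V l' u\<bar> \<le> h"
proof -
  have h: "0 \<le> h" using assms(3)[of u] by simp
  define p q p' q' where "p = exp (- (l u / 2))" and "q = 1 / (2.5 + l (butlast u))"
    and "p' = exp (- (l' u / 2))" and "q' = 1 / (2.5 + l' (butlast u))"
  have p: "\<bar>p - p'\<bar> \<le> h / 2" unfolding p_def p'_def
    by (rule order_trans[OF exp_minus_lipschitz])
      (use assms(3)[of u] assms(1)[THEN spec, of u] assms(2)[THEN spec, of u] in \<open>auto simp: field_simps abs_le_iff\<close>)
  have "q - q' = (l' (butlast u) - l (butlast u)) * (q * q')"
    unfolding q_def q'_def using assms(1)[THEN spec, of "butlast u"] assms(2)[THEN spec, of "butlast u"]
    by (simp add: field_simps)
  then have "\<bar>q - q'\<bar> = \<bar>l (butlast u) - l' (butlast u)\<bar> * (\<bar>q\<bar> * \<bar>q'\<bar>)" by (simp add: abs_mult abs_minus_commute)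
  \<comment> \<open>Both reciprocals are at most 1 / 2.5 = 0.4.\<close>
  also have "\<dots> \<le> h * (0.4 * 0.4)"
    unfolding q_def q'_def using assms(3)[of "butlast u"] assms(1)[THEN spec, of "butlast u"] assms(2)[THEN spec, of "butlast u"]
    by (intro mult_mono) (auto simp: field_simps)
  finally have q: "\<bar>q - q'\<bar> \<le> h * 0.16" by simp
  have "\<bar>p * q - p' * q'\<bar> = \<bar>(p - p') * q + p' * (q - q')\<bar>" by (simp add: algebra_simps)
  also have "\<dots> \<le> \<bar>p - p'\<bar> * \<bar>q\<bar> + \<bar>p'\<bar> * \<bar>q - q'\<bar>" by (simp flip: abs_mult)
  also have "\<dots> \<le> h / 2 * 1 + 1 * (h * 0.16)"
    using p q assms(1)[THEN spec, of "butlast u"] assms(2)[THEN spec, of u] h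
    by (intro add_mono mult_mono) (auto simp: q_def p'_def divide_le_eq)
  also have "\<dots> \<le> h" using h by simp
  finally have *: "\<bar>p * q - p' * q'\<bar> \<le> h" .
  have "\<bar>esc V l u - esc V l' u\<bar> = wt V u * \<bar>p * q - p' * q'\<bar>"
  proof -
    have "esc V l u = wt V u * (p * q)" "esc V l' u = wt V u * (p' * q')"
      by (simp_all add: esc_def p_def q_def p'_def q'_def)
    then show ?thesis
      using wt_nonneg[of V u] by (simp add: abs_mult flip: right_diff_distrib)
  qed
  also have "\<dots> \<le> 1 * h" using wt_nonneg wt_le[of V u] * h by (intro mult_mono) auto
  finally show ?thesis by simp
qed

lemma pth_bounds:
  assumes "\<forall>u. 0 \<le> l u"
  shows "0 \<le> pth V l x" "pth V l x \<le> 1"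
proof -
  have e: "0 \<le> 1 - esc V l u" "1 - esc V l u \<le> 1" for u using esc_bounds[of l V u] assms by auto
  show "0 \<le> pth V l x" unfolding pth_def using e by (intro prod_nonneg) auto
  show "pth V l x \<le> 1" unfolding pth_def using e by (intro prod_le_1) auto
qed

lemma pth_lipschitz:
  assumes "\<forall>u. 0 \<le> l u" "\<forall>u. 0 \<le> l' u" "\<And>u. \<bar>l u - l' u\<bar> \<le> h"
  shows "\<bar>pth V l x - pth V l' x\<bar> \<le> real (length x) * h"
proof -
  have "\<bar>pth V l x - pth V l' x\<bar>
      \<le> (\<Sum>j = 1..length x. \<bar>(1 - esc V l (take j x)) - (1 - esc V l' (take j x))\<bar>)"
    unfolding pth_def real_norm_def[symmetric]
  proof (rule norm_prod_diff)
    fix j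
    show "norm (1 - esc V l (take j x)) \<le> 1" "norm (1 - esc V l' (take j x)) \<le> 1"
      using esc_bounds[of l V "take j x"] esc_bounds[of l' V "take j x"] assms by auto
  qed
  also have "\<dots> \<le> (\<Sum>j = 1..length x. h)"
    using esc_lipschitz[of l l' h V] assms by (intro sum_mono) (auto simp: abs_minus_commute)
  finally show ?thesis by simp
qed

lemma lyap_bounds:
  assumes "\<forall>u. 0 \<le> l u"
  shows "0 \<le> lyap W V b l x" "lyap W V b l x \<le> 1"
proof -
  have "al * exp (- (l [] / 2)) \<le> 1 * 1" using al_nonneg al_le_1 assms[THEN spec, of "[]"] by (intro mult_mono) auto
  then show "0 \<le> lyap W V b l x" "lyap W V b l x \<le> 1"
    using pth_bounds[of l V x] assms al_nonneg by (auto simp: lyap_def)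
qed

text \<open>The bound \<open>K\<close> on the length of the words in \<open>W\<close> limits the
  number of factors of the product; the other branches of \<open>lyap\<close> have Lipschitz
  constant at most 1, which the summand 1 covers.\<close>

lemma lyap_lipschitz:
  assumes "\<forall>u. 0 \<le> l u" "\<forall>u. 0 \<le> l' u" "\<And>u. \<bar>l u - l' u\<bar> \<le> h"
    and "x \<in> V" "\<And>u. u \<in> W \<Longrightarrow> length u \<le> K"
  shows "\<bar>lyap W V b l x - lyap W V b l' x\<bar> \<le> (real K + 1) * h"
proof -
  have h: "0 \<le> h" using assms(3)[of x] by simp
  have hK: "h \<le> (real K + 1) * h" using h by (simp add: algebra_simps)
  have root: "\<bar>al * exp (- (l [] / 2)) - al * exp (- (l' [] / 2))\<bar> \<le> h"
  proof -
    have "\<bar>al * exp (- (l [] / 2)) - al * exp (- (l' [] / 2))\<bar>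
        = al * \<bar>exp (- (l [] / 2)) - exp (- (l' [] / 2))\<bar>"
      using al_nonneg by (simp add: abs_mult flip: right_diff_distrib)
    also have "\<dots> \<le> 1 * \<bar>l [] / 2 - l' [] / 2\<bar>"
      using al_le_1 al_nonneg assms(1)[THEN spec, of "[]"] assms(2)[THEN spec, of "[]"]
      by (intro mult_mono exp_minus_lipschitz) auto
    also have "\<dots> \<le> h" using assms(3)[of "[]"] by auto
    finally show ?thesis .
  qed
  show ?thesis
  proof (cases "V \<subseteq> W \<and> \<not> b \<and> x \<noteq> []")
    case True
    then have "length x \<le> K" using assms(4,5) by auto
    have "\<bar>pth V l x - pth V l' x\<bar> \<le> real (length x) * h" by (rule pth_lipschitz) (use assms in auto)
    also have "\<dots> \<le> (real K + 1) * h" using \<open>length x \<le> K\<close> h by (intro mult_right_mono) auto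
    finally show ?thesis using True by (simp add: lyap_def)
  next
    case False
    then show ?thesis using root hK h
      by (auto simp: lyap_def abs_minus_commute intro: order_trans)
  qed
qed

lemma pth_snoc: "pth V l (x @ [i]) = pth V l x * (1 - esc V l (x @ [i]))"
proof -
  have "{1..length (x @ [i])} = insert (Suc (length x)) {1..length x}" by auto
  then show ?thesis unfolding pth_def by (simp add: mult.commute)
qed

lemma pth_cong:
  assumes "\<And>j. 1 \<le> j \<Longrightarrow> j \<le> length x \<Longrightarrow> esc V l (take j x) = esc V' l' (take j x)"
  shows "pth V l x = pth V' l' x"
  unfolding pth_def using assms by (intro prod.cong) auto

lemma esc_cong:
  assumes "\<And>i. u @ [i] \<in> V \<longleftrightarrow> u @ [i] \<in> V'" "l u = l' u" "l (butlast u) = l' (butlast u)"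
  shows "esc V l u = esc V' l' u"
  unfolding esc_def wt_def using assms by simp

text \<open>Time spent at \<open>x\<close> does not enter the factors of its proper ancestors, and
  \<open>1 - exp (- (h / 2)) \<le> h / 2\<close> turns the derivative into a bound for waiting times
  of any length.\<close>

lemma lyap_drift:
  assumes l: "\<forall>u. 0 \<le> l u" and h: "0 \<le> h"
  shows "lyap W V b (l(x := l x + h)) x - lyap W V b l x \<le> drift W V b l x * h"
proof -
  let ?l = "l(x := l x + h)"
  have e: "1 - exp (- (h / 2)) \<le> h / 2" using exp_ge_add_one_self[of "- (h / 2)"] by simp
  have split: "exp (- ((l x + h) / 2)) = exp (- (l x / 2)) * exp (- (h / 2))"
    by (simp add: field_simps flip: exp_add)
  consider "\<not> V \<subseteq> W \<or> b" | "V \<subseteq> W" "\<not> b" "x = []" | "V \<subseteq> W" "\<not> b" "x \<noteq> []" by blast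
  then show ?thesis
  proof cases
    case 1
    then show ?thesis by (auto simp: lyap_def drift_def)
  next
    case 2
    have "al * exp (- (l [] / 2)) * (1 - exp (- (h / 2))) \<le> al * exp (- (l [] / 2)) * (h / 2)"
      using al_nonneg e by (intro mult_left_mono) auto
    with 2 split show ?thesis by (simp add: lyap_def drift_def algebra_simps)
  next
    case 3
    then obtain z k where x: "x = z @ [k]" by (metis rev_exhaust)
    have same: "pth V ?l z = pth V l z"
      by (intro pth_cong esc_cong) (auto simp: x dest: arg_cong[of _ _ length])
    have "esc V ?l x = esc V l x * exp (- (h / 2))"
      unfolding esc_def using split by (simp add: x)
    moreover have "pth V l z * esc V l x * (1 - exp (- (h / 2))) \<le> pth V l z * esc V l x * (h / 2)"
      using e esc_bounds[OF l] pth_bounds[OF l] by (intro mult_left_mono) auto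
    ultimately show ?thesis
      using 3 same pth_snoc[of V l z k] pth_snoc[of V ?l z k]
      by (simp add: lyap_def drift_def x algebra_simps)
  qed
qed

text \<open>A child entered for the first time has no local time yet and all its own children are
  unvisited, so its escape weight is a function of the time at its parent alone. Here this
  hyperbolic function is bounded below by the exponential one, using
  \<open>1 + 0.4 * t \<le> exp (t / 2)\<close>.\<close>

lemma esc_new:
  assumes l: "\<forall>u. 0 \<le> l u" and y: "l (x @ [i]) = 0" "\<And>j. x @ [i, j] \<notin> V"
  shows "c (x @ [i]) * exp (- (l x / 2)) \<le> esc V l (x @ [i])"
proof -
  have lx: "0 \<le> l x" using l by blast
  have "wt V (x @ [i]) = 0.9 * (\<Sum>j | j < B \<and> adj (x @ [i]) ((x @ [i]) @ [j]). c ((x @ [i]) @ [j]))"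
    unfolding wt_def sum_distrib_left[symmetric] using y(2) by simp
  \<comment> \<open>The constant is 0.9 / 0.36.\<close>
  then have w: "2.5 * c (x @ [i]) \<le> wt V (x @ [i])" using c_sub[of "x @ [i]"] by simp
  have "1 + l x * 0.4 \<le> 1 + l x / 2" using lx by simp
  also have "\<dots> \<le> exp (l x / 2)" by (rule exp_ge_add_one_self)
  finally have "exp (- (l x / 2)) \<le> 1 / (1 + l x * 0.4)"
    using lx by (simp add: exp_minus field_simps)
  also have "\<dots> = 2.5 / (2.5 + l x)" using lx by (simp add: field_simps)
  finally have "c (x @ [i]) * exp (- (l x / 2)) \<le> c (x @ [i]) * (2.5 / (2.5 + l x))"
    using c_nonneg by (intro mult_left_mono) auto
  also have "\<dots> = (2.5 * c (x @ [i])) / (2.5 + l x)" by simp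
  also have "\<dots> \<le> wt V (x @ [i]) / (2.5 + l x)"
    using w lx by (intro divide_right_mono) auto
  also have "\<dots> = esc V l (x @ [i])" using y by (simp add: esc_def)
  finally show ?thesis .
qed

text \<open>Since \<open>butlast [] = []\<close>, the root is listed among its own targets; this is
  harmless because no vertex is adjacent to itself. Children with index at least \<open>K\<close>
  are left out: moving there leaves \<open>words K\<close>.\<close>

definition targets :: "nat \<Rightarrow> nat list \<Rightarrow> nat list set" where
  "targets K x = insert (butlast x) ((\<lambda>i. x @ [i]) ` {..<K})"

lemma sum_targets:
  "(\<Sum>y\<in>targets K x. f y) = f (butlast x) + (\<Sum>i<K. f (x @ [i]))"
proof -
  have "butlast x \<notin> (\<lambda>i. x @ [i]) ` {..<K}"
    by (auto dest: arg_cong[of _ _ length])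
  then have "(\<Sum>y\<in>targets K x. f y) = f (butlast x) + (\<Sum>y\<in>(\<lambda>i. x @ [i]) ` {..<K}. f y)"
    unfolding targets_def by simp
  also have "(\<Sum>y\<in>(\<lambda>i. x @ [i]) ` {..<K}. f y) = (\<Sum>i<K. f (x @ [i]))"
    by (subst sum.reindex) (auto simp: inj_on_def)
  finally show ?thesis .
qed

lemma not_adj_self: "\<not> adj u u"
  using adj_tree[of u u] by auto

text \<open>The assumptions on \<open>V\<close> say that a subtree is entered only through its top
  and that a path at the root which has not returned has never left. Below the root, with product
  \<open>p\<close> over the proper ancestors, own escape weight \<open>s\<close> and time
  \<open>t\<close> at the parent, the three contributions are \<open>p * s / 2\<close> from waiting,
  at most \<open>p * s * (1 + t)\<close> from the parent and at most
  \<open>p * (s - s * (2.5 + t))\<close> from the children.\<close>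

lemma generator_nonpos:
  assumes l: "\<forall>u. 0 \<le> l u" and l0: "\<And>u. u \<notin> V \<Longrightarrow> l u = 0"
    and V: "\<And>u j. u \<notin> V \<Longrightarrow> u \<noteq> [] \<Longrightarrow> u @ [j] \<notin> V"
    and root: "\<not> b \<Longrightarrow> x = [] \<Longrightarrow> V \<subseteq> {[]}"
    and xV: "x \<in> V" and K: "B \<le> K"
  shows "drift W V b l x + (\<Sum>y\<in>targets K x. if adj x y
    then (lyap W (insert y V) (b \<or> y = []) l y - lyap W V b l x) * (1 + l y) else 0) \<le> 0"
proof -
  let ?g = "\<lambda>y. if adj x y
    then (lyap W (insert y V) (b \<or> y = []) l y - lyap W V b l x) * (1 + l y) else 0"
  consider "\<not> V \<subseteq> W" | "V \<subseteq> W" "b" | "V \<subseteq> W" "\<not> b" "x = []" | "V \<subseteq> W" "\<not> b" "x \<noteq> []" by blast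
  then show ?thesis
  proof cases
    case 1
    then have "?g y = 0" for y by (simp add: lyap_def)
    with 1 show ?thesis by (simp add: drift_def)
  next
    case 2
    \<comment> \<open>After the return the function has its maximal value 1, so a jump can only
      lower it.\<close>
    have "?g y \<le> 0" for y
      using 2 lyap_bounds[OF l, of W "insert y V" True y] l[THEN spec, of y]
      by (auto simp: lyap_def intro!: mult_nonpos_nonneg)
    then have "(\<Sum>y\<in>targets K x. ?g y) \<le> 0" by (intro sum_nonpos) auto
    with 2 show ?thesis by (simp add: drift_def)
  next
    case 3
    define e where "e = exp (- (l [] / 2))"
    have e: "0 \<le> e" by (simp add: e_def)
    have V3: "V \<subseteq> {[]}" using root 3 by auto
    \<comment> \<open>The first jump gives up the root term \<open>al * e\<close> and acquires the
      escape weight of the child; its rate is 1 because the child is new.\<close>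
    have b: "?g (x @ [i]) \<le> (if adj [] [i] then al * e else 0)
        - (if i < B \<and> adj [] [i] then c [i] * e else 0)" for i
    proof (cases "adj [] [i]")
      case True
      have n: "[i] \<notin> V" using V3 by auto
      have li: "l [i] = 0" using l0 n by simp
      have nj: "[i, j] \<notin> insert [i] V" for j using V3 by auto
      have "c [i] * e \<le> esc (insert [i] V) l [i]"
        using esc_new[of l "[]" i "insert [i] V"] l li nj by (simp add: e_def)
      moreover have "lyap W (insert [i] V) (b \<or> [i] = []) l [i] \<le> pth (insert [i] V) l [i]"
        using pth_bounds[OF l] 3 by (simp add: lyap_def)
      moreover have "pth (insert [i] V) l [i] = 1 - esc (insert [i] V) l [i]"
        using pth_snoc[of "insert [i] V" l "[]" i] by (simp add: pth_def)
      moreover have "lyap W V b l x = 1 - al * e" using 3 by (simp add: lyap_def e_def)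
      moreover have "0 \<le> c [i] * e" using c_nonneg e by simp
      ultimately show ?thesis using 3 True li by simp
    qed (use 3 in simp)
    have "drift W V b l x + (\<Sum>y\<in>targets K x. ?g y) = al * e / 2 + (\<Sum>i<K. ?g (x @ [i]))"
      unfolding sum_targets using 3 not_adj_self[of "[]"] by (simp add: drift_def e_def)
    also have "\<dots> \<le> al * e / 2 + (\<Sum>i<K. (if adj [] [i] then al * e else 0)
        - (if i < B \<and> adj [] [i] then c [i] * e else 0))"
      using b by (intro add_mono sum_mono) auto
    also have "(\<Sum>i<K. (if adj [] [i] then al * e else 0) - (if i < B \<and> adj [] [i] then c [i] * e else 0))
        = (\<Sum>i<K. if adj [] [i] then al * e else 0)
          - (\<Sum>i<K. if i < B \<and> adj [] [i] then c [i] * e else 0)"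
      by (rule sum_subtractf)
    also have "(\<Sum>i<K. if i < B \<and> adj [] [i] then c [i] * e else 0)
        = (\<Sum>i | i < B \<and> adj [] [i]. c [i] * e)"
      using K by (intro sum.mono_neutral_cong_right) auto
    also have "\<dots> = (\<Sum>i | i < B \<and> adj [] [i]. c [i]) * e" by (simp add: sum_distrib_right)
    also have "(\<Sum>i<K. if adj [] [i] then al * e else 0) = card ({..<K} \<inter> {i. adj [] [i]}) * (al * e)"
      by (simp add: sum.If_cases)
    also have "\<dots> \<le> card {v. adj [] v} * (al * e)"
    proof -
      have "card ({..<K} \<inter> {i. adj [] [i]}) = card ((\<lambda>i. [i]) ` ({..<K} \<inter> {i. adj [] [i]}))"
        by (rule card_image[symmetric]) (auto simp: inj_on_def)
      also have "\<dots> \<le> card {v. adj [] v}" by (rule card_mono[OF fin_adj]) auto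
      finally show ?thesis using al_nonneg e by (intro mult_right_mono) auto
    qed
    also have "al * e / 2 + (card {v. adj [] v} * (al * e) - (\<Sum>i | i < B \<and> adj [] [i]. c [i]) * e)
        = (al * (real (card {v. adj [] v}) + 1 / 2) - (\<Sum>i | i < B \<and> adj [] [i]. c [i])) * e"
      by (simp add: algebra_simps)
    also have "\<dots> \<le> 0" using al_le e by (intro mult_nonpos_nonneg) auto
    finally show ?thesis by simp
  next
    case 4
    then obtain z k where x: "x = z @ [k]" by (metis rev_exhaust)
    define p s t where "p = pth V l z" and "s = esc V l x" and "t = l z"
    \<comment> \<open>For an unvisited child with index below \<open>B\<close>,
      \<open>q i / (2.5 + t)\<close> is its share in \<open>s\<close>, and \<open>q i / 0.9\<close>
      is a lower bound for its own escape weight once it is entered.\<close>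
    define q where "q i = 0.9 * c (x @ [i]) * exp (- (l x / 2))" for i
    have t: "0 \<le> t" and p: "0 \<le> p" "p \<le> 1" and s: "0 \<le> s" "s \<le> 0.1"
      using l pth_bounds[OF l] esc_bounds[OF l] by (auto simp: t_def p_def s_def)
    have q0: "0 \<le> q i" for i using c_nonneg by (simp add: q_def)
    have F: "lyap W V b l x = p * (1 - s)"
      using 4 pth_snoc[of V l z k] by (simp add: lyap_def p_def s_def x)
    have sq: "(\<Sum>i | i < B \<and> adj x (x @ [i]) \<and> x @ [i] \<notin> V. q i) = s * (2.5 + t)"
    proof -
      have "(\<Sum>i | i < B \<and> adj x (x @ [i]) \<and> x @ [i] \<notin> V. q i) = wt V x * exp (- (l x / 2))"
        unfolding q_def wt_def by (simp add: sum_distrib_right)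
      then show ?thesis using t unfolding s_def esc_def by (simp add: x t_def)
    qed
    \<comment> \<open>If the parent is the root, the move is the return and the new value is at most
      1, which is then also the empty product \<open>p\<close>. Otherwise the parent has been
      visited before and the visited set does not change.\<close>
    have up: "?g (butlast x) \<le> p * s * (1 + t)"
    proof (cases "adj x z")
      case True
      have "lyap W (insert z V) (b \<or> z = []) l z \<le> p"
      proof (cases "z = []")
        case True
        then show ?thesis by (auto simp: p_def pth_def lyap_def)
      next
        case False
        have "z \<in> V" using V[of z k] x xV False by blast
        then have "insert z V = V" by blast
        then have "pth (insert z V) l z = p" by (simp add: p_def)
        then show ?thesis using False 4 p by (simp add: lyap_def)
      qed
      then have "lyap W (insert z V) (b \<or> z = []) l z - lyap W V b l x \<le> p * s"
        by (simp add: F algebra_simps)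
      then have "(lyap W (insert z V) (b \<or> z = []) l z - lyap W V b l x) * (1 + t) \<le> p * s * (1 + t)"
        using t by (intro mult_right_mono) auto
      then show ?thesis using True by (simp add: x t_def)
    qed (use p s t in \<open>simp add: x\<close>)
    \<comment> \<open>A new child takes its share out of the factor of \<open>x\<close> and brings
      its own factor. A visited child, or one with index at least \<open>B\<close>, leaves the
      factor of \<open>x\<close> unchanged and adds a factor at most 1.\<close>
    have down: "?g (x @ [i]) \<le> (if i < B \<and> adj x (x @ [i]) \<and> x @ [i] \<notin> V
        then p * (q i / (2.5 + t) - q i) else 0)" for i
    proof -
      let ?y = "x @ [i]"
      have Fy: "lyap W (insert ?y V) (b \<or> ?y = []) l ?y \<le> pth (insert ?y V) l ?y"
        using 4 pth_bounds[OF l] by (simp add: lyap_def)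
      have py: "pth (insert ?y V) l ?y
          = p * (1 - esc (insert ?y V) l x) * (1 - esc (insert ?y V) l ?y)"
      proof -
        have "pth (insert ?y V) l z = p"
          unfolding p_def x by (intro pth_cong esc_cong) (auto dest: arg_cong[of _ _ length])
        then show ?thesis using pth_snoc[of "insert ?y V" l x i] pth_snoc[of "insert ?y V" l z k]
          by (simp add: x)
      qed
      show ?thesis
      proof (cases "i < B \<and> adj x ?y \<and> ?y \<notin> V")
        case True
        have wt: "wt V x = 0.9 * c ?y + wt (insert ?y V) x"
        proof -
          have "{j. j < B \<and> adj x (x @ [j]) \<and> x @ [j] \<notin> V}
              = insert i {j. j < B \<and> adj x (x @ [j]) \<and> x @ [j] \<notin> insert ?y V}" using True by auto
          then show ?thesis unfolding wt_def by simp
        qed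
        have ex: "esc (insert ?y V) l x = s - q i / (2.5 + t)"
        proof -
          have "butlast x = z" by (simp add: x)
          then show ?thesis
            unfolding s_def esc_def wt q_def t_def
            by (simp only: distrib_right times_divide_eq_right mult.assoc add_divide_distrib add_diff_cancel_left')
        qed
        have nj: "x @ [i, j] \<notin> insert ?y V" for j using V[of ?y j] True by auto
        have "c ?y * exp (- (l x / 2)) \<le> esc (insert ?y V) l ?y"
          by (rule esc_new) (use l l0 True nj in auto)
        then have ey: "q i / 0.9 \<le> esc (insert ?y V) l ?y" by (simp add: q_def)
        \<comment> \<open>The second order effect: the gain of the child is multiplied by the
          remaining factor of \<open>x\<close>, and the lower bound 0.9 for it cancels the division
          in \<open>q i / 0.9\<close>.\<close>
        have a: "0.9 \<le> 1 - s + q i / (2.5 + t)" 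
        proof -
          have "0 \<le> q i / (2.5 + t)" using q0[of i] t by simp
          then show ?thesis using s by linarith
        qed
        have "pth (insert ?y V) l ?y \<le> p * (1 - s + q i / (2.5 + t)) * (1 - q i / 0.9)"
        proof -
          have "1 - (s - q i / (2.5 + t)) = 1 - s + q i / (2.5 + t)" by simp
          moreover have "0 \<le> p * (1 - s + q i / (2.5 + t))"
            by (rule mult_nonneg_nonneg[OF p(1)]) (use a in linarith)
          moreover have "1 - esc (insert ?y V) l ?y \<le> 1 - q i / 0.9" using ey by linarith
          ultimately show ?thesis unfolding py ex by (metis mult_left_mono)
        qed
        also have "\<dots> \<le> p * ((1 - s) + q i / (2.5 + t) - q i)"
        proof -
          have "0.9 * (q i / 0.9) \<le> (1 - s + q i / (2.5 + t)) * (q i / 0.9)"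
            using a q0[of i] by (intro mult_right_mono) auto
          then have "(1 - s + q i / (2.5 + t)) * (1 - q i / 0.9) \<le> (1 - s) + q i / (2.5 + t) - q i"
            by (simp add: right_diff_distrib)
          then show ?thesis using p unfolding mult.assoc by (intro mult_left_mono) auto
        qed
        finally have "lyap W (insert ?y V) (b \<or> ?y = []) l ?y - lyap W V b l x
            \<le> p * (q i / (2.5 + t) - q i)"
          using Fy unfolding F by (simp add: algebra_simps)
        then show ?thesis using True l0[of ?y] by simp
      next
        case False
        show ?thesis
        proof (cases "adj x ?y")
          case adj: True
          have ex: "esc (insert ?y V) l x = s"
          proof -
            have "{j. j < B \<and> adj x (x @ [j]) \<and> x @ [j] \<notin> insert ?y V}
                = {j. j < B \<and> adj x (x @ [j]) \<and> x @ [j] \<notin> V}" using False adj by auto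
            then show ?thesis unfolding s_def esc_def wt_def by simp
          qed
          have "pth (insert ?y V) l ?y \<le> p * (1 - s) * 1"
            unfolding py ex using p s esc_bounds[OF l] by (intro mult_left_mono) auto
          with Fy have "lyap W (insert ?y V) (b \<or> ?y = []) l ?y - lyap W V b l x \<le> 0"
            unfolding F by simp
          then have "?g ?y \<le> 0" using adj l[THEN spec, of ?y] by (simp add: mult_nonpos_nonneg)
          then show ?thesis unfolding if_not_P[OF False] .
        qed simp
      qed
    qed
    have "drift W V b l x + (\<Sum>y\<in>targets K x. ?g y)
        = p * s / 2 + ?g (butlast x) + (\<Sum>i<K. ?g (x @ [i]))"
      unfolding sum_targets using 4 by (simp add: drift_def p_def s_def x)
    also have "\<dots> \<le> p * s / 2 + p * s * (1 + t) + (\<Sum>i<K. if i < B \<and> adj x (x @ [i]) \<and> x @ [i] \<notin> V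
        then p * (q i / (2.5 + t) - q i) else 0)"
      using up down by (intro add_mono sum_mono) auto
    also have "(\<Sum>i<K. if i < B \<and> adj x (x @ [i]) \<and> x @ [i] \<notin> V then p * (q i / (2.5 + t) - q i) else 0)
        = (\<Sum>i | i < B \<and> adj x (x @ [i]) \<and> x @ [i] \<notin> V. p * (q i / (2.5 + t) - q i))"
      using K by (intro sum.mono_neutral_cong_right) auto
    also have "\<dots> = p * (s * (2.5 + t) / (2.5 + t) - s * (2.5 + t))"
      by (simp only: sum_distrib_left[symmetric] sum_subtractf sum_divide_distrib[symmetric] sq)
    \<comment> \<open>This is the balance \<open>1 / 2 + (1 + t) + 1 = 2.5 + t\<close>.\<close>
    also have "p * s / 2 + p * s * (1 + t) + p * (s * (2.5 + t) / (2.5 + t) - s * (2.5 + t)) = 0"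
    proof -
      have "s * (2.5 + t) / (2.5 + t) = s" using t by simp
      then show ?thesis by (simp add: algebra_simps)
    qed
    finally show ?thesis by simp
  qed
qed

end

section \<open>Local times and visited vertices\<close>

text \<open>Sampling at the next multiple of \<open>1 / Suc n\<close> strictly to the right of the
  time uses countably many times and is therefore jointly measurable; since the paths are constant
  to the right, the samples are eventually equal to the actual value.\<close>

lemma measurable_pair_right_constant:
  fixes Z :: "real \<Rightarrow> 'w \<Rightarrow> 'v :: countable"
  assumes meas: "\<And>r. 0 \<le> r \<Longrightarrow> Z r \<in> measurable A (count_space UNIV)"
    and right: "\<And>\<omega> r. \<omega> \<in> space A \<Longrightarrow> 0 \<le> r \<Longrightarrow> \<forall>\<^sub>F s in at_right r. Z s \<omega> = Z r \<omega>"
  shows "(\<lambda>(\<omega>, r). Z (max 0 r) \<omega>) \<in> measurable (A \<Otimes>\<^sub>M borel) (count_space UNIV)"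
proof -
  define d where "d n r = (real (nat \<lfloor>max 0 r * real (Suc n)\<rfloor>) + 1) / real (Suc n)" for n :: nat and r :: real
  have d: "max 0 r < d n r" "d n r \<le> max 0 r + 1 / real (Suc n)" for n r
  proof -
    have fl: "m < real (nat \<lfloor>m\<rfloor>) + 1" "real (nat \<lfloor>m\<rfloor>) \<le> m" if "0 \<le> m" for m :: real
      using that by linarith+
    have "0 \<le> max 0 r * real (Suc n)" by simp
    note fl = fl[OF this]
    then show "max 0 r < d n r" "d n r \<le> max 0 r + 1 / real (Suc n)"
      unfolding d_def using fl
      by (simp_all only: pos_less_divide_eq pos_divide_le_eq of_nat_0_less_iff zero_less_Suc
        distrib_right divide_self times_divide_eq_left mult_1 of_nat_eq_0_iff nat.distinct) simp_all
  qed
  have Zn: "(\<lambda>p. Z (d n (snd p)) (fst p)) \<in> measurable (A \<Otimes>\<^sub>M borel) (count_space UNIV)" for n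
  proof -
    have "(\<lambda>p. Z ((real k + 1) / real (Suc n)) (fst p)) \<in> measurable (A \<Otimes>\<^sub>M borel) (count_space UNIV)" for k :: nat
      by (rule measurable_compose[OF measurable_fst meas]) simp
    moreover have "(\<lambda>p. nat \<lfloor>max 0 (snd p) * real (Suc n)\<rfloor>) \<in> measurable (A \<Otimes>\<^sub>M borel) (count_space UNIV)"
      by measurable
    ultimately show ?thesis
      unfolding d_def
      by (rule measurable_compose_countable[where f="\<lambda>k p. Z ((real k + 1) / real (Suc n)) (fst p)"])
  qed
  have lim: "Z (max 0 (snd p)) (fst p) = v \<longleftrightarrow> (\<exists>m. \<forall>n\<ge>m. Z (d n (snd p)) (fst p) = v)"
    if p: "p \<in> space (A \<Otimes>\<^sub>M borel)" for p v
  proof -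
    have "\<forall>\<^sub>F s in at_right (max 0 (snd p)). Z s (fst p) = Z (max 0 (snd p)) (fst p)"
      by (rule right) (use p in \<open>auto simp: space_pair_measure\<close>)
    then obtain b where b: "b > max 0 (snd p)"
      "\<And>s. max 0 (snd p) < s \<Longrightarrow> s < b \<Longrightarrow> Z s (fst p) = Z (max 0 (snd p)) (fst p)"
      unfolding eventually_at_right_field by blast
    obtain m :: nat where m: "1 / (b - max 0 (snd p)) < real m" using reals_Archimedean2 by blast
    have "Z (d n (snd p)) (fst p) = Z (max 0 (snd p)) (fst p)" if "n \<ge> m" for n
    proof (rule b(2))
      have "1 / (b - max 0 (snd p)) < real (Suc n)" using m that by linarith
      then have "1 / real (Suc n) < b - max 0 (snd p)"
        using b(1) by (simp add: field_simps del: of_nat_Suc)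
      then show "d n (snd p) < b" using d(2)[of n "snd p"] by linarith
    qed (rule d(1))
    note near = this
    show ?thesis
    proof
      assume "\<exists>m'. \<forall>n\<ge>m'. Z (d n (snd p)) (fst p) = v"
      then obtain m' where "\<forall>n\<ge>m'. Z (d n (snd p)) (fst p) = v" ..
      then show "Z (max 0 (snd p)) (fst p) = v" using near[of "max m m'"] by auto
    qed (use near in blast)
  qed
  have "{p \<in> space (A \<Otimes>\<^sub>M borel). Z (max 0 (snd p)) (fst p) = v} \<in> sets (A \<Otimes>\<^sub>M borel)" for v
  proof -
    have "{p \<in> space (A \<Otimes>\<^sub>M borel). Z (max 0 (snd p)) (fst p) = v}
      = {p \<in> space (A \<Otimes>\<^sub>M borel). \<exists>m. \<forall>n\<ge>m. Z (d n (snd p)) (fst p) = v}"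
      using lim by blast
    also have "\<dots> \<in> sets (A \<Otimes>\<^sub>M borel)"
    proof -
      have [measurable]: "Measurable.pred (A \<Otimes>\<^sub>M borel) (\<lambda>p. Z (d n (snd p)) (fst p) = v)" for n
        using measurable_compose[OF Zn[of n], of "\<lambda>w. w = v" "count_space UNIV"] by simp
      show ?thesis by measurable
    qed
    finally show ?thesis .
  qed
  then show ?thesis
    by (subst measurable_count_space_eq2_countable)
      (auto simp: split_beta' vimage_def Int_def conj_commute)
qed

definition visited :: "(real \<Rightarrow> 'v) \<Rightarrow> real \<Rightarrow> 'v set" where
  "visited x s = x ` {0..s}"

definition returned :: "(real \<Rightarrow> 'v) \<Rightarrow> 'v \<Rightarrow> real \<Rightarrow> bool" where
  "returned x v s \<longleftrightarrow> (\<exists>s1 s2. 0 \<le> s1 \<and> s1 < s2 \<and> s2 \<le> s \<and> x s1 \<noteq> v \<and> x s2 = v)"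

definition excess :: "(real \<Rightarrow> 'v) \<Rightarrow> real \<Rightarrow> 'v \<Rightarrow> real" where
  "excess x s u = local_time x u s - 1"

text \<open>The integral on the right of \<open>X_intensity\<close>, for a single path.\<close>

definition compensator ::
  "('v \<Rightarrow> 'v \<Rightarrow> bool) \<Rightarrow> (real \<Rightarrow> 'v) \<Rightarrow> 'v \<Rightarrow> 'v \<Rightarrow> real \<Rightarrow> real \<Rightarrow> ennreal" where
  "compensator adj x u v s t = (\<integral>\<^sup>+ r \<in> {s<..t}. (if x r = u \<and> adj u v
      then ennreal (local_time x v r) else 0) \<partial>lborel)"

locale countable_jump_path = jump_path adj x
  for adj :: "'v :: countable \<Rightarrow> 'v \<Rightarrow> bool" and x
begin

text \<open>The joint measurability lemma is applied over a one-point probability space, i.e. to a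
  single path.\<close>

lemma sets_path: "S \<in> sets borel \<Longrightarrow> S \<subseteq> {0..} \<Longrightarrow> {s \<in> S. x s = y} \<in> sets borel"
proof -
  assume S: "S \<in> sets borel" "S \<subseteq> {0..}"
  have "(\<lambda>(_, r). x (max 0 r)) \<in> measurable (count_space {()} \<Otimes>\<^sub>M borel) (count_space UNIV)"
    by (rule measurable_pair_right_constant[of "\<lambda>r _. x r"]) (auto intro: right_const)
  from measurable_compose[OF _ this, of "\<lambda>r. ((), r)" borel]
  have [measurable]: "(\<lambda>r. x (max 0 r)) \<in> measurable borel (count_space UNIV)" by simp
  have "{r \<in> space borel. r \<in> S \<and> x (max 0 r) = y} \<in> sets borel"
    using S(1) by measurable
  also have "{r \<in> space borel. r \<in> S \<and> x (max 0 r) = y} = {s \<in> S. x s = y}"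
    using S(2) by (auto simp: max_def)
  finally show ?thesis .
qed

lemma excess_eq: "excess x t y = measure lborel {s \<in> {0..t}. x s = y}"
proof -
  have "(LINT s:{0..t}|lborel. indicator {y} (x s)) = (LINT s|lborel. indicator {s \<in> {0..t}. x s = y} s :: real)"
    unfolding set_lebesgue_integral_def by (intro Bochner_Integration.integral_cong) (auto simp: indicator_def)
  then show ?thesis by (simp add: excess_def local_time_def)
qed

lemma fmeasurable_path: "0 \<le> a \<Longrightarrow> {s \<in> {a<..b}. x s = y} \<in> fmeasurable lborel"
  "0 \<le> a \<Longrightarrow> {s \<in> {a..b}. x s = y} \<in> fmeasurable lborel"
  using fmeasurableI2[OF fmeasurable_cbox(1)[of a b], of "{s \<in> {a<..b}. x s = y}"]
    fmeasurableI2[OF fmeasurable_cbox(1)[of a b], of "{s \<in> {a..b}. x s = y}"]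
    sets_path[of "{a<..b}" y] sets_path[of "{a..b}" y] by force+

lemma excess_add:
  assumes "0 \<le> a" "a \<le> b"
  shows "excess x b y = excess x a y + measure lborel {s \<in> {a<..b}. x s = y}"
proof -
  have "{s \<in> {0..b}. x s = y} = {s \<in> {0..a}. x s = y} \<union> {s \<in> {a<..b}. x s = y}" using assms by auto
  then have "measure lborel {s \<in> {0..b}. x s = y}
      = measure lborel ({s \<in> {0..a}. x s = y} \<union> {s \<in> {a<..b}. x s = y})" by simp
  also have "\<dots> = measure lborel {s \<in> {0..a}. x s = y} + measure lborel {s \<in> {a<..b}. x s = y}"
    by (rule measure_Un2[OF fmeasurable_path(2) fmeasurable_path(1), THEN trans])
      (use assms in \<open>auto intro!: arg_cong[where f="measure lborel"]\<close>)
  finally show ?thesis by (simp add: excess_eq)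
qed

lemma excess_nonneg: "0 \<le> excess x t y"
  by (simp add: excess_eq)

lemma excess_mono: "0 \<le> a \<Longrightarrow> a \<le> b \<Longrightarrow> excess x a y \<le> excess x b y"
  by (simp add: excess_add[of a b])

lemma excess_diff_le: "0 \<le> a \<Longrightarrow> a \<le> b \<Longrightarrow> excess x b y - excess x a y \<le> b - a"
proof -
  assume ab: "0 \<le> a" "a \<le> b"
  have "measure lborel {s \<in> {a<..b}. x s = y} \<le> measure lborel {a<..b}"
  proof (rule measure_mono_fmeasurable)
    have "{a<..b} \<subseteq> {0..}" using ab by auto
    then show "{s \<in> {a<..b}. x s = y} \<in> sets lborel" using sets_path[of "{a<..b}" y] by simp
  qed (use ab in \<open>auto intro!: fmeasurableI\<close>)
  with ab show ?thesis by (simp add: excess_add[of a b])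
qed

lemma excess_const:
  assumes "0 \<le> a" "a \<le> b" "\<And>s. s \<in> {a..b} \<Longrightarrow> x s = u"
  shows "excess x b y = excess x a y + (if y = u then b - a else 0)"
proof -
  have "s \<in> {a<..b} \<and> x s = y \<longleftrightarrow> s \<in> {a<..b} \<and> y = u" for s
    using assms(3)[of s] by fastforce
  then have "{s \<in> {a<..b}. x s = y} = (if y = u then {a<..b} else {})"
    by (simp add: set_eq_iff)
  then show ?thesis using excess_add[OF assms(1,2), of y] assms(2) by simp
qed

lemma excess_0: "excess x 0 y = 0"
proof -
  have "measure lborel {s \<in> {0..0}. x s = y} \<le> measure lborel {0..0::real}"
    by (rule measure_mono_fmeasurable) (use sets_path[of "{0..0}" y] in \<open>auto intro!: fmeasurableI\<close>)
  then show ?thesis by (simp add: excess_eq measure_le_0_iff)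
qed

lemma excess_le: "0 \<le> t \<Longrightarrow> excess x t y \<le> t"
  using excess_diff_le[of 0 t y] excess_0 by simp

lemma excess_not_visited: "y \<notin> visited x t \<Longrightarrow> excess x t y = 0"
proof -
  assume "y \<notin> visited x t"
  then have "{s \<in> {0..t}. x s = y} = {}" by (auto simp: visited_def)
  then show ?thesis unfolding excess_eq by (simp only: measure_empty)
qed

lemma visited_const:
  assumes "0 \<le> a" "a \<le> b" "\<And>s. s \<in> {a..b} \<Longrightarrow> x s = u"
  shows "visited x b = visited x a"
proof -
  have "x s \<in> x ` {0..a}" if "0 \<le> s" "s \<le> b" for s
  proof (cases "s \<le> a")
    case False
    then have "x s = u" "x a = u" using assms(3)[of s] assms(3)[of a] assms(2) that by auto
    then have "x s = x a" by simp
    then show ?thesis using assms(1) by auto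
  qed (use that in auto)
  then have "x ` {0..b} \<subseteq> x ` {0..a}" by auto
  moreover have "x ` {0..a} \<subseteq> x ` {0..b}" using assms(2) by (intro image_mono) auto
  ultimately show ?thesis unfolding visited_def by blast
qed

lemma returned_const:
  assumes "0 \<le> a" "a \<le> b" "\<And>s. s \<in> {a..b} \<Longrightarrow> x s = u"
  shows "returned x v b = returned x v a"
proof
  assume "returned x v b"
  then obtain s1 s2 where s: "0 \<le> s1" "s1 < s2" "s2 \<le> b" "x s1 \<noteq> v" "x s2 = v" by (auto simp: returned_def)
  show "returned x v a"
  proof (cases "s2 \<le> a")
    case False
    then have "u = v" using assms(3)[of s2] s by auto
    then have "s1 < a" using assms(3)[of s1] s by force
    moreover have "x a = v" using assms(2) assms(3)[of a] \<open>u = v\<close> by simp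
    ultimately show ?thesis using s by (auto simp: returned_def)
  qed (use s in \<open>auto simp: returned_def\<close>)
next
  assume "returned x v a"
  then show "returned x v b" using order_trans[OF _ assms(2)] unfolding returned_def by blast
qed

lemma compensator_le:
  assumes "0 \<le> a" "a \<le> b"
  shows "compensator adj x u v a b \<le> ennreal ((1 + b) * (b - a))"
proof -
  have "compensator adj x u v a b \<le> (\<integral>\<^sup>+ r. ennreal (1 + b) * indicator {a<..b} r \<partial>lborel)"
    unfolding compensator_def
  proof (rule nn_integral_mono)
    fix r
    have "ennreal (local_time x v r) \<le> ennreal (1 + b)" if "a < r" "r \<le> b"
      using excess_le[of r v] that assms by (intro ennreal_leI) (simp add: excess_def)
    then show "(if x r = u \<and> adj u v then ennreal (local_time x v r) else 0) * indicator {a<..b} r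
        \<le> ennreal (1 + b) * indicator {a<..b} r"
      by (auto simp: indicator_def)
  qed
  also have "\<dots> = ennreal ((1 + b) * (b - a))"
    using assms by (subst nn_integral_cmult_indicator) (auto simp: ennreal_mult simp del: ennreal_plus)
  finally show ?thesis .
qed

text \<open>While the process sits at \<open>u\<close>, the local time of the other vertex
  \<open>v\<close> stands still, so the intensity is constant and the integral is exact.\<close>

lemma compensator_const:
  assumes "0 \<le> a" "a \<le> b" "\<And>s. s \<in> {a..b} \<Longrightarrow> x s = w" "u \<noteq> v"
  shows "compensator adj x u v a b = (if w = u \<and> adj u v then ennreal ((b - a) * (1 + excess x a v)) else 0)"
proof -
  have "compensator adj x u v a b
    = (\<integral>\<^sup>+ r. (if w = u \<and> adj u v then ennreal (1 + excess x a v) else 0) * indicator {a<..b} r \<partial>lborel)"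
    unfolding compensator_def
  proof (rule nn_integral_cong)
    fix r
    have "local_time x v r = 1 + excess x a v" if r: "a < r" "r \<le> b" "w = u"
    proof -
      have "excess x r v = excess x a v + (if v = w then r - a else 0)"
        by (rule excess_const) (use assms(1,3) r in auto)
      then show ?thesis using assms(4) r(3) by (simp add: excess_def)
    qed
    moreover have "x r = w" if "a < r" "r \<le> b" using that assms(3) by simp
    ultimately show "(if x r = u \<and> adj u v then ennreal (local_time x v r) else 0) * indicator {a<..b} r
        = (if w = u \<and> adj u v then ennreal (1 + excess x a v) else 0) * indicator {a<..b} r"
      by (auto simp: indicator_def)
  qed
  also have "\<dots> = (if w = u \<and> adj u v then ennreal ((b - a) * (1 + excess x a v)) else 0)"
    using assms excess_nonneg[of a v]
    by (subst nn_integral_cmult_indicator) (auto simp: ennreal_mult mult.commute simp del: ennreal_plus)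
  finally show ?thesis .
qed

end

section \<open>Paths on a weighted tree: the change over one grid cell\<close>

definition words :: "nat \<Rightarrow> nat list set" where
  "words K = {w. set w \<subseteq> {..<K} \<and> length w \<le> K}"

lemma finite_words: "finite (words K)"
  unfolding words_def by (rule finite_lists_length_le) simp

locale tree_path = countable_jump_path adj x + weighted_tree adj c B al
  for adj :: "nat list \<Rightarrow> nat list \<Rightarrow> bool" and x c B al +
  assumes start: "x 0 = []"
begin

text \<open>The only edge between words with prefix \<open>u\<close> and words without it joins
  \<open>u\<close> to its parent, so a path started outside this subtree first enters it at
  \<open>u\<close>.\<close>

lemma not_visited_child:
  assumes "0 \<le> s" "u \<notin> visited x s" "u \<noteq> []"
  shows "u @ [j] \<notin> visited x s"
proof
  assume "u @ [j] \<in> visited x s"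
  then obtain q where q: "0 \<le> q" "q \<le> s" "x q = u @ [j]" by (auto simp: visited_def)
  let ?A = "{w. \<exists>z. w = u @ z}"
  have "x 0 \<notin> ?A" using start assms(3) by simp
  moreover have "x q \<in> ?A" using q by simp
  ultimately obtain r w where r: "0 < r" "r \<le> q" "x r \<in> ?A" "w \<notin> ?A" "adj w (x r)"
    by (rule first_entrance[OF order_refl q(1)]) blast
  obtain z where z: "x r = u @ z" using r(3) by blast
  from adj_tree[OF r(5)] obtain i where "x r = w @ [i] \<or> w = x r @ [i]" by blast
  then have "x r = u" 
  proof
    assume *: "x r = w @ [i]"
    then have "u @ z = w @ [i]" using z by simp
    show ?thesis
    proof (cases z rule: rev_cases)
      case Nil
      then show ?thesis using z by simp
    next
      case (snoc ys y)
      then have "w = u @ ys" using \<open>u @ z = w @ [i]\<close> by simp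
      then show ?thesis using r(4) by blast
    qed
  next
    assume "w = x r @ [i]"
    then have "w = u @ (z @ [i])" using z by simp
    then show ?thesis using r(4) by blast
  qed
  moreover have "x r \<in> visited x s"
    unfolding visited_def by (rule imageI) (use r(1,2) q(2) in auto)
  ultimately show False using assms(2) by simp
qed

definition psi :: "nat list set \<Rightarrow> real \<Rightarrow> real" where
  "psi W s = lyap W (visited x s) (returned x [] s) (excess x s) (x s)"

definition dr :: "nat list set \<Rightarrow> real \<Rightarrow> real" where
  "dr W s = drift W (visited x s) (returned x [] s) (excess x s) (x s)"

text \<open>The change that a jump from \<open>u\<close> to \<open>v\<close> at time
  \<open>s\<close> would cause with the local times frozen. It vanishes unless the process is at
  \<open>u\<close>, so that sums over all pairs, with index sets that do not depend on the path,
  pick out the actual jump.\<close>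

definition jmp :: "nat list set \<Rightarrow> nat list \<Rightarrow> nat list \<Rightarrow> real \<Rightarrow> real" where
  "jmp W u v s = (if x s = u \<and> adj u v
     then lyap W (insert v (visited x s)) (returned x [] s \<or> v = []) (excess x s) v - psi W s else 0)"

lemma excess_all_nonneg: "\<forall>u. 0 \<le> excess x s u"
  by (simp add: excess_nonneg)

lemma psi_bounds: "0 \<le> psi W s" "psi W s \<le> 1"
  unfolding psi_def using lyap_bounds[OF excess_all_nonneg] by auto

lemma jmp_abs_le: "\<bar>jmp W u v s\<bar> \<le> 1"
  unfolding jmp_def using psi_bounds[of W s]
    lyap_bounds[OF excess_all_nonneg, of W "insert v (visited x s)" "returned x [] s \<or> v = []" s v]
  by (auto simp: abs_le_iff)

lemma drift_bounds:
  assumes "\<forall>u. 0 \<le> l u"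
  shows "0 \<le> drift W V b l y" "drift W V b l y \<le> 1"
proof -
  have "al * exp (- (l [] / 2)) \<le> 1 * 1"
    using al_nonneg al_le_1 assms by (intro mult_mono) auto
  moreover have "pth V l (butlast y) * esc V l y \<le> 1 * 1"
    using pth_bounds[OF assms] esc_bounds[OF assms]
    by (intro mult_mono) (auto intro: order_trans[OF esc_bounds(2)[OF assms]])
  moreover have "0 \<le> pth V l (butlast y) * esc V l y"
    using pth_bounds[OF assms] esc_bounds[OF assms] by simp
  ultimately show "0 \<le> drift W V b l y" "drift W V b l y \<le> 1"
    using al_nonneg by (auto simp: drift_def)
qed

lemma dr_bounds: "0 \<le> dr W s" "dr W s \<le> 1"
  unfolding dr_def using drift_bounds[OF excess_all_nonneg] by auto

lemma psi_step_const:
  assumes "0 \<le> a" "a \<le> b" "path_jumps x \<inter> {a<..b} = {}"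
  shows "psi W b - psi W a \<le> dr W a * (b - a)"
proof -
  have c: "\<And>s. s \<in> {a..b} \<Longrightarrow> x s = x a" by (rule const_no_jump) (use assms in auto)
  have "excess x b = (excess x a)(x a := excess x a (x a) + (b - a))"
    using excess_const[OF assms(1,2) c] by (auto simp: fun_eq_iff)
  moreover have "x b = x a" using c[of b] assms(2) by simp
  ultimately show ?thesis
    using lyap_drift[OF excess_all_nonneg, of "b - a" W "visited x a" "returned x [] a" a "x a"] assms(2)
      visited_const[OF assms(1,2) c] returned_const[OF assms(1,2) c, of "[]"]
    unfolding psi_def dr_def by simp
qed

lemma state_after_jump:
  assumes "0 \<le> a" "path_jumps x \<inter> {a<..b} = {r}"
  shows "x b = x r" "visited x b = insert (x r) (visited x a)"
    "returned x [] b = (returned x [] a \<or> x r = [])"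
proof -
  note s = single_jump[OF assms]
  show xb: "x b = x r" using s(4)[of b] s(2) by simp
  show "visited x b = insert (x r) (visited x a)"
  proof -
    have "x q \<in> insert (x r) (x ` {0..a})" if "0 \<le> q" "q \<le> b" for q
    proof -
      consider "q \<le> a" | "a < q" "q < r" | "r \<le> q" by linarith
      then show ?thesis
      proof cases
        case 2
        then have "x q = x a" using s(3)[of q] by simp
        then show ?thesis using assms(1) by auto
      next
        case 3
        then show ?thesis using s(4)[of q] that by simp
      qed (use that in auto)
    qed
    then have "x ` {0..b} \<subseteq> insert (x r) (x ` {0..a})" by (intro image_subsetI) simp
    moreover have "x r \<in> x ` {0..b}" using s(1,2) assms(1) by auto
    moreover have "x ` {0..a} \<subseteq> x ` {0..b}" using s(1,2) by (intro image_mono) auto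
    ultimately show ?thesis unfolding visited_def by blast
  qed
  show "returned x [] b = (returned x [] a \<or> x r = [])"
  proof
    assume "returned x [] b"
    then obtain s1 s2 where q: "0 \<le> s1" "s1 < s2" "s2 \<le> b" "x s1 \<noteq> []" "x s2 = []" by (auto simp: returned_def)
    consider "s2 \<le> a" | "a < s2" "s2 < r" | "r \<le> s2" by linarith
    then show "returned x [] a \<or> x r = []"
    proof cases
      case 1
      then show ?thesis using q by (auto simp: returned_def)
    next
      case 2
      then have xa: "x a = []" using s(3)[of s2] q by simp
      have "s1 < a"
      proof (rule ccontr)
        assume "\<not> s1 < a"
        then have "x s1 = x a" using s(3)[of s1] q 2 by simp
        with xa q show False by simp
      qed
      then show ?thesis using q xa by (auto simp: returned_def)
    next
      case 3
      then show ?thesis using s(4)[of s2] q by simp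
    qed
  next
    assume "returned x [] a \<or> x r = []"
    then show "returned x [] b"
    proof
      assume "returned x [] a"
      moreover have "s2 \<le> b" if "s2 \<le> a" for s2 using s(1,2) that by linarith
      ultimately show ?thesis unfolding returned_def by blast
    next
      assume "x r = []"
      moreover then have "x a \<noteq> []" using s(6) by simp
      ultimately show ?thesis unfolding returned_def using s(1,2) assms(1) by blast
    qed
  qed
qed

text \<open>Evaluating the effect of the jump with the local times of the left endpoint costs an
  error proportional to the length of the cell. Only finitely many cells contain a jump, so these
  errors vanish in the limit.\<close>

lemma psi_step_jump:
  assumes "0 \<le> a" "path_jumps x \<inter> {a<..b} = {r}" "\<And>u. u \<in> W \<Longrightarrow> length u \<le> K"
  shows "psi W b \<le> lyap W (insert (x r) (visited x a)) (returned x [] a \<or> x r = []) (excess x a) (x r)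
    + (real K + 1) * (b - a)"
proof -
  note s = single_jump(1,2)[OF assms(1,2)]
  have "\<bar>psi W b - lyap W (insert (x r) (visited x a)) (returned x [] a \<or> x r = []) (excess x a) (x r)\<bar>
    \<le> (real K + 1) * (b - a)"
    unfolding psi_def state_after_jump[OF assms(1,2)]
  proof (rule lyap_lipschitz[OF excess_all_nonneg excess_all_nonneg])
    show "\<bar>excess x b u - excess x a u\<bar> \<le> b - a" for u
      using excess_mono[of a b u] excess_diff_le[of a b u] s assms(1) by simp
  qed (use assms in auto)
  then show ?thesis by simp
qed

lemma sum_jmp:
  assumes "finite W"
  shows "(\<Sum>u\<in>W. \<Sum>v\<in>targets K u. jmp W u v s * f u v)
    = (if x s \<in> W then \<Sum>v\<in>targets K (x s). jmp W (x s) v s * f (x s) v else 0)"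
proof -
  have "(\<Sum>u\<in>W. \<Sum>v\<in>targets K u. jmp W u v s * f u v)
    = (\<Sum>u\<in>W. if u = x s then \<Sum>v\<in>targets K u. jmp W u v s * f u v else 0)"
    by (intro sum.cong) (auto simp: jmp_def intro!: sum.neutral)
  with assms show ?thesis by simp
qed

lemma not_subset_if_outside: "0 \<le> s \<Longrightarrow> x s \<notin> W \<Longrightarrow> \<not> visited x s \<subseteq> W"
  by (force simp: visited_def)

lemma finite_targets: "finite (targets K u)"
  by (simp add: targets_def)

lemma psi_step:
  assumes "0 \<le> a" "a \<le> b" "card (path_jumps x \<inter> {a<..b}) \<le> 1" "W = words K"
  shows "psi W b - psi W a - ((\<Sum>u\<in>W. \<Sum>v\<in>targets K u. jmp W u v a * card (jump_times x u v \<inter> {a<..b}))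
      + dr W a * (b - a)) \<le> (real K + 1) * (b - a) * card (path_jumps x \<inter> {a<..b})"
proof -
  have fin: "finite (path_jumps x \<inter> {a<..b})"
    by (rule finite_subset[OF _ finite_path_jumps[of b]]) (use assms in auto)
  have finW: "finite W" using finite_words assms by simp
  have D: "0 \<le> dr W a * (b - a)" using dr_bounds assms by simp
  have C: "0 \<le> (real K + 1) * (b - a)" using assms by simp
  show ?thesis
  proof (cases "path_jumps x \<inter> {a<..b} = {}")
    case True
    then show ?thesis
      using psi_step_const[OF assms(1,2) True, of W] jump_times_none[OF True] by simp
  next
    case False
    then have "card (path_jumps x \<inter> {a<..b}) = 1" using assms(3) fin by (simp add: card_gt_0_iff le_antisym Suc_leI)
    then obtain r where r: "path_jumps x \<inter> {a<..b} = {r}" by (auto simp: card_1_singleton_iff)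
    note s = single_jump(1,2,5,6)[OF assms(1) r]
    have sum: "(\<Sum>u\<in>W. \<Sum>v\<in>targets K u. jmp W u v a * card (jump_times x u v \<inter> {a<..b}))
      = (if x a \<in> W \<and> x r \<in> targets K (x a) then jmp W (x a) (x r) a else 0)"
    proof -
      have "(\<Sum>v\<in>targets K (x a). jmp W (x a) v a * card (jump_times x (x a) v \<inter> {a<..b}))
        = (\<Sum>v\<in>targets K (x a). if v = x r then jmp W (x a) v a else 0)"
        by (intro sum.cong) (auto simp: jump_times_single[OF assms(1) r])
      also have "\<dots> = (if x r \<in> targets K (x a) then jmp W (x a) (x r) a else 0)"
        using finite_targets by simp
      finally show ?thesis by (subst sum_jmp[OF finW]) simp
    qed
    have vis: "visited x b = insert (x r) (visited x a)" by (rule state_after_jump[OF assms(1) r])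
    consider "x a \<notin> W" | "x a \<in> W" "x r \<in> targets K (x a)" | "x a \<in> W" "x r \<notin> targets K (x a)" by blast
    then show ?thesis
    proof cases
      case 1
      then have "\<not> visited x a \<subseteq> W" using not_subset_if_outside assms(1) by blast
      then have "psi W a = 0" "psi W b = 0" by (auto simp: psi_def lyap_def vis)
      then show ?thesis unfolding sum r using 1 D C by simp
    next
      case 2
      have "psi W b \<le> lyap W (insert (x r) (visited x a)) (returned x [] a \<or> x r = []) (excess x a) (x r)
          + (real K + 1) * (b - a)"
        by (rule psi_step_jump[OF assms(1) r]) (use assms(4) in \<open>auto simp: words_def\<close>)
      then show ?thesis unfolding sum r using 2 D s(3) by (simp add: jmp_def)
    next
      case 3
      \<comment> \<open>A neighbour that is not a target is a child with index at least
        \<open>K\<close>, hence lies outside \<open>words K\<close>.\<close>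
      from adj_tree[OF s(3)] obtain i where i: "x r = x a @ [i] \<or> x a = x r @ [i]" by blast
      then have "x r = x a @ [i]"
      proof
        assume "x a = x r @ [i]"
        then have "x r = butlast (x a)" by simp
        then show ?thesis using 3 by (simp add: targets_def)
      qed
      moreover then have "\<not> i < K" using 3 by (auto simp: targets_def)
      ultimately have "x r \<notin> W" using assms(4) by (auto simp: words_def)
      then have "psi W b = 0" by (simp add: psi_def lyap_def vis)
      then show ?thesis unfolding sum r using 3 D C psi_bounds[of W a] by simp
    qed
  qed
qed

lemma generator_at:
  assumes "0 \<le> s" "B \<le> K"
  shows "dr W s + (\<Sum>v\<in>targets K (x s). jmp W (x s) v s * (1 + excess x s v)) \<le> 0"
proof -
  have "dr W s + (\<Sum>v\<in>targets K (x s). jmp W (x s) v s * (1 + excess x s v))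
    = drift W (visited x s) (returned x [] s) (excess x s) (x s) + (\<Sum>y\<in>targets K (x s). if adj (x s) y
    then (lyap W (insert y (visited x s)) (returned x [] s \<or> y = []) (excess x s) y
      - lyap W (visited x s) (returned x [] s) (excess x s) (x s)) * (1 + excess x s y) else 0)"
    unfolding dr_def psi_def jmp_def by (intro arg_cong2[where f="(+)"] refl sum.cong) auto
  also have "\<dots> \<le> 0"
  proof (rule generator_nonpos)
    show "visited x s \<subseteq> {[]}" if "\<not> returned x [] s" "x s = []"
    proof
      fix y assume "y \<in> visited x s"
      then obtain q where q: "0 \<le> q" "q \<le> s" "y = x q" by (auto simp: visited_def)
      show "y \<in> {[]}"
      proof (cases "q = s")
        case False
        then have "q < s" using q(2) by simp
        then have "x q = []" using that q(1) unfolding returned_def by blast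
        then show ?thesis using q(3) by simp
      qed (use that(2) q(3) in simp)
    qed
    show "x s \<in> visited x s" using assms by (simp add: visited_def)
  qed (use assms not_visited_child excess_nonneg excess_not_visited in auto)
  finally show ?thesis .
qed

text \<open>On a jump-free cell the compensators are exact and the generator inequality makes the
  sum nonpositive. On the remaining cells, whose number stays bounded under refinement, a crude
  bound of the order of the cell length is enough.\<close>

lemma compensated_step:
  assumes "0 \<le> a" "a \<le> b" "B \<le> K" "finite W"
  shows "(\<Sum>u\<in>W. \<Sum>v\<in>targets K u. jmp W u v a * enn2real (compensator adj x u v a b)) + dr W a * (b - a)
    \<le> ((1 + b) * (\<Sum>u\<in>W. real (card (targets K u))) + 1) * (b - a) * of_bool (path_jumps x \<inter> {a<..b} \<noteq> {})"
proof (cases "path_jumps x \<inter> {a<..b} = {}")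
  case True
  have c: "\<And>s. s \<in> {a..b} \<Longrightarrow> x s = x a" by (rule const_no_jump) (use assms True in auto)
  have "(\<Sum>u\<in>W. \<Sum>v\<in>targets K u. jmp W u v a * enn2real (compensator adj x u v a b)) + dr W a * (b - a) \<le> 0"
  proof (cases "x a \<in> W")
    case xa: True
    have "(\<Sum>v\<in>targets K (x a). jmp W (x a) v a * enn2real (compensator adj x (x a) v a b))
      = (\<Sum>v\<in>targets K (x a). jmp W (x a) v a * (1 + excess x a v)) * (b - a)"
      unfolding sum_distrib_right
    proof (rule sum.cong[OF refl])
      fix v
      show "jmp W (x a) v a * enn2real (compensator adj x (x a) v a b) = jmp W (x a) v a * (1 + excess x a v) * (b - a)"
      proof (cases "adj (x a) v")
        case True
        then have "x a \<noteq> v" using not_adj_self by auto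
        then show ?thesis using compensator_const[OF assms(1,2) c, of "x a" v] True assms excess_nonneg[of a v]
          by (simp add: enn2real_ennreal)
      qed (simp add: jmp_def)
    qed
    moreover have "(dr W a + (\<Sum>v\<in>targets K (x a). jmp W (x a) v a * (1 + excess x a v))) * (b - a) \<le> 0"
      using generator_at[of a K W] assms by (intro mult_nonpos_nonneg) auto
    ultimately show ?thesis by (subst sum_jmp[OF assms(4)]) (simp add: xa algebra_simps)
  next
    case False
    then have "\<not> visited x a \<subseteq> W" using not_subset_if_outside assms(1) by blast
    then have "dr W a = 0" by (simp add: dr_def drift_def)
    then show ?thesis using False by (subst sum_jmp[OF assms(4)]) simp
  qed
  then show ?thesis using True by simp
next
  case False
  have e: "enn2real (compensator adj x u v a b) \<le> (1 + b) * (b - a)" for u v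
    by (rule enn2real_leI) (use compensator_le[OF assms(1,2)] assms in auto)
  have "jmp W u v a * enn2real (compensator adj x u v a b) \<le> 1 * ((1 + b) * (b - a))" for u v
    by (rule mult_mono) (use e jmp_abs_le[of W u v a] assms in auto)
  then have "(\<Sum>u\<in>W. \<Sum>v\<in>targets K u. jmp W u v a * enn2real (compensator adj x u v a b))
    \<le> (\<Sum>u\<in>W. \<Sum>v\<in>targets K u. (1 + b) * (b - a))"
    by (intro sum_mono) simp
  moreover have "dr W a * (b - a) \<le> 1 * (b - a)"
    using dr_bounds assms by (intro mult_right_mono) auto
  moreover have "(\<Sum>u\<in>W. \<Sum>v\<in>targets K u. (1 + b) * (b - a)) = (1 + b) * (\<Sum>u\<in>W. real (card (targets K u))) * (b - a)"
    by (simp add: sum_distrib_left sum_distrib_right mult_ac)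
  ultimately show ?thesis using False by (simp add: distrib_right)
qed

end

section \<open>Discretisation and measurability\<close>

context jump_path
begin

text \<open>Once every cell contains at most one jump, jumps from \<open>u\<close> to
  \<open>v\<close> show up as changes between neighbouring grid points. The number of jumps thus
  becomes a limit of functions of finitely many values of the path, which yields its
  measurability.\<close>

lemma jump_count_grid:
  assumes "0 \<le> a" "a \<le> b" "u \<noteq> v"
  shows "\<exists>n0. \<forall>n\<ge>n0. card (jump_times x u v \<inter> {a<..b})
    = (\<Sum>i<n. of_bool (x (grid a b n i) = u \<and> x (grid a b n (Suc i)) = v))"
proof -
  let ?T = "path_jumps x \<inter> {0..b}"
  from grid_separates[OF finite_path_jumps[of b] assms(2)]
  obtain n0 where n0: "n0 > 0"
    "\<And>n i. n \<ge> n0 \<Longrightarrow> card (?T \<inter> {grid a b n i<..grid a b n (Suc i)}) \<le> 1" by blast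
  have "card (jump_times x u v \<inter> {a<..b})
    = (\<Sum>i<n. of_bool (x (grid a b n i) = u \<and> x (grid a b n (Suc i)) = v))" if n: "n \<ge> n0" for n
  proof -
    let ?g = "grid a b n"
    have "card (jump_times x u v \<inter> {a<..b}) = card (jump_times x u v \<inter> {?g 0<..?g n})"
      using n n0(1) by simp
    also have "\<dots> = (\<Sum>i<n. card (jump_times x u v \<inter> {?g i<..?g (Suc i)}))"
      by (rule sum_card_partition[symmetric]) (use n n0(1) mono_grid finite_jump_times assms in auto)
    also have "\<dots> = (\<Sum>i<n. of_bool (x (?g i) = u \<and> x (?g (Suc i)) = v))"
    proof (rule sum.cong[OF refl])
      fix i assume "i \<in> {..<n}"
      then have i: "Suc i \<le> n" by simp
      have g: "0 \<le> ?g i" "?g i \<le> ?g (Suc i)" "?g (Suc i) \<le> b"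
        using grid_ge[OF assms(2), of n i] assms(1) monoD[OF mono_grid[OF assms(2)], of i "Suc i" n]
          grid_le[OF assms(2) i] by auto
      have eq: "?T \<inter> {?g i<..?g (Suc i)} = path_jumps x \<inter> {?g i<..?g (Suc i)}" using g by auto
      have fin: "finite (path_jumps x \<inter> {?g i<..?g (Suc i)})"
        unfolding eq[symmetric] using finite_path_jumps by simp
      have c1: "card (path_jumps x \<inter> {?g i<..?g (Suc i)}) \<le> 1" using n0(2)[OF n, of i] unfolding eq .
      show "card (jump_times x u v \<inter> {?g i<..?g (Suc i)}) = of_bool (x (?g i) = u \<and> x (?g (Suc i)) = v)"
      proof (cases "path_jumps x \<inter> {?g i<..?g (Suc i)} = {}")
        case True
        have "x (?g (Suc i)) = x (?g i)" by (rule const_no_jump[OF g(1) True]) (use g in auto)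
        then show ?thesis using jump_times_none[OF True] assms(3) by auto
      next
        case False
        then have "card (path_jumps x \<inter> {?g i<..?g (Suc i)}) = 1"
          using c1 fin by (simp add: card_gt_0_iff le_antisym Suc_leI)
        then obtain r where r: "path_jumps x \<inter> {?g i<..?g (Suc i)} = {r}" by (auto simp: card_1_singleton_iff)
        have "x (?g (Suc i)) = x r"
          using single_jump(4)[OF g(1) r, of "?g (Suc i)"] single_jump(2)[OF g(1) r] by simp
        then show ?thesis using jump_times_single[OF g(1) r] by auto
      qed
    qed
    finally show ?thesis .
  qed
  then show ?thesis by blast
qed

text \<open>The countable set of times consists of rational fractions of \<open>s\<close> rather
  than rational times, so that \<open>q = 1\<close> gives the endpoint \<open>s\<close>, which
  cannot be approached from the right inside \<open>{0..s}\<close>.\<close>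

lemma dense_time:
  assumes "0 \<le> r" "r \<le> s" "r < e"
  shows "\<exists>q\<in>\<rat>. 0 \<le> q \<and> q \<le> 1 \<and> r \<le> s * q \<and> s * q < e \<and> x (s * q) = x r"
proof (cases "r = s")
  case True
  then show ?thesis using assms by (intro bexI[of _ 1]) auto
next
  case False
  then have s: "0 < s" "r < s" using assms by auto
  from right_const[OF assms(1)] obtain d where d: "d > r" "\<And>q. r < q \<Longrightarrow> q < d \<Longrightarrow> x q = x r"
    by (auto simp: eventually_at_right_field)
  have "r / s < min (min d e) s / s" using d s assms by (intro divide_strict_right_mono) auto
  then obtain q where q: "q \<in> \<rat>" "r / s < q" "q < min (min d e) s / s" using Rats_dense_in_real by blast
  then have sq: "r < s * q" "s * q < min (min d e) s" using s by (auto simp: field_simps)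
  have "0 \<le> q" using q(2) assms s by (meson divide_nonneg_pos less_imp_le order_trans)
  moreover have "q \<le> 1" using sq s by simp
  ultimately show ?thesis using q(1) sq d(2)[of "s * q"] by (intro bexI[of _ q]) auto
qed

lemma visited_rational:
  assumes "0 \<le> s"
  shows "v \<in> visited x s \<longleftrightarrow> (\<exists>q\<in>\<rat> \<inter> {0..1}. x (s * q) = v)"
proof
  assume "v \<in> visited x s"
  then obtain r where "0 \<le> r" "r \<le> s" "v = x r" by (auto simp: visited_def)
  with dense_time[of r s "r + 1"] show "\<exists>q\<in>\<rat> \<inter> {0..1}. x (s * q) = v" by fastforce
next
  assume "\<exists>q\<in>\<rat> \<inter> {0..1}. x (s * q) = v"
  then obtain q where "0 \<le> q" "q \<le> 1" "x (s * q) = v" by auto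
  moreover from this assms have "s * q \<in> {0..s}" using mult_left_le[of q s] by simp
  ultimately show "v \<in> visited x s" unfolding visited_def by blast
qed

lemma returned_rational:
  assumes "0 \<le> s"
  shows "returned x v s \<longleftrightarrow> (\<exists>q1\<in>\<rat> \<inter> {0..1}. \<exists>q2\<in>\<rat> \<inter> {0..1}. s * q1 < s * q2 \<and> x (s * q1) \<noteq> v \<and> x (s * q2) = v)"
proof
  assume "returned x v s"
  then obtain s1 s2 where s: "0 \<le> s1" "s1 < s2" "s2 \<le> s" "x s1 \<noteq> v" "x s2 = v" by (auto simp: returned_def)
  from dense_time[of s1 s s2] s obtain q1 where
    "q1 \<in> \<rat>" "0 \<le> q1" "q1 \<le> 1" "s * q1 < s2" "x (s * q1) = x s1" by auto
  moreover from dense_time[of s2 s "s2 + 1"] s obtain q2 where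
    "q2 \<in> \<rat>" "0 \<le> q2" "q2 \<le> 1" "s2 \<le> s * q2" "x (s * q2) = x s2" by auto
  ultimately show "\<exists>q1\<in>\<rat> \<inter> {0..1}. \<exists>q2\<in>\<rat> \<inter> {0..1}. s * q1 < s * q2 \<and> x (s * q1) \<noteq> v \<and> x (s * q2) = v"
    using s(4,5) by (intro bexI[of _ q1] bexI[of _ q2]) auto
next
  assume "\<exists>q1\<in>\<rat> \<inter> {0..1}. \<exists>q2\<in>\<rat> \<inter> {0..1}. s * q1 < s * q2 \<and> x (s * q1) \<noteq> v \<and> x (s * q2) = v"
  then obtain q1 q2 where q: "0 \<le> q1" "q2 \<le> 1" "s * q1 < s * q2" "x (s * q1) \<noteq> v" "x (s * q2) = v" by auto
  have "s * q2 \<le> s" "0 \<le> s * q1" using q assms mult_left_mono[of q2 1 s] by auto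
  then show "returned x v s" using q unfolding returned_def by blast
qed

end

context tree_path
begin

text \<open>This sum uses the actual jumps and \<open>comp_sum\<close> the compensators. In both,
  the coefficients are read off at the left endpoint of a cell and are thus known before the jumps
  in it occur.\<close>

definition psi_sum :: "nat \<Rightarrow> real \<Rightarrow> nat \<Rightarrow> real" where
  "psi_sum K t n = (\<Sum>i<n. (\<Sum>u\<in>words K. \<Sum>v\<in>targets K u. jmp (words K) u v (grid 0 t n i)
      * card (jump_times x u v \<inter> {grid 0 t n i<..grid 0 t n (Suc i)})) + dr (words K) (grid 0 t n i) * (t / n))"

definition comp_sum :: "nat \<Rightarrow> real \<Rightarrow> nat \<Rightarrow> real" where
  "comp_sum K t n = (\<Sum>i<n. (\<Sum>u\<in>words K. \<Sum>v\<in>targets K u. jmp (words K) u v (grid 0 t n i)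
      * enn2real (compensator adj x u v (grid 0 t n i) (grid 0 t n (Suc i)))) + dr (words K) (grid 0 t n i) * (t / n))"

lemma sum_jumps_grid:
  assumes "0 \<le> t" "0 < n"
  shows "(\<Sum>i<n. card (path_jumps x \<inter> {grid 0 t n i<..grid 0 t n (Suc i)})) = card (path_jumps x \<inter> {0<..t})"
proof -
  have "finite (path_jumps x \<inter> {0<..t})"
    by (rule finite_subset[OF _ finite_path_jumps[of t]]) auto
  then have "finite (path_jumps x \<inter> {grid 0 t n 0<..grid 0 t n n})" using assms(2) by simp
  from sum_card_partition[OF mono_grid[OF assms(1)] this] show ?thesis using assms(2) by simp
qed

lemma grid_props:
  assumes "0 \<le> t"
  shows "0 \<le> grid 0 t n i" "grid 0 t n i \<le> grid 0 t n (Suc i)" "i < n \<Longrightarrow> grid 0 t n (Suc i) \<le> t"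
    "grid 0 t n (Suc i) - grid 0 t n i = t / n"
  using grid_ge[OF assms, of n i] monoD[OF mono_grid[OF assms], of i "Suc i" n]
    grid_le[OF assms, of "Suc i" n] grid_Suc[of 0 t n i] by auto

text \<open>Errors arise only in cells containing a jump, each of order \<open>t / n\<close>. The
  constant depends on the path, which is enough for convergence path by path.\<close>

lemma psi_error:
  assumes "0 \<le> t"
  shows "\<exists>C. \<forall>\<^sub>F n in sequentially. psi (words K) t - psi (words K) 0 - psi_sum K t n \<le> C / n"
proof -
  let ?W = "words K" and ?T = "path_jumps x \<inter> {0..t}"
  from grid_separates[OF finite_path_jumps[of t] assms]
  obtain n0 where n0: "n0 > 0"
    "\<And>n i. n \<ge> n0 \<Longrightarrow> card (?T \<inter> {grid 0 t n i<..grid 0 t n (Suc i)}) \<le> 1" by blast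
  have "psi ?W t - psi ?W 0 - psi_sum K t n \<le> ((real K + 1) * t * card (path_jumps x \<inter> {0<..t})) / n"
    if n: "n \<ge> n0" for n
  proof -
    let ?g = "grid 0 t n"
    have n': "0 < n" using n n0 by simp
    have "psi ?W t - psi ?W 0 = (\<Sum>i<n. psi ?W (?g (Suc i)) - psi ?W (?g i))"
      using sum_lessThan_telescope[of "\<lambda>i. psi ?W (?g i)" n] n' by simp
    then have "psi ?W t - psi ?W 0 - psi_sum K t n
      = (\<Sum>i<n. psi ?W (?g (Suc i)) - psi ?W (?g i) - ((\<Sum>u\<in>?W. \<Sum>v\<in>targets K u. jmp ?W u v (?g i)
          * card (jump_times x u v \<inter> {?g i<..?g (Suc i)})) + dr ?W (?g i) * (t / n)))"
      unfolding psi_sum_def by (simp add: sum_subtractf)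
    also have "\<dots> \<le> (\<Sum>i<n. (real K + 1) * (t / n) * card (path_jumps x \<inter> {?g i<..?g (Suc i)}))"
    proof (rule sum_mono)
      fix i assume "i \<in> {..<n}"
      then have g: "0 \<le> ?g i" "?g i \<le> ?g (Suc i)" "?g (Suc i) \<le> t"
        using grid_props(1,2)[OF assms, of n i] grid_props(3)[OF assms, of i n] by simp_all
      have "?T \<inter> {?g i<..?g (Suc i)} = path_jumps x \<inter> {?g i<..?g (Suc i)}" using g by auto
      then have "card (path_jumps x \<inter> {?g i<..?g (Suc i)}) \<le> 1" using n0(2)[OF n, of i] by simp
      from psi_step[OF g(1,2) this refl, of K]
      show "psi ?W (?g (Suc i)) - psi ?W (?g i) - ((\<Sum>u\<in>?W. \<Sum>v\<in>targets K u. jmp ?W u v (?g i)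
          * card (jump_times x u v \<inter> {?g i<..?g (Suc i)})) + dr ?W (?g i) * (t / n))
        \<le> (real K + 1) * (t / n) * card (path_jumps x \<inter> {?g i<..?g (Suc i)})"
        unfolding grid_props(4)[OF assms] .
    qed
    also have "\<dots> = (real K + 1) * (t / n) * card (path_jumps x \<inter> {0<..t})"
      unfolding sum_distrib_left[symmetric] sum_jumps_grid[OF assms n', symmetric] by simp
    finally show ?thesis by simp
  qed
  then show ?thesis
    by (intro exI[of _ "(real K + 1) * t * card (path_jumps x \<inter> {0<..t})"]) (rule eventually_sequentiallyI)
qed

text \<open>The bound does not depend on \<open>n\<close> and has finite expectation along the
  process: it is the dominating function for the grid sums.\<close>

lemma psi_sum_abs_le:
  assumes "0 \<le> t" "0 < n"
  shows "\<bar>psi_sum K t n\<bar> \<le> (\<Sum>u\<in>words K. \<Sum>v\<in>targets K u. real (card (jump_times x u v \<inter> {0<..t}))) + t"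
proof -
  let ?W = "words K" and ?g = "grid 0 t n"
  let ?j = "\<lambda>i u v. card (jump_times x u v \<inter> {?g i<..?g (Suc i)})"
  have "\<bar>psi_sum K t n\<bar> \<le> (\<Sum>i<n. \<bar>(\<Sum>u\<in>?W. \<Sum>v\<in>targets K u. jmp ?W u v (?g i) * ?j i u v) + dr ?W (?g i) * (t / n)\<bar>)"
    unfolding psi_sum_def by (rule sum_abs)
  also have "\<dots> \<le> (\<Sum>i<n. (\<Sum>u\<in>?W. \<Sum>v\<in>targets K u. real (?j i u v)) + t / n)"
  proof (rule sum_mono)
    fix i
    have "\<bar>\<Sum>u\<in>?W. \<Sum>v\<in>targets K u. jmp ?W u v (?g i) * ?j i u v\<bar>
        \<le> (\<Sum>u\<in>?W. \<Sum>v\<in>targets K u. \<bar>jmp ?W u v (?g i) * ?j i u v\<bar>)"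
      by (intro order_trans[OF sum_abs] sum_mono sum_abs)
    also have "\<dots> \<le> (\<Sum>u\<in>?W. \<Sum>v\<in>targets K u. 1 * real (?j i u v))"
      unfolding abs_mult by (intro sum_mono mult_mono jmp_abs_le) auto
    finally have 1: "\<bar>\<Sum>u\<in>?W. \<Sum>v\<in>targets K u. jmp ?W u v (?g i) * ?j i u v\<bar>
        \<le> (\<Sum>u\<in>?W. \<Sum>v\<in>targets K u. real (?j i u v))" by simp
    have "0 \<le> dr ?W (?g i) * (t / n)" using dr_bounds(1)[of ?W "?g i"] assms by simp
    moreover have "dr ?W (?g i) * (t / n) \<le> 1 * (t / n)"
      by (rule mult_right_mono[OF dr_bounds(2)]) (use assms in simp)
    ultimately show "\<bar>(\<Sum>u\<in>?W. \<Sum>v\<in>targets K u. jmp ?W u v (?g i) * ?j i u v) + dr ?W (?g i) * (t / n)\<bar>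
        \<le> (\<Sum>u\<in>?W. \<Sum>v\<in>targets K u. real (?j i u v)) + t / n" using 1 by linarith
  qed
  also have "\<dots> = (\<Sum>i<n. \<Sum>u\<in>?W. \<Sum>v\<in>targets K u. real (?j i u v)) + t"
    using assms by (simp add: sum.distrib)
  also have "(\<Sum>i<n. \<Sum>u\<in>?W. \<Sum>v\<in>targets K u. real (?j i u v))
      = (\<Sum>u\<in>?W. \<Sum>v\<in>targets K u. \<Sum>i<n. real (?j i u v))"
    by (subst sum.swap, rule sum.cong[OF refl], rule sum.swap)
  also have "\<dots> = (\<Sum>u\<in>?W. \<Sum>v\<in>targets K u. real (card (jump_times x u v \<inter> {0<..t})))"
  proof (intro sum.cong refl)
    fix u v
    have "(\<Sum>i<n. ?j i u v) = card (jump_times x u v \<inter> {?g 0<..?g n})"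
      by (rule sum_card_partition) (use mono_grid assms finite_jump_times in auto)
    then show "(\<Sum>i<n. real (?j i u v)) = real (card (jump_times x u v \<inter> {0<..t}))"
      using assms by (simp flip: of_nat_sum)
  qed
  finally show ?thesis .
qed

text \<open>The first bound gives convergence along each path; the second depends neither on the
  path nor on \<open>n\<close> and serves as domination.\<close>

lemma comp_sum_le:
  assumes "0 \<le> t" "0 < n" "B \<le> K"
  defines "M \<equiv> (1 + t) * (\<Sum>u\<in>words K. real (card (targets K u))) + 1"
  shows "comp_sum K t n \<le> M * t * card (path_jumps x \<inter> {0<..t}) / n" "comp_sum K t n \<le> M * t"
proof -
  let ?W = "words K" and ?g = "grid 0 t n"
  have M: "0 \<le> M" unfolding M_def using assms(1) by (auto intro!: add_nonneg_nonneg mult_nonneg_nonneg sum_nonneg)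
  have step: "(\<Sum>u\<in>?W. \<Sum>v\<in>targets K u. jmp ?W u v (?g i) * enn2real (compensator adj x u v (?g i) (?g (Suc i))))
      + dr ?W (?g i) * (t / n) \<le> M * (t / n) * of_bool (path_jumps x \<inter> {?g i<..?g (Suc i)} \<noteq> {})"
    if "i < n" for i
  proof -
    note g = grid_props[OF assms(1), where n=n and i=i]
    have "(\<Sum>u\<in>?W. \<Sum>v\<in>targets K u. jmp ?W u v (?g i) * enn2real (compensator adj x u v (?g i) (?g (Suc i))))
      + dr ?W (?g i) * (?g (Suc i) - ?g i) \<le> ((1 + ?g (Suc i)) * (\<Sum>u\<in>words K. real (card (targets K u))) + 1)
        * (?g (Suc i) - ?g i) * of_bool (path_jumps x \<inter> {?g i<..?g (Suc i)} \<noteq> {})"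
      by (rule compensated_step) (use g assms finite_words in auto)
    also have "\<dots> \<le> M * (?g (Suc i) - ?g i) * of_bool (path_jumps x \<inter> {?g i<..?g (Suc i)} \<noteq> {})"
      unfolding M_def using g(1,2) g(3)[OF that] by (intro mult_right_mono add_mono sum_nonneg) auto
    finally show ?thesis unfolding g(4) .
  qed
  have "comp_sum K t n \<le> (\<Sum>i<n. M * (t / n) * of_bool (path_jumps x \<inter> {?g i<..?g (Suc i)} \<noteq> {}))"
    unfolding comp_sum_def using step by (intro sum_mono) auto
  also have "\<dots> \<le> (\<Sum>i<n. M * (t / n) * real (card (path_jumps x \<inter> {?g i<..?g (Suc i)})))"
  proof (intro sum_mono mult_left_mono)
    fix i assume "i \<in> {..<n}"
    then have "finite (path_jumps x \<inter> {?g i<..?g (Suc i)})"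
      by (intro finite_subset[OF _ finite_path_jumps[of t]])
        (use grid_props(1)[OF assms(1), of n i] grid_props(3)[OF assms(1), of i n] in auto)
    then show "of_bool (path_jumps x \<inter> {?g i<..?g (Suc i)} \<noteq> {}) \<le> real (card (path_jumps x \<inter> {?g i<..?g (Suc i)}))"
      by (simp add: Suc_leI card_gt_0_iff)
  qed (use M assms in auto)
  also have "\<dots> = M * (t / n) * real (card (path_jumps x \<inter> {0<..t}))"
    unfolding sum_distrib_left[symmetric] sum_jumps_grid[OF assms(1,2), symmetric] by simp
  finally show "comp_sum K t n \<le> M * t * card (path_jumps x \<inter> {0<..t}) / n" by simp
  have "comp_sum K t n \<le> (\<Sum>i<n. M * (t / n) * 1)"
    unfolding comp_sum_def
  proof (rule sum_mono)
    fix i assume "i \<in> {..<n}"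
    then have "(\<Sum>u\<in>?W. \<Sum>v\<in>targets K u. jmp ?W u v (?g i) * enn2real (compensator adj x u v (?g i) (?g (Suc i))))
      + dr ?W (?g i) * (t / n) \<le> M * (t / n) * of_bool (path_jumps x \<inter> {?g i<..?g (Suc i)} \<noteq> {})"
      using step by simp
    also have "\<dots> \<le> M * (t / n) * 1" using M assms by (intro mult_left_mono) auto
    finally show "(\<Sum>u\<in>?W. \<Sum>v\<in>targets K u. jmp ?W u v (?g i) * enn2real (compensator adj x u v (?g i) (?g (Suc i))))
      + dr ?W (?g i) * (t / n) \<le> M * (t / n) * 1" .
  qed
  then show "comp_sum K t n \<le> M * t" using assms by simp
qed

end

section \<open>Measurability with respect to the history\<close>

context vrjp
begin

lemma path: "\<omega> \<in> space M \<Longrightarrow> jump_path (adj \<omega>) (\<lambda>r. X r \<omega>)"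
  by unfold_locales (rule X_path)

lemma countable_path: "\<omega> \<in> space M \<Longrightarrow> countable_jump_path (adj \<omega>) (\<lambda>r. X r \<omega>)"
  using path by (simp add: countable_jump_path_def)

lemma space_history [simp]: "space (history M adj X s) = space M"
  by (simp add: history_def space_measure_of_conv)

lemma sets_history: "sets (history M adj X s) = sigma_sets (space M)
     ({{\<omega> \<in> space M. adj \<omega> u v} | u v. True} \<union> {{\<omega> \<in> space M. X r \<omega> = v} | r v. 0 \<le> r \<and> r \<le> s})"
  unfolding history_def by (rule sets_measure_of) auto

lemma history_mono: "s \<le> t \<Longrightarrow> sets (history M adj X s) \<subseteq> sets (history M adj X t)"
  unfolding sets_history by (rule sigma_sets_mono') fastforce

lemma subalgebra_history: "subalgebra M (history M adj X s)"
  unfolding subalgebra_def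
proof
  show "sets (history M adj X s) \<subseteq> sets M"
    unfolding sets_history
  proof (rule sets.sigma_sets_subset)
    have "{\<omega> \<in> space M. X r \<omega> = v} \<in> sets M" if "0 \<le> r" for r v
      using measurable_sets[OF X_measurable[OF that], of "{v}"] by (simp add: vimage_def Int_def conj_commute)
    moreover have "{\<omega> \<in> space M. adj \<omega> u v} \<in> sets M" for u v
      using adj_measurable by simp
    ultimately show "{{\<omega> \<in> space M. adj \<omega> u v} | u v. True} \<union> {{\<omega> \<in> space M. X r \<omega> = v} | r v. 0 \<le> r \<and> r \<le> s} \<subseteq> sets M"
      by auto
  qed
qed simp

lemma sigma_finite_history: "sigma_finite_subalgebra M (history M adj X s)"
  by (rule finite_measure_subalgebra_is_sigma_finite)
    (simp add: finite_measure_subalgebra_def finite_measure_axioms finite_measure_subalgebra_axioms_def subalgebra_history)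

lemma measurable_history_mono: "s \<le> t \<Longrightarrow> f \<in> measurable (history M adj X s) N \<Longrightarrow> f \<in> measurable (history M adj X t) N"
  using history_mono[of s t] by (auto simp: measurable_def)

lemma measurable_from_history: "f \<in> measurable (history M adj X s) N \<Longrightarrow> f \<in> measurable M N"
  using subalgebra_history[of s] by (rule measurable_from_subalg)

lemma history_adj: "Measurable.pred (history M adj X s) (\<lambda>\<omega>. adj \<omega> u v)"
proof -
  have "{\<omega> \<in> space M. adj \<omega> u v} \<in> sets (history M adj X s)"
    unfolding sets_history by (rule sigma_sets.Basic) blast
  then show ?thesis by (simp add: pred_def)
qed

lemma history_X: "0 \<le> r \<Longrightarrow> r \<le> s \<Longrightarrow> X r \<in> measurable (history M adj X s) (count_space UNIV)"
proof -
  assume r: "0 \<le> r" "r \<le> s"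
  have "{\<omega> \<in> space M. X r \<omega> = v} \<in> sets (history M adj X s)" for v
    unfolding sets_history by (rule sigma_sets.Basic) (use r in blast)
  then show ?thesis
    by (subst measurable_count_space_eq2_countable) (auto simp: vimage_def Int_def conj_commute)
qed

lemma history_X_eq: "0 \<le> r \<Longrightarrow> r \<le> s \<Longrightarrow> Measurable.pred (history M adj X s) (\<lambda>\<omega>. X r \<omega> = v)"
  using measurable_compose[OF history_X, of r s "\<lambda>w. w = v" "count_space UNIV"] by simp

lemma scaled_time: "0 \<le> s \<Longrightarrow> q \<in> \<rat> \<inter> {0..1} \<Longrightarrow> 0 \<le> s * q \<and> s * q \<le> s" for s q :: real
  using mult_left_le[of q s] by auto

lemma pred_bex_unit_rats:
  assumes "\<And>q. q \<in> \<rat> \<inter> {0..1 :: real} \<Longrightarrow> Measurable.pred N (P q)"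
  shows "Measurable.pred N (\<lambda>\<omega>. \<exists>q\<in>\<rat> \<inter> {0..1}. P q \<omega>)"
proof -
  have "Measurable.pred N (\<lambda>\<omega>. \<exists>q :: rat. of_rat q \<in> {0..1 :: real} \<and> P (of_rat q) \<omega>)"
  proof (rule pred_intros_countable(2))
    fix q :: rat
    show "Measurable.pred N (\<lambda>\<omega>. of_rat q \<in> {0..1 :: real} \<and> P (of_rat q) \<omega>)"
      using assms[of "of_rat q"] by (cases "of_rat q \<in> {0..1 :: real}") auto
  qed
  moreover have "(\<lambda>\<omega>. \<exists>q :: rat. of_rat q \<in> {0..1 :: real} \<and> P (of_rat q) \<omega>) = (\<lambda>\<omega>. \<exists>q\<in>\<rat> \<inter> {0..1}. P q \<omega>)"
    unfolding Rats_def by (intro ext) blast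
  ultimately show ?thesis by simp
qed

lemma history_visited:
  assumes "0 \<le> s"
  shows "Measurable.pred (history M adj X s) (\<lambda>\<omega>. v \<in> visited (\<lambda>r. X r \<omega>) s)"
proof -
  have "Measurable.pred (history M adj X s) (\<lambda>\<omega>. \<exists>q\<in>\<rat> \<inter> {0..1}. X (s * q) \<omega> = v)"
    by (rule pred_bex_unit_rats) (use history_X_eq scaled_time[OF assms] in blast)
  then show ?thesis
    by (subst measurable_cong) (use jump_path.visited_rational[OF path assms] in auto)
qed

lemma history_returned:
  assumes "0 \<le> s"
  shows "Measurable.pred (history M adj X s) (\<lambda>\<omega>. returned (\<lambda>r. X r \<omega>) v s)"
proof -
  have "Measurable.pred (history M adj X s) (\<lambda>\<omega>. \<exists>q1\<in>\<rat> \<inter> {0..1}. \<exists>q2\<in>\<rat> \<inter> {0..1}.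
      s * q1 < s * q2 \<and> X (s * q1) \<omega> \<noteq> v \<and> X (s * q2) \<omega> = v)"
  proof (intro pred_bex_unit_rats)
    fix q1 q2 :: real assume "q1 \<in> \<rat> \<inter> {0..1}" "q2 \<in> \<rat> \<inter> {0..1}"
    note q = this[THEN scaled_time[OF assms]]
    have [measurable]: "Measurable.pred (history M adj X s) (\<lambda>\<omega>. X (s * q1) \<omega> = v)"
      "Measurable.pred (history M adj X s) (\<lambda>\<omega>. X (s * q2) \<omega> = v)"
      using q history_X_eq by auto
    show "Measurable.pred (history M adj X s) (\<lambda>\<omega>. s * q1 < s * q2 \<and> X (s * q1) \<omega> \<noteq> v \<and> X (s * q2) \<omega> = v)"
      by measurable
  qed
  then show ?thesis
    by (subst measurable_cong) (use jump_path.returned_rational[OF path assms] in auto)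
qed

lemma history_excess:
  assumes "0 \<le> s"
  shows "(\<lambda>\<omega>. excess (\<lambda>r. X r \<omega>) s v) \<in> borel_measurable (history M adj X s)"
proof -
  let ?H = "history M adj X s"
  \<comment> \<open>Freezing the path at time \<open>s\<close> keeps all its values measurable with
    respect to the history up to \<open>s\<close>.\<close>
  have "(\<lambda>(\<omega>, r). X (min (max 0 r) s) \<omega>) \<in> measurable (?H \<Otimes>\<^sub>M borel) (count_space UNIV)"
  proof (rule measurable_pair_right_constant[where Z="\<lambda>r. X (min r s)"])
    show "X (min r s) \<in> measurable ?H (count_space UNIV)" if "0 \<le> r" for r
      using that assms by (intro history_X) auto
    show "\<forall>\<^sub>F q in at_right r. X (min q s) \<omega> = X (min r s) \<omega>" if \<omega>: "\<omega> \<in> space ?H" "0 \<le> r" for \<omega> r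
    proof (cases "r < s")
      case True
      have "\<forall>\<^sub>F q in at_right r. X q \<omega> = X r \<omega>"
        using jump_path.right_const[OF path, of \<omega> r] \<omega> by simp
      moreover have "\<forall>\<^sub>F q in at_right r. q < s"
        unfolding eventually_at_right_field using True by blast
      ultimately show ?thesis by eventually_elim (use True in auto)
    next
      case False
      have "\<forall>\<^sub>F q in at_right r. r < q" by (rule eventually_at_right_less)
      then show ?thesis by eventually_elim (use False in auto)
    qed
  qed
  then have [measurable]: "(\<lambda>p. X (min (max 0 (snd p)) s) (fst p)) \<in> measurable (?H \<Otimes>\<^sub>M borel) (count_space UNIV)"
    by (simp add: split_beta')
  have "(\<lambda>\<omega>. LINT r|lborel. indicator {0..s} r * indicator {v} (X (min (max 0 r) s) \<omega>) :: real) \<in> borel_measurable ?H"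
  proof (rule lborel.borel_measurable_lebesgue_integral)
    have "(\<lambda>p. indicator {0..s} (snd p) * indicator {v} (X (min (max 0 (snd p)) s) (fst p)) :: real)
        \<in> borel_measurable (?H \<Otimes>\<^sub>M borel)"
      by measurable
    then show "(\<lambda>(\<omega>, r). indicator {0..s} r * indicator {v} (X (min (max 0 r) s) \<omega>) :: real)
        \<in> borel_measurable (?H \<Otimes>\<^sub>M lborel)"
      by (simp add: split_beta' cong: measurable_cong_sets)
  qed
  moreover have "excess (\<lambda>r. X r \<omega>) s v
    = (LINT r|lborel. indicator {0..s} r * indicator {v} (X (min (max 0 r) s) \<omega>))" for \<omega>
    unfolding excess_def local_time_def set_lebesgue_integral_def
    by (auto intro!: Bochner_Integration.integral_cong simp: indicator_def)
  ultimately show ?thesis by simp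
qed

lemma measurable_jump_count:
  assumes "0 \<le> s" "s \<le> t"
  shows "(\<lambda>\<omega>. real (card (jump_times (\<lambda>r. X r \<omega>) u v \<inter> {s<..t}))) \<in> borel_measurable M"
proof (cases "u = v")
  case True
  then have "jump_times y u v = {}" for y :: "real \<Rightarrow> 'v" by (simp add: jump_times_def)
  then show ?thesis by simp
next
  case False
  have X_eq: "Measurable.pred M (\<lambda>\<omega>. X r \<omega> = w)" if "0 \<le> r" for r w
    using measurable_compose[OF X_measurable[OF that], of "\<lambda>y. y = w" "count_space UNIV"] by simp
  show ?thesis
  proof (rule borel_measurable_LIMSEQ_real)
    fix \<omega> assume "\<omega> \<in> space M"
    then interpret jump_path "adj \<omega>" "\<lambda>r. X r \<omega>" by (rule path)
    obtain n0 where n0: "\<And>n. n \<ge> n0 \<Longrightarrow> card (jump_times (\<lambda>r. X r \<omega>) u v \<inter> {s<..t})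
        = (\<Sum>i<n. of_bool (X (grid s t n i) \<omega> = u \<and> X (grid s t n (Suc i)) \<omega> = v))"
      using jump_count_grid[OF assms False] by blast
    have "\<forall>\<^sub>F n in sequentially. real (card (jump_times (\<lambda>r. X r \<omega>) u v \<inter> {s<..t}))
        = real (\<Sum>i<n. of_bool (X (grid s t n i) \<omega> = u \<and> X (grid s t n (Suc i)) \<omega> = v))"
      by (rule eventually_sequentiallyI[of n0]) (use n0 in simp)
    then show "(\<lambda>n. real (\<Sum>i<n. of_bool (X (grid s t n i) \<omega> = u \<and> X (grid s t n (Suc i)) \<omega> = v)))
        \<longlonglongrightarrow> real (card (jump_times (\<lambda>r. X r \<omega>) u v \<inter> {s<..t}))"
      by (intro tendsto_eventually) (auto elim: eventually_mono)
  next
    fix n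
    have [measurable]: "Measurable.pred M (\<lambda>\<omega>. X (grid s t n i) \<omega> = w)" for i w
      using X_eq grid_ge[OF assms(2), of n i] assms(1) by simp
    show "(\<lambda>\<omega>. real (\<Sum>i<n. of_bool (X (grid s t n i) \<omega> = u \<and> X (grid s t n (Suc i)) \<omega> = v))) \<in> borel_measurable M"
      unfolding of_nat_sum of_nat_of_bool of_bool_def by measurable
  qed
qed

lemma measurable_compensator:
  assumes "0 \<le> s"
  shows "(\<lambda>\<omega>. compensator (adj \<omega>) (\<lambda>r. X r \<omega>) u v s t) \<in> borel_measurable M"
proof -
  have "(\<lambda>(\<omega>, r). X (max 0 r) \<omega>) \<in> measurable (M \<Otimes>\<^sub>M borel) (count_space UNIV)"
    by (rule measurable_pair_right_constant[where Z=X])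
      (use X_measurable jump_path.right_const[OF path] in auto)
  then have Xm: "(\<lambda>p. X (max 0 (snd p)) (fst p)) \<in> measurable (M \<Otimes>\<^sub>M borel) (count_space UNIV)"
    by (simp add: split_beta')
  note [measurable] = Xm adj_measurable
  have "(\<lambda>p. X (max 0 (snd p)) (fst (fst p))) \<in> measurable ((M \<Otimes>\<^sub>M borel) \<Otimes>\<^sub>M borel) (count_space UNIV)"
    using measurable_compose[of "\<lambda>p. (fst (fst p), snd p)" "(M \<Otimes>\<^sub>M borel) \<Otimes>\<^sub>M borel", OF _ Xm] by simp
  note [measurable] = this
  have [measurable]: "(\<lambda>p. LINT q|lborel. (if 0 \<le> q \<and> q \<le> snd p then 1 else 0) * indicator {v} (X (max 0 q) (fst p)) :: real)
      \<in> borel_measurable (M \<Otimes>\<^sub>M borel)"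
  proof (rule lborel.borel_measurable_lebesgue_integral)
    have "(\<lambda>p. (if 0 \<le> snd p \<and> snd p \<le> snd (fst p) then 1 else 0) * indicator {v} (X (max 0 (snd p)) (fst (fst p))) :: real)
        \<in> borel_measurable ((M \<Otimes>\<^sub>M borel) \<Otimes>\<^sub>M borel)"
      by measurable
    then show "(\<lambda>(p, q). (if 0 \<le> q \<and> q \<le> snd p then 1 else 0) * indicator {v} (X (max 0 q) (fst p)) :: real)
        \<in> borel_measurable ((M \<Otimes>\<^sub>M borel) \<Otimes>\<^sub>M lborel)"
      by (simp add: split_beta' cong: measurable_cong_sets)
  qed
  have "(\<lambda>\<omega>. \<integral>\<^sup>+ r. (if X (max 0 r) \<omega> = u \<and> adj \<omega> u v then ennreal (1 + (LINT q|lborel.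
      (if 0 \<le> q \<and> q \<le> r then 1 else 0) * indicator {v} (X (max 0 q) \<omega>))) else 0) * indicator {s<..t} r \<partial>lborel)
      \<in> borel_measurable M"
  proof (rule lborel.borel_measurable_nn_integral)
    have "(\<lambda>p. (if X (max 0 (snd p)) (fst p) = u \<and> adj (fst p) u v then ennreal (1 + (LINT q|lborel.
      (if 0 \<le> q \<and> q \<le> snd p then 1 else 0) * indicator {v} (X (max 0 q) (fst p)))) else 0) * indicator {s<..t} (snd p))
      \<in> borel_measurable (M \<Otimes>\<^sub>M borel)"
      by measurable
    then show "(\<lambda>(\<omega>, r). (if X (max 0 r) \<omega> = u \<and> adj \<omega> u v then ennreal (1 + (LINT q|lborel.
      (if 0 \<le> q \<and> q \<le> r then 1 else 0) * indicator {v} (X (max 0 q) \<omega>))) else 0) * indicator {s<..t} r)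
      \<in> borel_measurable (M \<Otimes>\<^sub>M lborel)"
      by (simp add: split_beta' cong: measurable_cong_sets)
  qed
  moreover have "compensator (adj \<omega>) (\<lambda>r. X r \<omega>) u v s t
    = (\<integral>\<^sup>+ r. (if X (max 0 r) \<omega> = u \<and> adj \<omega> u v then ennreal (1 + (LINT q|lborel.
      (if 0 \<le> q \<and> q \<le> r then 1 else 0) * indicator {v} (X (max 0 q) \<omega>))) else 0) * indicator {s<..t} r \<partial>lborel)" for \<omega>
    unfolding compensator_def
  proof (rule nn_integral_cong)
    fix r
    have "local_time (\<lambda>r. X r \<omega>) v r = 1 + (LINT q|lborel.
        (if 0 \<le> q \<and> q \<le> r then 1 else 0) * indicator {v} (X (max 0 q) \<omega>))"
      unfolding local_time_def set_lebesgue_integral_def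
      by (auto intro!: Bochner_Integration.integral_cong simp: indicator_def)
    then show "(if X r \<omega> = u \<and> adj \<omega> u v then ennreal (local_time (\<lambda>r. X r \<omega>) v r) else 0) * indicator {s<..t} r
      = (if X (max 0 r) \<omega> = u \<and> adj \<omega> u v then ennreal (1 + (LINT q|lborel.
      (if 0 \<le> q \<and> q \<le> r then 1 else 0) * indicator {v} (X (max 0 q) \<omega>))) else 0) * indicator {s<..t} r"
      using assms by (auto simp: indicator_def)
  qed
  ultimately show ?thesis by simp
qed

text \<open>The equality of conditional expectations is tested against a factor that is known at
  time \<open>s\<close>; this is the only way in which the intensity assumption enters.\<close>

lemma nn_intensity:
  assumes "0 \<le> s" "s \<le> t" "g \<in> borel_measurable (history M adj X s)"
  shows "(\<integral>\<^sup>+ \<omega>. g \<omega> * ennreal (real (card (jump_times (\<lambda>r. X r \<omega>) u v \<inter> {s<..t}))) \<partial>M)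
    = (\<integral>\<^sup>+ \<omega>. g \<omega> * compensator (adj \<omega>) (\<lambda>r. X r \<omega>) u v s t \<partial>M)"
proof -
  interpret sigma_finite_subalgebra M "history M adj X s" by (rule sigma_finite_history)
  let ?J = "\<lambda>\<omega>. ennreal (real (card (jump_times (\<lambda>r. X r \<omega>) u v \<inter> {s<..t})))"
  let ?C = "\<lambda>\<omega>. compensator (adj \<omega>) (\<lambda>r. X r \<omega>) u v s t"
  have J: "?J \<in> borel_measurable M" using measurable_jump_count[OF assms(1,2)] by simp
  have C: "?C \<in> borel_measurable M" by (rule measurable_compensator[OF assms(1)])
  have "AE \<omega> in M. nn_cond_exp M (history M adj X s) ?J \<omega> = nn_cond_exp M (history M adj X s) ?C \<omega>"
    using X_intensity[OF assms(1,2), of u v] unfolding compensator_def by (simp add: ennreal_of_nat_eq_real_of_nat)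
  then have "AE \<omega> in M. g \<omega> * nn_cond_exp M (history M adj X s) ?J \<omega> = g \<omega> * nn_cond_exp M (history M adj X s) ?C \<omega>"
    by eventually_elim simp
  from nn_integral_cong_AE[OF this] show ?thesis
    unfolding nn_cond_exp_intg[OF assms(3) J] nn_cond_exp_intg[OF assms(3) C] .
qed

end

context countable_jump_path
begin

text \<open>The position at any time is the position at time 0 or at the last jump before
  it.\<close>

lemma finite_visited: "finite (visited x t)"
proof -
  let ?T = "insert 0 (path_jumps x \<inter> {0..t})"
  have fin: "finite ?T" using finite_path_jumps by simp
  have "x s \<in> x ` ?T" if s: "0 \<le> s" "s \<le> t" for s
  proof -
    define r where "r = Max (?T \<inter> {..s})"
    have f: "finite (?T \<inter> {..s})" using fin by simp
    have "0 \<in> ?T \<inter> {..s}" using s by simp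
    then have r: "r \<in> ?T \<inter> {..s}" unfolding r_def using f by (intro Max_in) auto
    then have r0: "0 \<le> r" using s by auto
    have "path_jumps x \<inter> {r<..s} = {}"
    proof (rule ccontr)
      assume "path_jumps x \<inter> {r<..s} \<noteq> {}"
      then obtain q where q: "q \<in> path_jumps x" "r < q" "q \<le> s" by auto
      then have "q \<in> ?T \<inter> {..s}" using s r0 by auto
      then have "q \<le> r" unfolding r_def using f by (rule Max_ge[rotated])
      with q show False by simp
    qed
    then have "x s = x r" by (rule const_no_jump[OF r0]) (use r in auto)
    then show ?thesis using r by blast
  qed
  then have "visited x t \<subseteq> x ` ?T" unfolding visited_def by (intro image_subsetI) simp
  then show ?thesis using fin finite_surj by blast
qed

text \<open>Integer times and a countable set of vertices make the event measurable, and the absence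
  of a return becomes a decreasing limit of events that concern bounded time intervals.\<close>

lemma leaves_forever_iff:
  "leaves_forever x \<longleftrightarrow> (\<exists>n::nat. \<exists>v. v \<noteq> x 0 \<and> v \<in> visited x n) \<and> (\<forall>n::nat. \<not> returned x (x 0) n)"
proof
  assume "leaves_forever x"
  then obtain t where t: "t > 0" "\<And>s. s \<in> {0..<t} \<Longrightarrow> x s = x 0" "x t \<noteq> x 0"
    "\<And>s u. s > t \<Longrightarrow> s \<notin> jump_times x u (x 0)" unfolding leaves_forever_def by blast
  obtain n :: nat where "t \<le> n" using real_arch_simple by blast
  then have "x t \<in> visited x n" unfolding visited_def by (intro imageI) (use t(1) in auto)
  then have 1: "\<exists>n::nat. \<exists>v. v \<noteq> x 0 \<and> v \<in> visited x n" using t(3) by blast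
  have "\<not> returned x (x 0) n" for n :: nat
  proof
    assume "returned x (x 0) n"
    then obtain s1 s2 where s: "0 \<le> s1" "s1 < s2" "x s1 \<noteq> x 0" "x s2 = x 0" by (auto simp: returned_def)
    have "t \<le> s1"
    proof (rule ccontr)
      assume "\<not> t \<le> s1"
      then have "x s1 = x 0" using s(1) by (intro t(2)) simp
      with s(3) show False by contradiction
    qed
    then have "0 \<le> t" "t \<le> s2" "x t \<notin> {x 0}" "x s2 \<in> {x 0}" using t(1,3) s by auto
    then obtain r u where r: "t < r" "x r \<in> {x 0}" "u \<notin> {x 0}" "\<forall>\<^sub>F s in at_left r. x s = u"
      by (rule first_entrance) blast
    then have "r \<in> jump_times x u (x 0)" using t(1) by (simp add: jump_times_def)
    then show False using t(4) r(1) by blast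
  qed
  with 1 show "(\<exists>n::nat. \<exists>v. v \<noteq> x 0 \<and> v \<in> visited x n) \<and> (\<forall>n::nat. \<not> returned x (x 0) n)" by blast
next
  assume *: "(\<exists>n::nat. \<exists>v. v \<noteq> x 0 \<and> v \<in> visited x n) \<and> (\<forall>n::nat. \<not> returned x (x 0) n)"
  then obtain b where b: "0 \<le> b" "x b \<in> - {x 0}" by (auto simp: visited_def)
  have nr: "x s2 \<noteq> x 0" if s: "0 \<le> s1" "s1 < s2" "x s1 \<noteq> x 0" for s1 s2
  proof
    assume e: "x s2 = x 0"
    obtain n :: nat where "s2 \<le> n" using real_arch_simple by blast
    with s e have "returned x (x 0) n" unfolding returned_def by blast
    with * show False by blast
  qed
  have "x 0 \<notin> - {x 0}" by simp
  then obtain r u where r: "0 < r" "r \<le> b" "x r \<in> - {x 0}"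
    "u \<notin> - {x 0}" "\<forall>\<^sub>F s in at_left r. x s = u"
    using b(2) by (rule first_entrance[OF order_refl b(1)]) blast
  \<comment> \<open>The left limit at the first departure time \<open>r\<close> is
    \<open>x 0\<close>, so being elsewhere before \<open>r\<close> would already entail a
    return.\<close>
  have before: "x s = x 0" if s: "s \<in> {0..<r}" for s
  proof (rule ccontr)
    assume ne: "x s \<noteq> x 0"
    have "\<forall>\<^sub>F q in at_left r. q \<in> {s<..<r}"
      unfolding eventually_at_left_field using s by (intro exI[of _ s]) auto
    with r(5) have "\<forall>\<^sub>F q in at_left r. x q = u \<and> q \<in> {s<..<r}" by eventually_elim simp
    then obtain q where "x q = u" "q \<in> {s<..<r}"
      using eventually_happens'[OF trivial_limit_at_left_real] by blast
    then show False using nr[of s q] s ne r(4) by simp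
  qed
  have after: "s \<notin> jump_times x v (x 0)" if "s > r" for s v
    using nr[of r s] that r by (auto simp: jump_times_def)
  show "leaves_forever x"
    unfolding leaves_forever_def
    by (intro exI[of _ r] conjI ballI allI impI r(1) before after) (use r(3) in auto)
qed

end

section \<open>Random weights: measurability of the supermartingale\<close>

locale weighted_vrjp = vrjp M adj "[] :: nat list" X for M :: "'w measure" and adj X +
  fixes c :: "'w \<Rightarrow> nat list \<Rightarrow> real" and B :: nat and al :: "'w \<Rightarrow> real"
  assumes weights: "\<omega> \<in> space M \<Longrightarrow> weighted_tree (adj \<omega>) (c \<omega>) B (al \<omega>)"
    and c_measurable: "(\<lambda>\<omega>. c \<omega> u) \<in> borel_measurable (history M adj X 0)"
    and al_measurable: "al \<in> borel_measurable (history M adj X 0)"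
begin

abbreviation path_at :: "'w \<Rightarrow> real \<Rightarrow> nat list" where
  "path_at \<omega> \<equiv> (\<lambda>r. X r \<omega>)"

lemma tree: "\<omega> \<in> space M \<Longrightarrow> tree_path (adj \<omega>) (path_at \<omega>) (c \<omega>) B (al \<omega>)"
  using countable_path weights X_start
  by (simp add: tree_path_def tree_path_axioms_def)

definition Psi :: "nat list set \<Rightarrow> real \<Rightarrow> 'w \<Rightarrow> real" where
  "Psi W s \<omega> = tree_path.psi (adj \<omega>) (path_at \<omega>) (c \<omega>) B (al \<omega>) W s"

definition Jmp :: "nat list set \<Rightarrow> nat list \<Rightarrow> nat list \<Rightarrow> real \<Rightarrow> 'w \<Rightarrow> real" where
  "Jmp W u v s \<omega> = tree_path.jmp (adj \<omega>) (path_at \<omega>) (c \<omega>) B (al \<omega>) W u v s"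

definition Dr :: "nat list set \<Rightarrow> real \<Rightarrow> 'w \<Rightarrow> real" where
  "Dr W s \<omega> = tree_path.dr (adj \<omega>) (path_at \<omega>) (c \<omega>) B (al \<omega>) W s"

context
  fixes s :: real
  assumes s: "0 \<le> s"
begin

lemma c_history [measurable]: "(\<lambda>\<omega>. c \<omega> u) \<in> borel_measurable (history M adj X s)"
  by (rule measurable_history_mono[OF s c_measurable])

lemma al_history [measurable]: "al \<in> borel_measurable (history M adj X s)"
  by (rule measurable_history_mono[OF s al_measurable])

lemmas [measurable] = history_adj history_visited[OF s] history_returned[OF s] history_excess[OF s]
  history_X[OF s order_refl]

text \<open>The additional set \<open>S\<close> is empty for the current state and
  \<open>{v}\<close> for the state after a hypothetical jump to \<open>v\<close>, so that one chain
  of lemmas serves both.\<close>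

lemma esc_history [measurable]:
  "(\<lambda>\<omega>. weighted_tree.esc (adj \<omega>) (c \<omega>) B (S \<union> visited (path_at \<omega>) s) (excess (path_at \<omega>) s) u)
    \<in> borel_measurable (history M adj X s)"
proof -
  have "(\<lambda>\<omega>. (\<Sum>i<B. if adj \<omega> u (u @ [i]) \<and> u @ [i] \<notin> S \<and> \<not> u @ [i] \<in> visited (path_at \<omega>) s then 0.9 * c \<omega> (u @ [i]) else 0)
      * (exp (- (excess (path_at \<omega>) s u / 2)) / (2.5 + excess (path_at \<omega>) s (butlast u))))
    \<in> borel_measurable (history M adj X s)" by measurable
  moreover have "weighted_tree.esc (adj \<omega>) (c \<omega>) B (S \<union> visited (path_at \<omega>) s) (excess (path_at \<omega>) s) u
    = (\<Sum>i<B. if adj \<omega> u (u @ [i]) \<and> u @ [i] \<notin> S \<and> \<not> u @ [i] \<in> visited (path_at \<omega>) s then 0.9 * c \<omega> (u @ [i]) else 0)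
      * (exp (- (excess (path_at \<omega>) s u / 2)) / (2.5 + excess (path_at \<omega>) s (butlast u)))"
    if "\<omega> \<in> space M" for \<omega>
  proof -
    interpret weighted_tree "adj \<omega>" "c \<omega>" B "al \<omega>" using that by (rule weights)
    have "wt (S \<union> visited (path_at \<omega>) s) u
      = (\<Sum>i | i \<in> {..<B} \<and> (adj \<omega> u (u @ [i]) \<and> u @ [i] \<notin> S \<and> \<not> u @ [i] \<in> visited (path_at \<omega>) s). 0.9 * c \<omega> (u @ [i]))"
      unfolding wt_def by (rule sum.cong) auto
    also have "\<dots> = (\<Sum>i<B. if adj \<omega> u (u @ [i]) \<and> u @ [i] \<notin> S \<and> \<not> u @ [i] \<in> visited (path_at \<omega>) s then 0.9 * c \<omega> (u @ [i]) else 0)"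
      by (rule sum.inter_filter) simp
    finally show ?thesis unfolding esc_def by simp
  qed
  ultimately show ?thesis by (subst measurable_cong) auto
qed

lemma pth_history [measurable]:
  "(\<lambda>\<omega>. weighted_tree.pth (adj \<omega>) (c \<omega>) B (S \<union> visited (path_at \<omega>) s) (excess (path_at \<omega>) s) y)
    \<in> borel_measurable (history M adj X s)"
proof -
  have "(\<lambda>\<omega>. \<Prod>j = 1..length y. 1 - weighted_tree.esc (adj \<omega>) (c \<omega>) B (S \<union> visited (path_at \<omega>) s) (excess (path_at \<omega>) s) (take j y))
    \<in> borel_measurable (history M adj X s)" by measurable
  then show ?thesis by (subst measurable_cong) (auto simp: weighted_tree.pth_def[OF weights])
qed

lemma visited_subset_history [measurable]:
  "Measurable.pred (history M adj X s) (\<lambda>\<omega>. S \<union> visited (path_at \<omega>) s \<subseteq> W)"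
proof -
  have "Measurable.pred (history M adj X s) (\<lambda>\<omega>. \<forall>v. v \<in> visited (path_at \<omega>) s \<longrightarrow> v \<in> W)" by measurable
  moreover have "S \<union> visited (path_at \<omega>) s \<subseteq> W \<longleftrightarrow> S \<subseteq> W \<and> (\<forall>v. v \<in> visited (path_at \<omega>) s \<longrightarrow> v \<in> W)" for \<omega> by auto
  ultimately show ?thesis by simp
qed

lemma lyap_history:
  "(\<lambda>\<omega>. weighted_tree.lyap (adj \<omega>) (c \<omega>) B (al \<omega>) W (S \<union> visited (path_at \<omega>) s) (returned (path_at \<omega>) [] s \<or> b)
      (excess (path_at \<omega>) s) y) \<in> borel_measurable (history M adj X s)"
proof -
  have "(\<lambda>\<omega>. if \<not> (S \<union> visited (path_at \<omega>) s \<subseteq> W) then 0 else if returned (path_at \<omega>) [] s \<or> b then 1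
     else if y = [] then 1 - al \<omega> * exp (- (excess (path_at \<omega>) s [] / 2))
     else weighted_tree.pth (adj \<omega>) (c \<omega>) B (S \<union> visited (path_at \<omega>) s) (excess (path_at \<omega>) s) y)
    \<in> borel_measurable (history M adj X s)" (is "?f \<in> _") by measurable
  moreover have "weighted_tree.lyap (adj \<omega>) (c \<omega>) B (al \<omega>) W (S \<union> visited (path_at \<omega>) s) (returned (path_at \<omega>) [] s \<or> b)
      (excess (path_at \<omega>) s) y = ?f \<omega>" if "\<omega> \<in> space M" for \<omega>
    by (simp only: weighted_tree.lyap_def[OF weights[OF that]])
  ultimately show ?thesis by (subst measurable_cong) simp_all
qed

lemma drift_history:
  "(\<lambda>\<omega>. weighted_tree.drift (adj \<omega>) (c \<omega>) B (al \<omega>) W (S \<union> visited (path_at \<omega>) s) (returned (path_at \<omega>) [] s)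
      (excess (path_at \<omega>) s) y) \<in> borel_measurable (history M adj X s)"
proof -
  have "(\<lambda>\<omega>. if \<not> (S \<union> visited (path_at \<omega>) s \<subseteq> W) \<or> returned (path_at \<omega>) [] s then 0
     else if y = [] then al \<omega> * exp (- (excess (path_at \<omega>) s [] / 2)) / 2
     else weighted_tree.pth (adj \<omega>) (c \<omega>) B (S \<union> visited (path_at \<omega>) s) (excess (path_at \<omega>) s) (butlast y)
       * weighted_tree.esc (adj \<omega>) (c \<omega>) B (S \<union> visited (path_at \<omega>) s) (excess (path_at \<omega>) s) y / 2)
    \<in> borel_measurable (history M adj X s)" (is "?f \<in> _") by measurable
  moreover have "weighted_tree.drift (adj \<omega>) (c \<omega>) B (al \<omega>) W (S \<union> visited (path_at \<omega>) s) (returned (path_at \<omega>) [] s)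
      (excess (path_at \<omega>) s) y = ?f \<omega>" if "\<omega> \<in> space M" for \<omega>
    by (simp only: weighted_tree.drift_def[OF weights[OF that]])
  ultimately show ?thesis by (subst measurable_cong) simp_all
qed

lemma Psi_history [measurable]: "Psi W s \<in> borel_measurable (history M adj X s)"
proof -
  have "(\<lambda>\<omega>. weighted_tree.lyap (adj \<omega>) (c \<omega>) B (al \<omega>) W ({} \<union> visited (path_at \<omega>) s) (returned (path_at \<omega>) [] s \<or> False)
      (excess (path_at \<omega>) s) (X s \<omega>)) \<in> borel_measurable (history M adj X s)"
    by (rule measurable_compose_countable[OF lyap_history history_X[OF s order_refl]])
  then show ?thesis by (subst measurable_cong) (auto simp: Psi_def tree_path.psi_def[OF tree])
qed

lemma Dr_history [measurable]: "Dr W s \<in> borel_measurable (history M adj X s)"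
proof -
  have "(\<lambda>\<omega>. weighted_tree.drift (adj \<omega>) (c \<omega>) B (al \<omega>) W ({} \<union> visited (path_at \<omega>) s) (returned (path_at \<omega>) [] s)
      (excess (path_at \<omega>) s) (X s \<omega>)) \<in> borel_measurable (history M adj X s)"
    by (rule measurable_compose_countable[OF drift_history history_X[OF s order_refl]])
  then show ?thesis by (subst measurable_cong) (auto simp: Dr_def tree_path.dr_def[OF tree])
qed

lemma Jmp_history [measurable]: "Jmp W u v s \<in> borel_measurable (history M adj X s)"
proof -
  note [measurable] = history_X_eq[OF s order_refl]
    lyap_history[of W "{v}" "v = []" v, unfolded insert_is_Un[symmetric]]
  have "(\<lambda>\<omega>. if X s \<omega> = u \<and> adj \<omega> u v then
      weighted_tree.lyap (adj \<omega>) (c \<omega>) B (al \<omega>) W (insert v (visited (path_at \<omega>) s)) (returned (path_at \<omega>) [] s \<or> v = [])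
      (excess (path_at \<omega>) s) v - Psi W s \<omega> else 0) \<in> borel_measurable (history M adj X s)" (is "?f \<in> _") by measurable
  moreover have "Jmp W u v s \<omega> = ?f \<omega>" if "\<omega> \<in> space M" for \<omega>
    by (simp add: Jmp_def Psi_def tree_path.jmp_def[OF tree[OF that]])
  ultimately show ?thesis by (subst measurable_cong) auto
qed

end

lemma Psi_bounds: "\<omega> \<in> space M \<Longrightarrow> 0 \<le> Psi W s \<omega>" "\<omega> \<in> space M \<Longrightarrow> Psi W s \<omega> \<le> 1"
  unfolding Psi_def using tree_path.psi_bounds[OF tree] by auto

lemma Dr_bounds: "\<omega> \<in> space M \<Longrightarrow> 0 \<le> Dr W s \<omega>" "\<omega> \<in> space M \<Longrightarrow> Dr W s \<omega> \<le> 1"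
  unfolding Dr_def using tree_path.dr_bounds[OF tree] by auto

lemma Jmp_abs_le: "\<omega> \<in> space M \<Longrightarrow> \<bar>Jmp W u v s \<omega>\<bar> \<le> 1"
  unfolding Jmp_def using tree_path.jmp_abs_le[OF tree] by auto

lemma integrable_Psi: "0 \<le> s \<Longrightarrow> integrable M (Psi W s)"
  by (rule integrable_const_bound[of _ 1])
    (use Psi_bounds measurable_from_history[OF Psi_history] in \<open>auto intro!: AE_I2\<close>)

lemma integrable_Dr: "0 \<le> s \<Longrightarrow> integrable M (Dr W s)"
  by (rule integrable_const_bound[of _ 1])
    (use Dr_bounds measurable_from_history[OF Dr_history] in \<open>auto intro!: AE_I2\<close>)

end

section \<open>Integrated intensities against bounded integrands\<close>

context vrjp
begin

lemma compensator_finite: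
  assumes "\<omega> \<in> space M" "0 \<le> s" "s \<le> t"
  shows "compensator (adj \<omega>) (\<lambda>r. X r \<omega>) u v s t
      = ennreal (enn2real (compensator (adj \<omega>) (\<lambda>r. X r \<omega>) u v s t))"
    "enn2real (compensator (adj \<omega>) (\<lambda>r. X r \<omega>) u v s t) \<le> (1 + t) * (t - s)"
proof -
  interpret countable_jump_path "adj \<omega>" "\<lambda>r. X r \<omega>" by (rule countable_path[OF assms(1)])
  have le: "compensator (adj \<omega>) (\<lambda>r. X r \<omega>) u v s t \<le> ennreal ((1 + t) * (t - s))"
    using compensator_le[OF assms(2,3)] .
  then have "compensator (adj \<omega>) (\<lambda>r. X r \<omega>) u v s t < top"
    using ennreal_less_top le_less_trans by blast
  then show "compensator (adj \<omega>) (\<lambda>r. X r \<omega>) u v s t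
      = ennreal (enn2real (compensator (adj \<omega>) (\<lambda>r. X r \<omega>) u v s t))" by simp
  show "enn2real (compensator (adj \<omega>) (\<lambda>r. X r \<omega>) u v s t) \<le> (1 + t) * (t - s)"
    by (rule enn2real_leI[OF _ le]) (use assms in auto)
qed

lemma integrable_compensator:
  assumes "0 \<le> s" "s \<le> t"
  shows "integrable M (\<lambda>\<omega>. enn2real (compensator (adj \<omega>) (\<lambda>r. X r \<omega>) u v s t))"
  by (rule integrable_const_bound[of _ "(1 + t) * (t - s)"])
    (use compensator_finite(2)[OF _ assms] measurable_compensator[OF assms(1)] in \<open>auto intro!: AE_I2\<close>)

text \<open>The compensator over a bounded interval is bounded, so the equality of nonnegative
  integrals also shows that the number of jumps between two given vertices is integrable.\<close>

lemma intensity_nonneg: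
  assumes "0 \<le> s" "s \<le> t" and g: "g \<in> borel_measurable (history M adj X s)"
    and g0: "\<And>\<omega>. \<omega> \<in> space M \<Longrightarrow> 0 \<le> g \<omega>" and gC: "\<And>\<omega>. \<omega> \<in> space M \<Longrightarrow> g \<omega> \<le> C"
  shows "integrable M (\<lambda>\<omega>. g \<omega> * real (card (jump_times (\<lambda>r. X r \<omega>) u v \<inter> {s<..t})))"
    "(\<integral>\<omega>. g \<omega> * real (card (jump_times (\<lambda>r. X r \<omega>) u v \<inter> {s<..t})) \<partial>M)
      = (\<integral>\<omega>. g \<omega> * enn2real (compensator (adj \<omega>) (\<lambda>r. X r \<omega>) u v s t) \<partial>M)"
proof -
  let ?J = "\<lambda>\<omega>. real (card (jump_times (\<lambda>r. X r \<omega>) u v \<inter> {s<..t}))"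
  let ?C = "\<lambda>\<omega>. compensator (adj \<omega>) (\<lambda>r. X r \<omega>) u v s t"
  have gM: "g \<in> borel_measurable M" by (rule measurable_from_history[OF g])
  note meas = gM measurable_jump_count[OF assms(1,2)] measurable_compensator[OF assms(1)]
  have intC: "integrable M (\<lambda>\<omega>. g \<omega> * enn2real (?C \<omega>))"
  proof (rule Bochner_Integration.integrable_bound[OF integrable_mult_right[OF integrable_compensator[OF assms(1,2)], of C]])
    show "AE \<omega> in M. norm (g \<omega> * enn2real (?C \<omega>)) \<le> norm (C * enn2real (?C \<omega>))"
      using g0 gC by (intro AE_I2) (auto simp: abs_mult intro!: mult_right_mono intro: order_trans[OF gC abs_ge_self])
  qed (use meas in measurable)
  have eq: "(\<integral>\<^sup>+ \<omega>. ennreal (g \<omega> * ?J \<omega>) \<partial>M) = (\<integral>\<^sup>+ \<omega>. ennreal (g \<omega> * enn2real (?C \<omega>)) \<partial>M)"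
  proof -
    have "(\<integral>\<^sup>+ \<omega>. ennreal (g \<omega> * ?J \<omega>) \<partial>M) = (\<integral>\<^sup>+ \<omega>. ennreal (g \<omega>) * ennreal (?J \<omega>) \<partial>M)"
      by (rule nn_integral_cong) (simp add: ennreal_mult g0)
    also have "\<dots> = (\<integral>\<^sup>+ \<omega>. ennreal (g \<omega>) * ?C \<omega> \<partial>M)"
      by (rule nn_intensity[OF assms(1,2)]) (use g in measurable)
    also have "\<dots> = (\<integral>\<^sup>+ \<omega>. ennreal (g \<omega> * enn2real (?C \<omega>)) \<partial>M)"
      by (rule nn_integral_cong) (simp add: ennreal_mult g0 flip: compensator_finite(1)[OF _ assms(1,2)])
    finally show ?thesis .
  qed
  show intJ: "integrable M (\<lambda>\<omega>. g \<omega> * ?J \<omega>)"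
  proof (rule integrableI_nonneg)
    show "AE \<omega> in M. 0 \<le> g \<omega> * ?J \<omega>" using g0 by (intro AE_I2) simp
    show "(\<integral>\<^sup>+ \<omega>. ennreal (g \<omega> * ?J \<omega>) \<partial>M) < \<infinity>"
      unfolding eq using intC g0 by (subst nn_integral_eq_integral) (auto intro!: AE_I2)
  qed (use meas in measurable)
  show "(\<integral>\<omega>. g \<omega> * ?J \<omega> \<partial>M) = (\<integral>\<omega>. g \<omega> * enn2real (?C \<omega>) \<partial>M)"
    using eq g0 by (subst (1 2) integral_eq_nn_integral) (use meas in \<open>auto intro!: AE_I2\<close>)
qed

lemma integrable_jump_count:
  assumes "0 \<le> s" "s \<le> t"
  shows "integrable M (\<lambda>\<omega>. real (card (jump_times (\<lambda>r. X r \<omega>) u v \<inter> {s<..t})))"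
  using intensity_nonneg(1)[OF assms, of "\<lambda>_. 1" 1 u v] by simp

lemma intensity:
  assumes "0 \<le> s" "s \<le> t" and g: "g \<in> borel_measurable (history M adj X s)"
    and g1: "\<And>\<omega>. \<omega> \<in> space M \<Longrightarrow> \<bar>g \<omega>\<bar> \<le> 1"
  shows "integrable M (\<lambda>\<omega>. g \<omega> * real (card (jump_times (\<lambda>r. X r \<omega>) u v \<inter> {s<..t})))"
    "integrable M (\<lambda>\<omega>. g \<omega> * enn2real (compensator (adj \<omega>) (\<lambda>r. X r \<omega>) u v s t))"
    "(\<integral>\<omega>. g \<omega> * real (card (jump_times (\<lambda>r. X r \<omega>) u v \<inter> {s<..t})) \<partial>M)
      = (\<integral>\<omega>. g \<omega> * enn2real (compensator (adj \<omega>) (\<lambda>r. X r \<omega>) u v s t) \<partial>M)"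
proof -
  let ?J = "\<lambda>\<omega>. real (card (jump_times (\<lambda>r. X r \<omega>) u v \<inter> {s<..t}))"
  let ?C = "\<lambda>\<omega>. enn2real (compensator (adj \<omega>) (\<lambda>r. X r \<omega>) u v s t)"
  have gM: "g \<in> borel_measurable M" by (rule measurable_from_history[OF g])
  note meas = gM measurable_jump_count[OF assms(1,2)] measurable_compensator[OF assms(1)]
  have J: "integrable M ?J" by (rule integrable_jump_count[OF assms(1,2)])
  have C: "integrable M ?C" by (rule integrable_compensator[OF assms(1,2)])
  show gJ: "integrable M (\<lambda>\<omega>. g \<omega> * ?J \<omega>)"
    by (rule Bochner_Integration.integrable_bound[OF J])
      (use meas g1 in \<open>auto intro!: AE_I2 simp: abs_mult mult_left_le_one_le\<close>)
  show gC: "integrable M (\<lambda>\<omega>. g \<omega> * ?C \<omega>)"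
    by (rule Bochner_Integration.integrable_bound[OF C])
      (use meas g1 in \<open>auto intro!: AE_I2 simp: abs_mult mult_left_le_one_le\<close>)
  \<comment> \<open>The signed \<open>g\<close> is the difference of the nonnegative functions
    \<open>g + 1\<close> and 1, and all integrals are finite.\<close>
  have "(\<integral>\<omega>. (g \<omega> + 1) * ?J \<omega> \<partial>M) = (\<integral>\<omega>. (g \<omega> + 1) * ?C \<omega> \<partial>M)"
    by (rule intensity_nonneg(2)[OF assms(1,2), where C=2]) (use g g1 in \<open>force simp: abs_le_iff\<close>)+
  moreover have "(\<integral>\<omega>. 1 * ?J \<omega> \<partial>M) = (\<integral>\<omega>. 1 * ?C \<omega> \<partial>M)"
    by (rule intensity_nonneg(2)[OF assms(1,2), where C=1]) auto
  moreover have "(\<integral>\<omega>. (g \<omega> + 1) * ?J \<omega> \<partial>M) = (\<integral>\<omega>. g \<omega> * ?J \<omega> \<partial>M) + (\<integral>\<omega>. ?J \<omega> \<partial>M)"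
    using gJ J by (simp add: distrib_right)
  moreover have "(\<integral>\<omega>. (g \<omega> + 1) * ?C \<omega> \<partial>M) = (\<integral>\<omega>. g \<omega> * ?C \<omega> \<partial>M) + (\<integral>\<omega>. ?C \<omega> \<partial>M)"
    using gC C by (simp add: distrib_right)
  ultimately show "(\<integral>\<omega>. g \<omega> * ?J \<omega> \<partial>M) = (\<integral>\<omega>. g \<omega> * ?C \<omega> \<partial>M)" by simp
qed

end

section \<open>The supermartingale\<close>

lemma exp_half_tendsto: "(\<lambda>n. exp (- real n / 2)) \<longlonglongrightarrow> 0"
proof -
  have "(\<lambda>n. exp (- 1 / 2 :: real) ^ n) \<longlonglongrightarrow> 0" by (rule LIMSEQ_power_zero) simp
  then show ?thesis by (simp flip: exp_of_nat_mult)
qed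

context weighted_vrjp
begin

abbreviation tgt :: "nat \<Rightarrow> nat list \<Rightarrow> nat list set" where
  "tgt K u \<equiv> insert (butlast u) ((\<lambda>i. u @ [i]) ` {..<K})"

abbreviation jumps :: "nat list \<Rightarrow> nat list \<Rightarrow> real \<Rightarrow> real \<Rightarrow> 'w \<Rightarrow> real" where
  "jumps u v s t \<omega> \<equiv> real (card (jump_times (path_at \<omega>) u v \<inter> {s<..t}))"

abbreviation rate :: "nat list \<Rightarrow> nat list \<Rightarrow> real \<Rightarrow> real \<Rightarrow> 'w \<Rightarrow> real" where
  "rate u v s t \<omega> \<equiv> enn2real (compensator (adj \<omega>) (path_at \<omega>) u v s t)"

definition jump_part :: "nat \<Rightarrow> real \<Rightarrow> nat \<Rightarrow> 'w \<Rightarrow> real" where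
  "jump_part K t n \<omega> = (\<Sum>i<n. (\<Sum>u\<in>words K. \<Sum>v\<in>tgt K u. Jmp (words K) u v (grid 0 t n i) \<omega>
      * jumps u v (grid 0 t n i) (grid 0 t n (Suc i)) \<omega>) + Dr (words K) (grid 0 t n i) \<omega> * (t / n))"

definition rate_part :: "nat \<Rightarrow> real \<Rightarrow> nat \<Rightarrow> 'w \<Rightarrow> real" where
  "rate_part K t n \<omega> = (\<Sum>i<n. (\<Sum>u\<in>words K. \<Sum>v\<in>tgt K u. Jmp (words K) u v (grid 0 t n i) \<omega>
      * rate u v (grid 0 t n i) (grid 0 t n (Suc i)) \<omega>) + Dr (words K) (grid 0 t n i) \<omega> * (t / n))"

lemma jump_part_eq: "\<omega> \<in> space M \<Longrightarrow> jump_part K t n \<omega> = tree_path.psi_sum (adj \<omega>) (path_at \<omega>) (c \<omega>) B (al \<omega>) K t n"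
  by (simp add: jump_part_def tree_path.psi_sum_def[OF tree] weighted_tree.targets_def[OF weights] Jmp_def Dr_def)

lemma rate_part_eq: "\<omega> \<in> space M \<Longrightarrow> rate_part K t n \<omega> = tree_path.comp_sum (adj \<omega>) (path_at \<omega>) (c \<omega>) B (al \<omega>) K t n"
  by (simp add: rate_part_def tree_path.comp_sum_def[OF tree] weighted_tree.targets_def[OF weights] Jmp_def Dr_def)

text \<open>Cell by cell, the coefficient is measurable at the left endpoint, so under the
  expectation the number of jumps may be exchanged for the compensator.\<close>

lemma integral_jump_part:
  assumes "0 \<le> t"
  shows "integrable M (jump_part K t n)" "integrable M (rate_part K t n)"
    "expectation (jump_part K t n) = expectation (rate_part K t n)"
proof -
  have grid: "0 \<le> grid 0 t n i" "grid 0 t n i \<le> grid 0 t n (Suc i)" for i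
    using grid_ge[OF assms, of n i] monoD[OF mono_grid[OF assms], of i "Suc i" n] by auto
  note int = intensity[OF grid Jmp_history[OF grid(1)] Jmp_abs_le]
  show "integrable M (jump_part K t n)" "integrable M (rate_part K t n)"
    unfolding jump_part_def rate_part_def
    by (intro Bochner_Integration.integrable_sum Bochner_Integration.integrable_add integrable_mult_left
        integrable_Dr grid int; assumption)+
  have J: "integrable M (\<lambda>\<omega>. \<Sum>u\<in>words K. \<Sum>v\<in>tgt K u. Jmp (words K) u v (grid 0 t n i) \<omega>
      * jumps u v (grid 0 t n i) (grid 0 t n (Suc i)) \<omega>)" for i
    by (intro Bochner_Integration.integrable_sum int; assumption)
  have R: "integrable M (\<lambda>\<omega>. \<Sum>u\<in>words K. \<Sum>v\<in>tgt K u. Jmp (words K) u v (grid 0 t n i) \<omega>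
      * rate u v (grid 0 t n i) (grid 0 t n (Suc i)) \<omega>)" for i
    by (intro Bochner_Integration.integrable_sum int; assumption)
  have D: "integrable M (\<lambda>\<omega>. Dr (words K) (grid 0 t n i) \<omega> * (t / n))" for i
    by (intro integrable_mult_left integrable_Dr grid)
  have JR: "expectation (\<lambda>\<omega>. \<Sum>u\<in>words K. \<Sum>v\<in>tgt K u. Jmp (words K) u v (grid 0 t n i) \<omega>
      * jumps u v (grid 0 t n i) (grid 0 t n (Suc i)) \<omega>)
    = expectation (\<lambda>\<omega>. \<Sum>u\<in>words K. \<Sum>v\<in>tgt K u. Jmp (words K) u v (grid 0 t n i) \<omega>
      * rate u v (grid 0 t n i) (grid 0 t n (Suc i)) \<omega>)" for i
  proof -
    have "expectation (\<lambda>\<omega>. \<Sum>u\<in>words K. \<Sum>v\<in>tgt K u. Jmp (words K) u v (grid 0 t n i) \<omega>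
        * jumps u v (grid 0 t n i) (grid 0 t n (Suc i)) \<omega>)
      = (\<Sum>u\<in>words K. \<Sum>v\<in>tgt K u. expectation (\<lambda>\<omega>. Jmp (words K) u v (grid 0 t n i) \<omega>
        * jumps u v (grid 0 t n i) (grid 0 t n (Suc i)) \<omega>))"
      by (subst Bochner_Integration.integral_sum, (intro Bochner_Integration.integrable_sum int; assumption))
        (intro sum.cong refl Bochner_Integration.integral_sum int; assumption)
    also have "\<dots> = (\<Sum>u\<in>words K. \<Sum>v\<in>tgt K u. expectation (\<lambda>\<omega>. Jmp (words K) u v (grid 0 t n i) \<omega>
        * rate u v (grid 0 t n i) (grid 0 t n (Suc i)) \<omega>))"
      by (intro sum.cong refl int(3); assumption)
    also have "\<dots> = expectation (\<lambda>\<omega>. \<Sum>u\<in>words K. \<Sum>v\<in>tgt K u. Jmp (words K) u v (grid 0 t n i) \<omega>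
        * rate u v (grid 0 t n i) (grid 0 t n (Suc i)) \<omega>)"
      by (subst Bochner_Integration.integral_sum, (intro Bochner_Integration.integrable_sum int; assumption))
        (intro sum.cong refl Bochner_Integration.integral_sum[symmetric] int; assumption)
    finally show ?thesis .
  qed
  have "expectation (jump_part K t n) = (\<Sum>i<n. expectation (\<lambda>\<omega>. \<Sum>u\<in>words K. \<Sum>v\<in>tgt K u. Jmp (words K) u v (grid 0 t n i) \<omega>
      * jumps u v (grid 0 t n i) (grid 0 t n (Suc i)) \<omega>) + expectation (\<lambda>\<omega>. Dr (words K) (grid 0 t n i) \<omega> * (t / n)))"
    unfolding jump_part_def
    by (simp only: Bochner_Integration.integral_sum[OF Bochner_Integration.integrable_add[OF J D]]
        Bochner_Integration.integral_add[OF J D])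
  also have "\<dots> = expectation (rate_part K t n)"
    unfolding rate_part_def JR
    by (simp only: Bochner_Integration.integral_sum[OF Bochner_Integration.integrable_add[OF R D]]
        Bochner_Integration.integral_add[OF R D])
  finally show "expectation (jump_part K t n) = expectation (rate_part K t n)" .
qed

text \<open>As \<open>jump_part\<close> and \<open>rate_part\<close> have the same expectation, the
  increment of the expectation is, for every grid, at most the sum of the expected positive parts of
  the two discretisation errors. Both tend to 0 by dominated convergence; positive parts suffice
  because all estimates are one-sided.\<close>

lemma Psi_supermartingale:
  assumes t: "0 \<le> t" and K: "B \<le> K"
  shows "expectation (Psi (words K) t) \<le> expectation (Psi (words K) 0)"
proof -
  let ?W = "words K"
  \<comment> \<open>Grids with \<open>Suc n\<close> cells avoid the degenerate empty grid.\<close>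
  let ?R = "\<lambda>n \<omega>. max 0 (Psi ?W t \<omega> - Psi ?W 0 \<omega> - jump_part K t (Suc n) \<omega>)"
  let ?Q = "\<lambda>n \<omega>. max 0 (rate_part K t (Suc n) \<omega>)"
  let ?J = "\<lambda>\<omega>. (\<Sum>u\<in>?W. \<Sum>v\<in>tgt K u. jumps u v 0 t \<omega>)"
  let ?M = "((1 + t) * (\<Sum>u\<in>?W. real (card (tgt K u))) + 1) * t"
  have over_n: "(\<lambda>n. C / real (Suc n)) \<longlonglongrightarrow> 0" for C :: real
    using LIMSEQ_ignore_initial_segment[OF lim_const_over_n[of C], of 1] by simp
  note P = integrable_Psi[OF t, of ?W] integrable_Psi[OF order_refl, of ?W]
  note S = integral_jump_part[OF t, of K]
  have intJ: "integrable M ?J"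
    by (intro Bochner_Integration.integrable_sum integrable_jump_count t order_refl)
  have R: "(\<lambda>n. expectation (?R n)) \<longlonglongrightarrow> expectation (\<lambda>_. 0)"
  proof (rule integral_dominated_convergence)
    show "integrable M (\<lambda>\<omega>. 1 + ?J \<omega> + t)" using intJ by simp
    show "AE \<omega> in M. (\<lambda>n. ?R n \<omega>) \<longlonglongrightarrow> 0"
    proof (rule AE_I2)
      fix \<omega> assume \<omega>: "\<omega> \<in> space M"
      interpret tree_path "adj \<omega>" "path_at \<omega>" "c \<omega>" B "al \<omega>" by (rule tree[OF \<omega>])
      obtain C where "\<forall>\<^sub>F n in sequentially. psi ?W t - psi ?W 0 - psi_sum K t n \<le> C / n"
        using psi_error[OF t] by blast
      then have "\<forall>\<^sub>F n in sequentially. psi ?W t - psi ?W 0 - psi_sum K t (Suc n) \<le> C / real (Suc n)"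
        by (subst eventually_sequentially_Suc)
      then have ev: "\<forall>\<^sub>F n in sequentially. ?R n \<omega> \<le> max 0 (C / real (Suc n))"
        by eventually_elim (auto simp: jump_part_eq[OF \<omega>] Psi_def)
      have "(\<lambda>n. max 0 (C / real (Suc n))) \<longlonglongrightarrow> max 0 0" by (intro tendsto_max tendsto_const over_n)
      then show "(\<lambda>n. ?R n \<omega>) \<longlonglongrightarrow> 0"
        by (intro tendsto_sandwich[OF _ ev tendsto_const]) auto
    qed
    show "AE \<omega> in M. norm (?R n \<omega>) \<le> 1 + ?J \<omega> + t" for n
    proof (rule AE_I2)
      fix \<omega> assume \<omega>: "\<omega> \<in> space M"
      interpret tree_path "adj \<omega>" "path_at \<omega>" "c \<omega>" B "al \<omega>" by (rule tree[OF \<omega>])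
      have "\<bar>jump_part K t (Suc n) \<omega>\<bar> \<le> ?J \<omega> + t"
        using psi_sum_abs_le[OF t, of "Suc n" K] unfolding jump_part_eq[OF \<omega>] targets_def by simp
      moreover have "0 \<le> ?J \<omega>" by (intro sum_nonneg) auto
      ultimately show "norm (?R n \<omega>) \<le> 1 + ?J \<omega> + t"
        using Psi_bounds[OF \<omega>, of ?W t] Psi_bounds[OF \<omega>, of ?W 0] t by auto
    qed
    show "?R n \<in> borel_measurable M" for n
      by (intro borel_measurable_max borel_measurable_diff borel_measurable_const borel_measurable_integrable P S)
  qed auto
  have Q: "(\<lambda>n. expectation (?Q n)) \<longlonglongrightarrow> expectation (\<lambda>_. 0)"
  proof (rule integral_dominated_convergence)
    show "integrable M (\<lambda>\<omega>. ?M)" by simp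
    show "AE \<omega> in M. (\<lambda>n. ?Q n \<omega>) \<longlonglongrightarrow> 0"
    proof (rule AE_I2)
      fix \<omega> assume \<omega>: "\<omega> \<in> space M"
      interpret tree_path "adj \<omega>" "path_at \<omega>" "c \<omega>" B "al \<omega>" by (rule tree[OF \<omega>])
      let ?C = "?M * card (path_jumps (path_at \<omega>) \<inter> {0<..t})"
      have le: "?Q n \<omega> \<le> max 0 (?C / real (Suc n))" for n
        using comp_sum_le(1)[OF t _ K, of "Suc n"] unfolding rate_part_eq[OF \<omega>] targets_def by auto
      have "(\<lambda>n. max 0 (?C / real (Suc n))) \<longlonglongrightarrow> max 0 0" by (intro tendsto_max tendsto_const over_n)
      then have lim: "(\<lambda>n. max 0 (?C / real (Suc n))) \<longlonglongrightarrow> 0" unfolding max.idem .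
      show "(\<lambda>n. ?Q n \<omega>) \<longlonglongrightarrow> 0"
        by (rule tendsto_sandwich[OF always_eventually always_eventually tendsto_const lim])
          (use le in \<open>auto simp del: of_nat_Suc\<close>)
    qed
    show "AE \<omega> in M. norm (?Q n \<omega>) \<le> ?M" for n
    proof (rule AE_I2)
      fix \<omega> assume \<omega>: "\<omega> \<in> space M"
      interpret tree_path "adj \<omega>" "path_at \<omega>" "c \<omega>" B "al \<omega>" by (rule tree[OF \<omega>])
      have "rate_part K t (Suc n) \<omega> \<le> ?M"
        using comp_sum_le(2)[OF t _ K, of "Suc n"] unfolding rate_part_eq[OF \<omega>] targets_def by simp
      moreover have "0 \<le> ?M"
        using t by (auto intro!: mult_nonneg_nonneg add_nonneg_nonneg sum_nonneg)
      ultimately show "norm (?Q n \<omega>) \<le> ?M" by auto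
    qed
    show "?Q n \<in> borel_measurable M" for n
      by (intro borel_measurable_max borel_measurable_const borel_measurable_integrable S)
  qed auto
  have le: "expectation (Psi ?W t) - expectation (Psi ?W 0) \<le> expectation (?R n) + expectation (?Q n)" for n
  proof -
    have "expectation (Psi ?W t) - expectation (Psi ?W 0) - expectation (jump_part K t (Suc n))
        = expectation (\<lambda>\<omega>. Psi ?W t \<omega> - Psi ?W 0 \<omega> - jump_part K t (Suc n) \<omega>)"
      using P S(1) by simp
    also have "\<dots> \<le> expectation (?R n)"
      using P S(1) by (intro integral_mono Bochner_Integration.integrable_diff integrable_max integrable_const) auto
    finally have 1: "expectation (Psi ?W t) - expectation (Psi ?W 0) - expectation (jump_part K t (Suc n))
        \<le> expectation (?R n)" .
    have "expectation (rate_part K t (Suc n)) \<le> expectation (?Q n)"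
      using S(2) by (intro integral_mono integrable_max integrable_const) auto
    then show ?thesis using 1 S(3)[of "Suc n"] by simp
  qed
  have "(\<lambda>n. expectation (?R n) + expectation (?Q n)) \<longlonglongrightarrow> 0 + 0"
    using tendsto_add[OF R Q] by simp
  then have "expectation (Psi ?W t) - expectation (Psi ?W 0) \<le> 0 + 0"
    by (rule LIMSEQ_le_const) (use le in blast)
  then show ?thesis by simp
qed

section \<open>From the supermartingale to transience\<close>

lemma Psi_0:
  assumes "\<omega> \<in> space M"
  shows "Psi (words K) 0 \<omega> = 1 - al \<omega>"
proof -
  interpret tree_path "adj \<omega>" "path_at \<omega>" "c \<omega>" B "al \<omega>" by (rule tree[OF assms])
  have "visited (path_at \<omega>) 0 = {[]}" using X_start[OF assms] by (simp add: visited_def)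
  moreover have "\<not> returned (path_at \<omega>) [] 0" by (auto simp: returned_def)
  ultimately show ?thesis
    using excess_0[of "[]"] X_start[OF assms] by (simp add: Psi_def psi_def lyap_def words_def)
qed

definition away :: "nat \<Rightarrow> 'w set" where
  "away n = {\<omega> \<in> space M. \<not> returned (path_at \<omega>) [] n \<and> (\<exists>v. v \<noteq> [] \<and> v \<in> visited (path_at \<omega>) n)}"

text \<open>The left side is at most 1 and vanishes after a return without killing. Otherwise the
  process is away from the root, or has been killed, or has waited at the root up to time
  \<open>n\<close>; in the last case the value is \<open>al\<close> times
  \<open>exp (- n / 2)\<close>.\<close>

lemma one_minus_Psi_le:
  assumes \<omega>: "\<omega> \<in> space M"
  shows "1 - Psi (words K) (real n) \<omega> \<le> indicator (away n) \<omega> + exp (- real n / 2)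
    + indicator {\<omega> \<in> space M. \<not> visited (path_at \<omega>) n \<subseteq> words K} \<omega>"
proof -
  interpret tree_path "adj \<omega>" "path_at \<omega>" "c \<omega>" B "al \<omega>" by (rule tree[OF \<omega>])
  have P: "0 \<le> Psi (words K) (real n) \<omega>" by (rule Psi_bounds[OF \<omega>])
  have e: "0 < exp (- real n / 2)" by simp
  consider "\<not> visited (path_at \<omega>) n \<subseteq> words K" | "\<omega> \<in> away n"
    | "visited (path_at \<omega>) n \<subseteq> words K" "returned (path_at \<omega>) [] n"
    | "visited (path_at \<omega>) n \<subseteq> words K" "\<not> returned (path_at \<omega>) [] n" "visited (path_at \<omega>) n \<subseteq> {[]}"
    using \<omega> by (auto simp: away_def)
  then show ?thesis
  proof cases
    case 1
    then have "indicator {\<omega> \<in> space M. \<not> visited (path_at \<omega>) n \<subseteq> words K} \<omega> = (1 :: real)"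
      using \<omega> by simp
    moreover have "0 \<le> (indicator (away n) \<omega> :: real)" by simp
    ultimately show ?thesis using P e by linarith
  next
    case 2
    then have "indicator (away n) \<omega> = (1 :: real)" by simp
    moreover have "0 \<le> (indicator {\<omega> \<in> space M. \<not> visited (path_at \<omega>) n \<subseteq> words K} \<omega> :: real)" by simp
    ultimately show ?thesis using P e by linarith
  next
    case 3
    then have "Psi (words K) (real n) \<omega> = 1" by (simp add: Psi_def psi_def lyap_def)
    then show ?thesis using e by (simp add: indicator_def)
  next
    case 4
    have root: "path_at \<omega> s = []" if "s \<in> {0..real n}" for s
      using 4(3) that unfolding visited_def by blast
    have "excess (path_at \<omega>) n [] = n"
      using excess_const[of 0 "real n" "[]" "[]", OF _ _ root] excess_0 by simp
    moreover have "path_at \<omega> n = []" by (rule root) simp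
    ultimately have "1 - Psi (words K) (real n) \<omega> = al \<omega> * exp (- real n / 2)"
      using 4 by (simp add: Psi_def psi_def lyap_def)
    also have "\<dots> \<le> 1 * exp (- real n / 2)" using al_le_1 by (intro mult_right_mono) auto
    finally show ?thesis by (simp add: indicator_def)
  qed
qed

lemma away_sets: "away n \<in> sets M"
proof -
  note [measurable] = measurable_from_history[OF history_returned[of "real n"]]
    measurable_from_history[OF history_visited[of "real n"]]
  show ?thesis unfolding away_def by measurable
qed

lemma integrable_al: "integrable M al"
proof (rule integrable_const_bound[of _ 1])
  show "AE \<omega> in M. norm (al \<omega>) \<le> 1"
    using weighted_tree.al_le_1[OF weights] weighted_tree.al_nonneg[OF weights] by (intro AE_I2) auto
qed (rule measurable_from_history[OF al_measurable])

text \<open>The expectation of \<open>1 - Psi\<close> starts at that of \<open>al\<close> and does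
  not decrease. With \<open>n\<close> fixed, letting \<open>K\<close> tend to infinity removes the
  killing, since a path visits finitely many vertices up to time \<open>n\<close> and these lie in a
  common \<open>words K\<close>.\<close>

lemma prob_away_ge: "expectation al - exp (- real n / 2) \<le> prob (away n)"
proof -
  let ?E = "\<lambda>K. {\<omega> \<in> space M. \<not> visited (path_at \<omega>) n \<subseteq> words K}"
  have E: "?E K \<in> sets M" for K
  proof -
    have "Measurable.pred M (\<lambda>\<omega>. {} \<union> visited (path_at \<omega>) (real n) \<subseteq> words K)"
      by (rule measurable_from_history[OF visited_subset_history]) simp
    then have [measurable]: "Measurable.pred M (\<lambda>\<omega>. visited (path_at \<omega>) (real n) \<subseteq> words K)" by simp
    show ?thesis by measurable
  qed
  have ind: "integrable M (indicator A :: 'w \<Rightarrow> real)" if "A \<in> sets M" for A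
    by (rule integrable_real_indicator[OF that]) (simp add: less_top[symmetric])
  have le: "expectation al - exp (- real n / 2) - prob (away n) \<le> prob (?E K)" if K: "B \<le> K" for K
  proof -
    have "expectation al = 1 - expectation (Psi (words K) 0)"
    proof -
      have "expectation (Psi (words K) 0) = expectation (\<lambda>\<omega>. 1 - al \<omega>)"
        by (rule Bochner_Integration.integral_cong[OF refl Psi_0])
      also have "\<dots> = 1 - expectation al" using integrable_al by (simp add: prob_space)
      finally show ?thesis by simp
    qed
    also have "\<dots> \<le> 1 - expectation (Psi (words K) n)" using Psi_supermartingale[OF _ K, of n] by simp
    also have "\<dots> = expectation (\<lambda>\<omega>. 1 - Psi (words K) n \<omega>)"
      using integrable_Psi[of n "words K"] by (simp add: prob_space)
    also have "\<dots> \<le> expectation (\<lambda>\<omega>. indicator (away n) \<omega> + exp (- real n / 2) + indicator (?E K) \<omega>)"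
    proof (rule integral_mono)
      show "integrable M (\<lambda>\<omega>. indicator (away n) \<omega> + exp (- real n / 2) + indicator (?E K) \<omega>)"
        using ind[OF away_sets] ind[OF E] by (intro Bochner_Integration.integrable_add integrable_const)
      show "integrable M (\<lambda>\<omega>. 1 - Psi (words K) n \<omega>)"
        using integrable_Psi[of n "words K"] by simp
    qed (rule one_minus_Psi_le)
    also have "\<dots> = prob (away n) + exp (- real n / 2) + prob (?E K)"
    proof -
      have "expectation (indicator (away n)) = prob (away n)" "expectation (indicator (?E K)) = prob (?E K)"
        using sets.sets_into_space[OF away_sets] by (simp_all add: Int_absorb2 Int_absorb1 Collect_restrict)
      then show ?thesis
        using ind[OF away_sets] ind[OF E] by (subst Bochner_Integration.integral_add, simp, simp, subst Bochner_Integration.integral_add)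
          (simp_all add: prob_space)
    qed
    finally show ?thesis by simp
  qed
  have "(\<lambda>K. prob (?E K)) \<longlonglongrightarrow> prob (\<Inter>K. ?E K)"
  proof (rule finite_Lim_measure_decseq)
    have "words K \<subseteq> words K'" if "K \<le> K'" for K K' using that by (auto simp: words_def)
    then show "decseq ?E" unfolding decseq_def by blast
  qed (use E in auto)
  also have "(\<Inter>K. ?E K) = {}"
  proof -
    have "\<exists>K. visited (path_at \<omega>) n \<subseteq> words K" if "\<omega> \<in> space M" for \<omega>
    proof -
      interpret tree_path "adj \<omega>" "path_at \<omega>" "c \<omega>" B "al \<omega>" by (rule tree[OF that])
      let ?V = "visited (path_at \<omega>) n"
      define K where "K = Max (insert 0 (length ` ?V \<union> Suc ` (\<Union>w\<in>?V. set w)))"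
      have fin: "finite (insert 0 (length ` ?V \<union> Suc ` (\<Union>w\<in>?V. set w)))" using finite_visited[of "real n"] by auto
      have "w \<in> words K" if w: "w \<in> ?V" for w
      proof -
        have "length w \<le> K" unfolding K_def by (rule Max_ge[OF fin]) (use w in auto)
        moreover have "Suc i \<le> K" if "i \<in> set w" for i
          unfolding K_def by (rule Max_ge[OF fin]) (use w that in auto)
        ultimately show ?thesis by (auto simp: words_def Suc_le_eq)
      qed
      then show ?thesis by blast
    qed
    then show ?thesis by blast
  qed
  finally have "(\<lambda>K. prob (?E K)) \<longlonglongrightarrow> 0" by simp
  then have "expectation al - exp (- real n / 2) - prob (away n) \<le> 0"
    by (rule LIMSEQ_le_const) (use le in blast)
  then show ?thesis by simp
qed

text \<open>The events \<open>away n\<close> need not be monotone, as the root may be left late.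
  Relaxing them to leaving at some time gives the events \<open>?N n\<close>, which decrease to the
  event of leaving forever.\<close>

theorem transient_if:
  assumes "0 < expectation al"
  shows "transient M X"
proof -
  let ?L = "{\<omega> \<in> space M. leaves_forever (path_at \<omega>)}"
  let ?V = "{\<omega> \<in> space M. \<exists>n::nat. \<exists>v. v \<noteq> [] \<and> v \<in> visited (path_at \<omega>) n}"
  let ?N = "\<lambda>n::nat. {\<omega> \<in> space M. \<not> returned (path_at \<omega>) [] n} \<inter> ?V"
  have [measurable]: "Measurable.pred M (\<lambda>\<omega>. returned (path_at \<omega>) [] (real n))"
    "Measurable.pred M (\<lambda>\<omega>. v \<in> visited (path_at \<omega>) (real n))" for n v
    by (rule measurable_from_history[OF history_returned[of "real n"]], simp)
      (rule measurable_from_history[OF history_visited[of "real n"]], simp)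
  have N: "?N n \<in> sets M" for n by measurable
  have L: "?L = (\<Inter>n. ?N n)"
  proof -
    have "leaves_forever (path_at \<omega>) \<longleftrightarrow> (\<exists>n::nat. \<exists>v. v \<noteq> [] \<and> v \<in> visited (path_at \<omega>) n)
        \<and> (\<forall>n::nat. \<not> returned (path_at \<omega>) [] n)" if "\<omega> \<in> space M" for \<omega>
      using countable_jump_path.leaves_forever_iff[OF countable_path[OF that]] X_start[OF that] by simp
    then show ?thesis by blast
  qed
  have "(\<lambda>n. prob (?N n)) \<longlonglongrightarrow> prob (\<Inter>n. ?N n)"
  proof (rule finite_Lim_measure_decseq)
    have "returned y [] (real n)" if "returned y [] (real m)" "m \<le> n" for m n and y :: "real \<Rightarrow> nat list"
    proof -
      have "s \<le> real n" if "s \<le> real m" for s using that \<open>m \<le> n\<close> by linarith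
      then show ?thesis using that(1) unfolding returned_def by blast
    qed
    then show "decseq ?N" unfolding decseq_def by blast
  qed (use N in auto)
  moreover have "(\<lambda>n. expectation al - exp (- real n / 2)) \<longlonglongrightarrow> expectation al - 0"
    by (intro tendsto_diff tendsto_const exp_half_tendsto)
  moreover have "expectation al - exp (- real n / 2) \<le> prob (?N n)" for n
  proof -
    have "prob (away n) \<le> prob (?N n)"
      by (rule finite_measure_mono) (use N in \<open>auto simp: away_def\<close>)
    then show ?thesis using prob_away_ge[of n] by simp
  qed
  ultimately have "expectation al - 0 \<le> prob (\<Inter>n. ?N n)"
    by (intro LIMSEQ_le[of _ _ "\<lambda>n. prob (?N n)"]) auto
  then show ?thesis using assms L by (simp add: transient_def)
qed

end

section \<open>Percolation on the Galton--Watson tree\<close>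

text \<open>Survival up to generation \<open>n\<close> of the subtree at \<open>u\<close> after independent bond percolation with
  retention probability \<open>0.36\<close>, each vertex keeping only its first \<open>B\<close> children.\<close>

fun survival :: "nat \<Rightarrow> nat \<Rightarrow> (nat list \<Rightarrow> nat \<Rightarrow> bool) \<Rightarrow> nat list \<Rightarrow> real" where
  "survival B 0 ch u = 1"
| "survival B (Suc n) ch u = 1 - (\<Prod>i<B. 1 - (if ch u i then 0.36 * survival B n ch (u @ [i]) else 0))"

lemma survival_bounds: "0 \<le> survival B n ch u \<and> survival B n ch u \<le> 1"
proof (induction n arbitrary: u)
  case (Suc n)
  have "0 \<le> 1 - (if ch u i then 0.36 * survival B n ch (u @ [i]) else 0)"
    "1 - (if ch u i then 0.36 * survival B n ch (u @ [i]) else 0) \<le> 1" for i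
    using Suc[of "u @ [i]"] by auto
  then have "0 \<le> (\<Prod>i<B. 1 - (if ch u i then 0.36 * survival B n ch (u @ [i]) else 0))"
    "(\<Prod>i<B. 1 - (if ch u i then 0.36 * survival B n ch (u @ [i]) else 0)) \<le> 1"
    by (blast intro: prod_nonneg prod_le_1)+
  then show ?case by simp
qed simp

lemma survival_decreasing: "survival B (Suc n) ch u \<le> survival B n ch u"
proof (induction n arbitrary: u)
  case 0
  show ?case using survival_bounds[of B "Suc 0" ch u] by simp
next
  case (Suc n)
  have "(\<Prod>i<B. 1 - (if ch u i then 0.36 * survival B n ch (u @ [i]) else 0))
      \<le> (\<Prod>i<B. 1 - (if ch u i then 0.36 * survival B (Suc n) ch (u @ [i]) else 0))"
  proof (rule prod_mono)
    fix i
    show "0 \<le> 1 - (if ch u i then 0.36 * survival B n ch (u @ [i]) else 0)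
      \<and> 1 - (if ch u i then 0.36 * survival B n ch (u @ [i]) else 0)
        \<le> 1 - (if ch u i then 0.36 * survival B (Suc n) ch (u @ [i]) else 0)"
      using Suc[of "u @ [i]"] survival_bounds[of B n ch "u @ [i]"] by auto
  qed
  then show ?case by simp
qed

definition survival_lim :: "nat \<Rightarrow> (nat list \<Rightarrow> nat \<Rightarrow> bool) \<Rightarrow> nat list \<Rightarrow> real" where
  "survival_lim B ch u = lim (\<lambda>n. survival B n ch u)"

lemma survival_tendsto: "(\<lambda>n. survival B n ch u) \<longlonglongrightarrow> survival_lim B ch u"
proof -
  have "decseq (\<lambda>n. survival B n ch u)" by (rule decseq_SucI) (rule survival_decreasing)
  then have "convergent (\<lambda>n. survival B n ch u)"
    using survival_bounds decseq_convergent[of "\<lambda>n. survival B n ch u" 0] by (metis convergentI)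
  then show ?thesis unfolding survival_lim_def by (rule convergent_LIMSEQ_iff[THEN iffD1])
qed

lemma survival_lim_bounds: "0 \<le> survival_lim B ch u" "survival_lim B ch u \<le> 1"
  by (rule LIMSEQ_le_const[OF survival_tendsto] LIMSEQ_le_const2[OF survival_tendsto];
      use survival_bounds in blast)+

text \<open>In the limit the recursion becomes a fixed point equation, and the union bound
  \<open>1 - (\<Prod>i. 1 - f i) \<le> (\<Sum>i. f i)\<close> turns it into the inequality required
  of the weights.\<close>

lemma survival_lim_le:
  "survival_lim B ch u \<le> 0.36 * (\<Sum>i | i < B \<and> ch u i. survival_lim B ch (u @ [i]))"
proof -
  let ?f = "\<lambda>i. if ch u i then 0.36 * survival_lim B ch (u @ [i]) else 0"
  have "(\<lambda>n. if ch u i then 0.36 * survival B n ch (u @ [i]) else 0) \<longlonglongrightarrow> ?f i" for i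
    by (auto intro!: tendsto_intros survival_tendsto)
  then have "(\<lambda>n. survival B (Suc n) ch u) \<longlonglongrightarrow> 1 - (\<Prod>i<B. 1 - ?f i)"
    by (simp only: survival.simps) (intro tendsto_diff tendsto_const tendsto_prod)
  moreover have "(\<lambda>n. survival B (Suc n) ch u) \<longlonglongrightarrow> survival_lim B ch u"
    by (rule LIMSEQ_Suc[OF survival_tendsto])
  ultimately have "survival_lim B ch u = 1 - (\<Prod>i<B. 1 - ?f i)"
    by (rule LIMSEQ_unique[rotated])
  also have "\<dots> \<le> (\<Sum>i<B. ?f i)"
  proof -
    have "?f i \<in> {0..1}" for i
      using survival_lim_bounds[of B ch "u @ [i]"] by simp
    then show ?thesis using Weierstrass_prod_ineq[of "{..<B}" ?f] by fastforce
  qed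
  also have "\<dots> = (\<Sum>i | i \<in> {..<B} \<and> ch u i. 0.36 * survival_lim B ch (u @ [i]))"
    by (rule sum.inter_filter[symmetric]) simp
  finally show ?thesis by (simp add: sum_distrib_left)
qed

text \<open>Survival below \<open>u\<close> depends on descendants of \<open>u\<close> only; this
  locality provides the independence of different subtrees.\<close>

lemma survival_cong:
  assumes "\<And>z i. ch (u @ z) i = ch' (u @ z) i"
  shows "survival B n ch u = survival B n ch' u"
  using assms
proof (induction n arbitrary: u)
  case (Suc n)
  have "survival B n ch (u @ [i]) = survival B n ch' (u @ [i])" for i
    by (rule Suc.IH) (use Suc.prems[of "i # z" for z] in simp)
  moreover have "ch u i = ch' u i" for i using Suc.prems[of "[]"] by simp
  ultimately show ?case by (simp cong: if_cong)
qed simp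

lemma survival_measurable:
  assumes "\<And>z i. Measurable.pred A (\<lambda>\<omega>. ch \<omega> (u @ z) i)"
  shows "(\<lambda>\<omega>. survival B n (ch \<omega>) u) \<in> borel_measurable A"
  using assms
proof (induction n arbitrary: u)
  case (Suc n)
  have [measurable]: "(\<lambda>\<omega>. survival B n (ch \<omega>) (u @ [i])) \<in> borel_measurable A" for i
    by (rule Suc.IH) (use Suc.prems[of "i # z" for z] in simp)
  have [measurable]: "Measurable.pred A (\<lambda>\<omega>. ch \<omega> u i)" for i using Suc.prems[of "[]"] by simp
  show ?case unfolding survival.simps by measurable
qed simp

lemma survival_lim_measurable:
  assumes "\<And>z i. Measurable.pred A (\<lambda>\<omega>. ch \<omega> (u @ z) i)"
  shows "(\<lambda>\<omega>. survival_lim B (ch \<omega>) u) \<in> borel_measurable A"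
  by (rule borel_measurable_LIMSEQ_real, rule survival_tendsto, rule survival_measurable, rule assms)

section \<open>Expected survival for i.i.d. offspring\<close>

context prob_space
begin

text \<open>The offspring number of \<open>u\<close> and the survival of the subtrees at its
  children are functions of disjoint blocks of labels, hence independent.\<close>

lemma expectation_prod_survival:
  fixes N :: "nat list \<Rightarrow> 'a \<Rightarrow> nat"
    and Z :: "nat \<Rightarrow> 'a \<Rightarrow> real"
  assumes ind: "indep_vars (\<lambda>_. count_space UNIV) N UNIV"
    and Z_def: "\<And>i \<omega>. Z i \<omega> = 1 - 0.36 * survival B n (\<lambda>w j. j < N w \<omega>) (u @ [i])"
  shows "expectation (\<lambda>\<omega>. of_bool (min (N u \<omega>) B = k) * (\<Prod>i<k. Z i \<omega>))
    = expectation (\<lambda>\<omega>. of_bool (min (N u \<omega>) B = k)) * (\<Prod>i<k. expectation (Z i))"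
proof -
  \<comment> \<open>Block 0 is \<open>u\<close> itself; block \<open>j > 0\<close> is the subtree at
    the child with index \<open>j - 1\<close>.\<close>
  define A where "A j = (if j = 0 then {u} else {u @ [j - 1] @ z | z. True})" for j :: nat
  define Y where "Y j f = (if j = 0 then of_bool (min (f u) B = k)
    else 1 - 0.36 * survival B n (\<lambda>w i. i < f w) (u @ [j - 1]))" for j :: nat and f :: "nat list \<Rightarrow> nat"
  have disj: "disjoint_family_on A {..k}"
    unfolding disjoint_family_on_def A_def by (auto split: if_splits)
  have Nm: "random_variable (count_space UNIV) (N w)" for w using ind by (simp add: indep_vars_def)
  have Ym: "Y j \<in> borel_measurable (PiM (A j) (\<lambda>_. count_space UNIV))" for j
  proof (cases "j = 0")
    case True
    have "(\<lambda>f. f u) \<in> measurable (PiM (A j) (\<lambda>_. count_space UNIV)) (count_space UNIV)"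
      by (rule measurable_component_singleton) (simp add: A_def True)
    then have "(\<lambda>f. (\<lambda>a. of_bool (min a B = k) :: real) (f u)) \<in> borel_measurable (PiM (A j) (\<lambda>_. count_space UNIV))"
      by (rule measurable_compose) simp
    then show ?thesis unfolding Y_def True by simp
  next
    case False
    have "(\<lambda>f. survival B n (\<lambda>w i. i < f w) (u @ [j - 1])) \<in> borel_measurable (PiM (A j) (\<lambda>_. count_space UNIV))"
    proof (rule survival_measurable)
      fix z i
      have "(\<lambda>f. f ((u @ [j - 1]) @ z)) \<in> measurable (PiM (A j) (\<lambda>_. count_space UNIV)) (count_space UNIV)"
        by (rule measurable_component_singleton) (use False in \<open>auto simp: A_def\<close>)
      from measurable_compose[OF this, of "\<lambda>a. i < a" "count_space UNIV"]
      show "Measurable.pred (PiM (A j) (\<lambda>_. count_space UNIV)) (\<lambda>f. i < f ((u @ [j - 1]) @ z))" by simp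
    qed
    then show ?thesis unfolding Y_def using False by simp
  qed
  have "indep_vars (\<lambda>j. PiM (A j) (\<lambda>_. count_space UNIV)) (\<lambda>j \<omega>. restrict (\<lambda>w. N w \<omega>) (A j)) {..k}"
    by (rule indep_vars_restrict[OF ind _ disj]) simp
  from indep_vars_compose2[OF this Ym]
  have "indep_vars (\<lambda>_. borel) (\<lambda>j \<omega>. Y j (restrict (\<lambda>w. N w \<omega>) (A j))) {..k}" .
  moreover have Y: "Y j (restrict (\<lambda>w. N w \<omega>) (A j)) = (if j = 0 then of_bool (min (N u \<omega>) B = k) else Z (j - 1) \<omega>)" for j \<omega>
  proof (cases "j = 0")
    case False
    have "survival B n (\<lambda>w i. i < restrict (\<lambda>w. N w \<omega>) (A j) w) (u @ [j - 1])
        = survival B n (\<lambda>w i. i < N w \<omega>) (u @ [j - 1])"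
      by (rule survival_cong) (use False in \<open>auto simp: A_def\<close>)
    then show ?thesis using False by (simp add: Y_def Z_def)
  qed (simp add: Y_def A_def)
  ultimately have indY: "indep_vars (\<lambda>_. borel) (\<lambda>j \<omega>. if j = 0 then of_bool (min (N u \<omega>) B = k) else Z (j - 1) \<omega>) {..k}"
    by simp
  have Zb: "0 \<le> Z i \<omega> \<and> Z i \<omega> \<le> 1" for i \<omega>
    using survival_bounds[of B n "\<lambda>w j. j < N w \<omega>" "u @ [i]"] by (simp add: Z_def)
  have rv: "(\<lambda>\<omega>. if j = 0 then of_bool (min (N u \<omega>) B = k) else Z (j - 1) \<omega>) \<in> borel_measurable M" if "j \<in> {..k}" for j
    using indY that by (simp add: indep_vars_def)
  have int: "integrable M (\<lambda>\<omega>. if j = 0 then of_bool (min (N u \<omega>) B = k) else Z (j - 1) \<omega>)" if "j \<in> {..k}" for j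
    by (rule integrable_const_bound[of _ 1]) (use rv[OF that] Zb in \<open>auto intro!: AE_I2\<close>)
  have prod: "(\<Prod>j\<le>k. g j) = g 0 * (\<Prod>i<k. g (Suc i))" for g :: "nat \<Rightarrow> real"
    by (simp add: prod.atMost_shift)
  have "expectation (\<lambda>\<omega>. \<Prod>j\<le>k. if j = 0 then of_bool (min (N u \<omega>) B = k) else Z (j - 1) \<omega>)
    = (\<Prod>j\<le>k. expectation (\<lambda>\<omega>. if j = 0 then of_bool (min (N u \<omega>) B = k) else Z (j - 1) \<omega>))"
    by (rule indep_vars_lebesgue_integral[OF _ indY int]) auto
  then show ?thesis unfolding prod by simp
qed

text \<open>Induction on \<open>n\<close> with a bound \<open>s\<close> that is preserved from one
  generation to the next: if the children survive with expected probability at least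
  \<open>s\<close>, then \<open>u\<close> does so with at least
  \<open>1 - E((1 - 0.36 * s) ^ min N B)\<close>, and the condition on \<open>s\<close> makes this
  at least \<open>s\<close>. The condition can be met by small positive \<open>s\<close> when
  \<open>0.36 * \<mu> > 1\<close>.\<close>

lemma expectation_survival_ge:
  fixes N :: "nat list \<Rightarrow> 'a \<Rightarrow> nat"
  assumes ind: "indep_vars (\<lambda>_. count_space UNIV) N UNIV"
    and mean: "\<And>u. \<mu> \<le> expectation (\<lambda>\<omega>. real (min (N u \<omega>) B))"
    and s: "0 \<le> s" "s \<le> 1" "1 + real B * (0.36 * s) \<le> 0.36 * \<mu>"
  shows "s \<le> expectation (\<lambda>\<omega>. survival B n (\<lambda>w j. j < N w \<omega>) u)"
proof (induction n arbitrary: u)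
  case 0
  show ?case using s by (simp add: prob_space)
next
  case (Suc n)
  define Z where "Z i \<omega> = 1 - 0.36 * survival B n (\<lambda>w j. j < N w \<omega>) (u @ [i])" for i \<omega>
  define G where "G \<omega> = min (N u \<omega>) B" for \<omega>
  define x where "x = 0.36 * s"
  have x: "0 \<le> x" "x \<le> 1" using s by (auto simp: x_def)
  have Nm [measurable]: "random_variable (count_space UNIV) (N w)" for w using ind by (simp add: indep_vars_def)
  have sm [measurable]: "(\<lambda>\<omega>. survival B n (\<lambda>w j. j < N w \<omega>) w) \<in> borel_measurable M" for n w
    by (rule survival_measurable) measurable
  have Zm [measurable]: "Z i \<in> borel_measurable M" for i unfolding Z_def by measurable
  have Gm [measurable]: "random_variable (count_space UNIV) G" unfolding G_def by measurable
  have Zb: "0 \<le> Z i \<omega> \<and> Z i \<omega> \<le> 1" for i \<omega>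
    using survival_bounds[of B n "\<lambda>w j. j < N w \<omega>" "u @ [i]"] by (simp add: Z_def)
  have int_s: "integrable M (\<lambda>\<omega>. survival B n (\<lambda>w j. j < N w \<omega>) w)" for n w
    by (rule integrable_const_bound[of _ 1]) (use survival_bounds in \<open>auto intro!: AE_I2\<close>)
  have EZ: "0 \<le> expectation (Z i)" "expectation (Z i) \<le> 1 - x" for i
  proof -
    show "0 \<le> expectation (Z i)" using Zb by (intro integral_nonneg_AE AE_I2) blast
    have "expectation (Z i) = 1 - 0.36 * expectation (\<lambda>\<omega>. survival B n (\<lambda>w j. j < N w \<omega>) (u @ [i]))"
      unfolding Z_def using int_s by (simp add: prob_space)
    then show "expectation (Z i) \<le> 1 - x" using Suc[of "u @ [i]"] by (simp add: x_def)
  qed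
  have pZ: "0 \<le> (\<Prod>i<k. Z i \<omega>) \<and> (\<Prod>i<k. Z i \<omega>) \<le> 1" for k \<omega>
    using Zb by (auto intro!: prod_nonneg prod_le_1)
  have int_k: "integrable M (\<lambda>\<omega>. of_bool (G \<omega> = k) * (\<Prod>i<k. Z i \<omega>))" for k
    by (rule integrable_const_bound[of _ 1]) (use pZ in \<open>auto intro!: AE_I2\<close>)
  have int_b: "integrable M (\<lambda>\<omega>. of_bool (G \<omega> = k) :: real)" for k
    by (rule integrable_const_bound[of _ 1]) (auto intro!: AE_I2)
  have int_G: "integrable M (\<lambda>\<omega>. real (G \<omega>))"
    by (rule integrable_const_bound[of _ "real B"]) (auto intro!: AE_I2 simp: G_def)
  \<comment> \<open>Conditioning on the truncated offspring number is carried out by splitting over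
    its finitely many values.\<close>
  have Gsum: "(\<Sum>k\<le>B. of_bool (G \<omega> = k) * f k) = f (G \<omega>)" for f :: "nat \<Rightarrow> real" and \<omega>
  proof -
    have "(\<Sum>k\<le>B. of_bool (G \<omega> = k) * f k) = (\<Sum>k\<in>{..B}. if G \<omega> = k then f k else 0)"
      by (intro sum.cong) auto
    then show ?thesis by (simp add: G_def)
  qed
  have surv: "survival B (Suc n) (\<lambda>w j. j < N w \<omega>) u = 1 - (\<Sum>k\<le>B. of_bool (G \<omega> = k) * (\<Prod>i<k. Z i \<omega>))" for \<omega>
  proof -
    have "(\<Prod>i<B. 1 - (if i < N u \<omega> then 0.36 * survival B n (\<lambda>w j. j < N w \<omega>) (u @ [i]) else 0))
        = (\<Prod>i<G \<omega>. Z i \<omega>)"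
      unfolding G_def Z_def by (rule prod.mono_neutral_cong_right) auto
    then show ?thesis unfolding Gsum[of \<omega> "\<lambda>k. \<Prod>i<k. Z i \<omega>"] by simp
  qed
  \<comment> \<open>By Bernoulli \<open>(1 - x) ^ k * (1 + k * x)\<close> is at most
    \<open>(1 - x * x) ^ k\<close>, hence at most 1. Enlarging \<open>k\<close> to \<open>B\<close>
    in the denominator makes the bound affine in \<open>k\<close>, so that only the mean
    enters.\<close>
  have bern: "(1 - x) ^ k \<le> 1 - x * real k / (1 + real B * x)" if "k \<le> B" for k
  proof -
    have "(1 - x) ^ k * (1 + real k * x) \<le> (1 - x) ^ k * (1 + x) ^ k"
      using x Bernoulli_inequality[of x k] by (intro mult_left_mono) auto
    also have "\<dots> = (1 - x\<^sup>2) ^ k" by (simp add: power_mult_distrib[symmetric] power2_eq_square algebra_simps)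
    also have "\<dots> \<le> 1" using x by (intro power_le_one) (auto simp: power2_eq_square mult_le_one)
    finally have "(1 - x) ^ k \<le> 1 / (1 + real k * x)" using x by (simp add: pos_le_divide_eq add_pos_nonneg)
    also have "\<dots> = 1 - x * real k / (1 + real k * x)"
    proof -
      have "1 + real k * x \<noteq> 0" using x by (intro add_pos_nonneg[THEN less_imp_neq, symmetric]) auto
      then show ?thesis by (simp add: field_simps)
    qed
    also have "\<dots> \<le> 1 - x * real k / (1 + real B * x)"
      using x that by (intro diff_left_mono divide_left_mono mult_right_mono add_left_mono mult_pos_pos)
        (auto intro!: add_pos_nonneg)
    finally show ?thesis .
  qed
  have "expectation (\<lambda>\<omega>. \<Sum>k\<le>B. of_bool (G \<omega> = k) * (\<Prod>i<k. Z i \<omega>))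
    = (\<Sum>k\<le>B. expectation (\<lambda>\<omega>. of_bool (G \<omega> = k) * (\<Prod>i<k. Z i \<omega>)))"
    by (rule Bochner_Integration.integral_sum[OF int_k])
  also have "\<dots> = (\<Sum>k\<le>B. expectation (\<lambda>\<omega>. of_bool (G \<omega> = k)) * (\<Prod>i<k. expectation (Z i)))"
    unfolding G_def using expectation_prod_survival[OF ind, of Z B n u] by (intro sum.cong refl) (simp add: Z_def)
  also have "\<dots> \<le> (\<Sum>k\<le>B. expectation (\<lambda>\<omega>. of_bool (G \<omega> = k)) * (1 - x) ^ k)"
  proof (intro sum_mono mult_left_mono)
    fix k
    have "(\<Prod>i<k. expectation (Z i)) \<le> (\<Prod>i<k. 1 - x)" by (rule prod_mono) (use EZ in auto)
    then show "(\<Prod>i<k. expectation (Z i)) \<le> (1 - x) ^ k" by simp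
  qed (auto intro!: integral_nonneg_AE)
  also have "\<dots> \<le> (\<Sum>k\<le>B. expectation (\<lambda>\<omega>. of_bool (G \<omega> = k)) * (1 - x * real k / (1 + real B * x)))"
    using bern by (intro sum_mono mult_left_mono) (auto intro!: integral_nonneg_AE)
  also have "\<dots> = expectation (\<lambda>\<omega>. \<Sum>k\<le>B. of_bool (G \<omega> = k) * (1 - x * real k / (1 + real B * x)))"
    using int_b by (subst Bochner_Integration.integral_sum) auto
  also have "\<dots> = expectation (\<lambda>\<omega>. 1 - x * real (G \<omega>) / (1 + real B * x))"
    by (simp only: Gsum)
  also have "\<dots> = 1 - x * expectation (\<lambda>\<omega>. real (G \<omega>)) / (1 + real B * x)"
    using int_G by (simp add: prob_space)
  also have "\<dots> \<le> 1 - s"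
  proof -
    have pos: "0 < 1 + real B * x" using x by (auto intro!: add_pos_nonneg)
    have "1 + real B * x \<le> 0.36 * expectation (\<lambda>\<omega>. real (G \<omega>))"
      using s(3) mean[of u] unfolding x_def G_def by simp
    then have "s * (1 + real B * x) \<le> s * (0.36 * expectation (\<lambda>\<omega>. real (G \<omega>)))"
      using s(1) by (rule mult_left_mono)
    also have "\<dots> = x * expectation (\<lambda>\<omega>. real (G \<omega>))" by (simp add: x_def)
    finally show ?thesis using pos by (simp add: pos_le_divide_eq)
  qed
  finally have "expectation (\<lambda>\<omega>. \<Sum>k\<le>B. of_bool (G \<omega> = k) * (\<Prod>i<k. Z i \<omega>)) \<le> 1 - s" .
  moreover have "expectation (\<lambda>\<omega>. survival B (Suc n) (\<lambda>w j. j < N w \<omega>) u)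
      = 1 - expectation (\<lambda>\<omega>. \<Sum>k\<le>B. of_bool (G \<omega> = k) * (\<Prod>i<k. Z i \<omega>))"
    unfolding surv
    by (subst Bochner_Integration.integral_diff[OF integrable_const Bochner_Integration.integrable_sum[OF int_k]])
      (simp add: prob_space)
  ultimately show ?case by simp
qed

end

text \<open>This allows bounded families to be used while the mean stays above the
  threshold.\<close>

lemma truncated_mean:
  fixes p :: "nat pmf"
  assumes "integrable (measure_pmf p) real" "a < measure_pmf.expectation p real"
  shows "\<exists>B. a < measure_pmf.expectation p (\<lambda>k. real (min k B))"
proof -
  have "(\<lambda>B. measure_pmf.expectation p (\<lambda>k. real (min k B))) \<longlonglongrightarrow> measure_pmf.expectation p real"
  proof (rule integral_dominated_convergence[OF _ _ assms(1)])
    show "AE k in measure_pmf p. (\<lambda>B. real (min k B)) \<longlonglongrightarrow> real k"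
    proof (rule AE_I2)
      fix k
      have "\<forall>\<^sub>F B in sequentially. real (min k B) = real k"
        by (rule eventually_sequentiallyI[of k]) simp
      then show "(\<lambda>B. real (min k B)) \<longlonglongrightarrow> real k" by (rule tendsto_eventually)
    qed
  qed auto
  from order_tendstoD(1)[OF this assms(2)] show ?thesis
    by (auto simp: eventually_sequentially)
qed

section \<open>Transience\<close>

lemma gw_tree_snoc: "u @ [i] \<in> gw_tree N \<longleftrightarrow> u \<in> gw_tree N \<and> i < N u"
proof
  assume "u @ [i] \<in> gw_tree N"
  then show "u \<in> gw_tree N \<and> i < N u" by cases auto
qed (auto intro: gw_tree.child)

lemma tree_adj_child: "tree_adj (gw_tree N) u (u @ [i]) \<longleftrightarrow> u \<in> gw_tree N \<and> i < N u"
  by (auto simp: tree_adj_def gw_tree_snoc)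

text \<open>The weights must be functions of adjacency, which the history contains, whereas
  independence is available for the offspring numbers of all words. On vertices of the tree both
  give the same survival probability.\<close>

lemma survival_gw_tree:
  assumes "u \<in> gw_tree N"
  shows "survival B n (\<lambda>w i. tree_adj (gw_tree N) w (w @ [i])) u = survival B n (\<lambda>w i. i < N w) u"
  using assms
proof (induction n arbitrary: u)
  case (Suc n)
  have "(if tree_adj (gw_tree N) u (u @ [i])
        then 0.36 * survival B n (\<lambda>w i. tree_adj (gw_tree N) w (w @ [i])) (u @ [i]) else 0)
      = (if i < N u then 0.36 * survival B n (\<lambda>w i. i < N w) (u @ [i]) else 0)" for i
    using Suc.IH[of "u @ [i]"] Suc.prems by (simp add: tree_adj_child gw_tree_snoc)
  then show ?case by (simp only: survival.simps)
qed simp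

theorem theorem3:
  fixes M :: "'w measure"
    and p :: "nat pmf"
    and m :: real
    and N :: "nat list \<Rightarrow> 'w \<Rightarrow> nat"
    and X :: "real \<Rightarrow> 'w \<Rightarrow> nat list"
  assumes "prob_space M"
    and "iid_offspring M p N"
    and "integrable (measure_pmf p) real"
    and "measure_pmf.expectation p real = m"
    and "1 / 0.36 < m"
    and "vrjp M (\<lambda>\<omega>. tree_adj (gw_tree (\<lambda>u. N u \<omega>))) [] X"
  shows "transient M X"
proof -
  define adj where "adj \<omega> = tree_adj (gw_tree (\<lambda>u. N u \<omega>))" for \<omega>
  have vrjp: "vrjp M adj [] X" using assms(6) unfolding adj_def .
  then interpret vrjp M adj "[]" X .
  obtain B where B: "1 / 0.36 < measure_pmf.expectation p (\<lambda>k. real (min k B))"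
    using truncated_mean[OF assms(3), of "1 / 0.36"] assms(4,5) by auto
  define \<mu> where "\<mu> = measure_pmf.expectation p (\<lambda>k. real (min k B))"
  have B0: "0 < B" using B by (cases "B = 0") auto
  have \<mu>: "1 < 0.36 * \<mu>" using B by (simp add: \<mu>_def)
  have \<mu>B: "\<mu> \<le> real B"
    unfolding \<mu>_def by (rule measure_pmf.integral_le_const)
      (auto intro!: AE_I2 measure_pmf.integrable_const_bound[of _ "real B"])
  have ind: "indep_vars (\<lambda>_. count_space UNIV) N UNIV"
    and distr: "distr M (count_space UNIV) (N u) = measure_pmf p" for u
    using assms(2) by (auto simp: iid_offspring_def)
  have Nm: "random_variable (count_space UNIV) (N u)" for u using ind by (simp add: indep_vars_def)
  have mean: "\<mu> \<le> expectation (\<lambda>\<omega>. real (min (N u \<omega>) B))" for u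
    using integral_distr[OF Nm, of "\<lambda>k. real (min k B)" u] unfolding \<mu>_def distr by simp
  define \<theta> where "\<theta> \<omega> = survival_lim B (\<lambda>w i. adj \<omega> w (w @ [i]))" for \<omega>
  \<comment> \<open>Scaling preserves the inequality for the survival probabilities, and as these
    are at most 1 the chosen factor gives \<open>c_le\<close>.\<close>
  define c where "c \<omega> u = \<theta> \<omega> u / (10 * real B)" for \<omega> u
  \<comment> \<open>The largest value compatible with \<open>al_le\<close>; the summand 1 / 2 keeps
    the denominator positive for a root without children.\<close>
  define al where "al \<omega> = (\<Sum>i | i < B \<and> adj \<omega> [] [i]. c \<omega> [i]) / (real (card {v. adj \<omega> [] v}) + 1 / 2)" for \<omega>
  have \<theta>: "0 \<le> \<theta> \<omega> u" "\<theta> \<omega> u \<le> 1" for \<omega> u unfolding \<theta>_def using survival_lim_bounds by auto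
  have \<theta>_sub: "\<theta> \<omega> u \<le> 0.36 * (\<Sum>i | i < B \<and> adj \<omega> u (u @ [i]). \<theta> \<omega> (u @ [i]))" for \<omega> u
    unfolding \<theta>_def by (rule survival_lim_le)
  have c_sum: "(\<Sum>i | P i. c \<omega> (u @ [i])) = (\<Sum>i | P i. \<theta> \<omega> (u @ [i])) / (10 * real B)" for P \<omega> u
    unfolding c_def sum_divide_distrib ..
  have c_sub: "c \<omega> u \<le> 0.36 * (\<Sum>i | i < B \<and> adj \<omega> u (u @ [i]). c \<omega> (u @ [i]))" for \<omega> u
    unfolding c_sum using divide_right_mono[OF \<theta>_sub, of "10 * real B" \<omega> u] by (simp add: c_def)
  have c0: "0 \<le> c \<omega> u" for \<omega> u using \<theta> by (simp add: c_def)
  have al0: "0 \<le> al \<omega>" for \<omega> unfolding al_def using c0 by (intro divide_nonneg_pos sum_nonneg) (auto intro: add_nonneg_pos)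
  have \<theta>m: "(\<lambda>\<omega>. \<theta> \<omega> u) \<in> borel_measurable (history M adj X 0)" for u
    unfolding \<theta>_def by (rule survival_lim_measurable) (rule history_adj)
  have cm: "(\<lambda>\<omega>. c \<omega> u) \<in> borel_measurable (history M adj X 0)" for u
    unfolding c_def using \<theta>m by measurable
  have alm: "al \<in> borel_measurable (history M adj X 0)"
  proof -
    note [measurable] = cm history_adj
    \<comment> \<open>Indexing the neighbours of the root by numbers turns the degree into the
      cardinality of a random set of naturals, which is measurable.\<close>
    have "card {v. adj \<omega> [] v} = card {i. adj \<omega> [] [i]}" for \<omega>
    proof -
      have "{v. adj \<omega> [] v} = (\<lambda>i. [i]) ` {i. adj \<omega> [] [i]}" by (auto simp: adj_def tree_adj_def)
      then show ?thesis by (simp add: card_image inj_on_def)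
    qed
    then have "al = (\<lambda>\<omega>. (\<Sum>i<B. if adj \<omega> [] [i] then c \<omega> [i] else 0) / (real (card {i. adj \<omega> [] [i]}) + 1 / 2))"
      unfolding al_def by (intro ext) (simp flip: sum.inter_filter)
    moreover have "(\<lambda>\<omega>. (\<Sum>i<B. if adj \<omega> [] [i] then c \<omega> [i] else 0) / (real (card {i. adj \<omega> [] [i]}) + 1 / 2))
        \<in> borel_measurable (history M adj X 0)" by measurable
    ultimately show ?thesis by simp
  qed
  interpret weighted_vrjp M adj X c B al
  proof (rule weighted_vrjp.intro[OF vrjp], rule weighted_vrjp_axioms.intro)
    fix \<omega> assume \<omega>: "\<omega> \<in> space M"
    show "weighted_tree (adj \<omega>) (c \<omega>) B (al \<omega>)"
    proof
      show "\<exists>i. v = u @ [i] \<or> u = v @ [i]" if "adj \<omega> u v" for u v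
        using that by (auto simp: adj_def tree_adj_def)
      show "finite {v. adj \<omega> u v}" for u using locally_finite[OF \<omega>] .
      show "c \<omega> u * (10 * real B) \<le> 1" for u using \<theta> B0 by (simp add: c_def)
      have "0 < real (card {v. adj \<omega> [] v}) + 1 / 2" by (simp add: add_nonneg_pos)
      then show "al \<omega> * (real (card {v. adj \<omega> [] v}) + 1 / 2) \<le> (\<Sum>i | i < B \<and> adj \<omega> [] [i]. c \<omega> [i])"
        by (simp add: al_def)
    qed (use c0 c_sub al0 in auto)
  qed (rule cm alm)+
  \<comment> \<open>If \<open>al\<close> vanished almost surely, so would the weights of the
    children of the root and hence the survival probability at the root, contrary to its positive
    expectation.\<close>
  have "0 < expectation al"
  proof (rule ccontr)
    assume "\<not> 0 < expectation al"
    then have "expectation al = 0" using integral_nonneg_AE[of al M] al0 by (simp add: not_less order_antisym)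
    then have "AE \<omega> in M. al \<omega> = 0"
      using integral_nonneg_eq_0_iff_AE[OF integrable_al] al0 by simp
    then have AE0: "AE \<omega> in M. \<theta> \<omega> [] = 0"
    proof eventually_elim
      fix \<omega> assume "al \<omega> = 0"
      moreover have "0 < real (card {v. adj \<omega> [] v}) + 1 / 2" by (simp add: add_nonneg_pos)
      ultimately have "(\<Sum>i | i < B \<and> adj \<omega> [] [i]. c \<omega> [i]) = 0" by (simp add: al_def)
      then have "c \<omega> [] \<le> 0" using c_sub[of \<omega> "[]"] by simp
      then show "\<theta> \<omega> [] = 0" using \<theta>(1)[of \<omega> "[]"] B0 by (simp add: c_def divide_le_0_iff)
    qed
    \<comment> \<open>The solution of \<open>1 + real B * (0.36 * s) = 0.36 * \<mu>\<close>,
      positive by the choice of \<open>B\<close>.\<close>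
    define s where "s = (0.36 * \<mu> - 1) / (0.36 * real B)"
    have "(0.36 * real B) * s = 0.36 * \<mu> - 1" unfolding s_def using B0 by simp
    moreover have "real B * (0.36 * s) = (0.36 * real B) * s" by simp
    ultimately have "1 + real B * (0.36 * s) \<le> 0.36 * \<mu>" by linarith
    moreover have "0 < s" "s \<le> 1" using \<mu> \<mu>B B0 by (auto simp: s_def divide_le_eq)
    ultimately have s: "0 < s" "s \<le> 1" "1 + real B * (0.36 * s) \<le> 0.36 * \<mu>" by auto
    have "(\<lambda>n. expectation (\<lambda>\<omega>. survival B n (\<lambda>w i. adj \<omega> w (w @ [i])) [])) \<longlonglongrightarrow> expectation (\<lambda>\<omega>. \<theta> \<omega> [])"
    proof (rule integral_dominated_convergence[where w="\<lambda>_. 1"])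
      show "AE \<omega> in M. (\<lambda>n. survival B n (\<lambda>w i. adj \<omega> w (w @ [i])) []) \<longlonglongrightarrow> \<theta> \<omega> []"
        unfolding \<theta>_def by (intro AE_I2 survival_tendsto)
      show "(\<lambda>\<omega>. survival B n (\<lambda>w i. adj \<omega> w (w @ [i])) []) \<in> borel_measurable M" for n
        by (rule survival_measurable) (rule adj_measurable)
      show "AE \<omega> in M. norm (survival B n (\<lambda>w i. adj \<omega> w (w @ [i])) []) \<le> 1" for n
        using survival_bounds by (intro AE_I2) auto
    qed (use measurable_from_history[OF \<theta>m] in auto)
    moreover have "s \<le> expectation (\<lambda>\<omega>. survival B n (\<lambda>w i. adj \<omega> w (w @ [i])) [])" for n
      using expectation_survival_ge[OF ind mean less_imp_le[OF s(1)] s(2,3), of n "[]"]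
      by (simp add: adj_def survival_gw_tree gw_tree.root)
    ultimately have "s \<le> expectation (\<lambda>\<omega>. \<theta> \<omega> [])" by (intro LIMSEQ_le_const) auto
    moreover have "expectation (\<lambda>\<omega>. \<theta> \<omega> []) = 0"
      using AE0 by (simp add: integral_eq_zero_AE)
    ultimately show False using s(1) by simp
  qed
  then show ?thesis by (rule transient_if)
qed

end
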